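(* Let $t\ge 2$, let $(D,\mathcal R)$ be any $k$-CSP and let $\rho$ be a distribution over $\mathcal R$. Then there is $c_k>0$ depending only on $k$ such that, except with probability $o_n(1)$, a binomial $\rho$-random instance $\mathcal I$ of the CSP with $n$ variables and $\Delta n$ expected constraints has an SoS solution (pseudo-distribution) $\mu$ of degree at least $c_k\,n/(\Delta^{2/(t-1)}\log\Delta)$ and of value $\widetilde{\mathbb E}_\mu \mathrm{Val}_{\mathcal I}(x)=\mathrm{opt}_t(\rho)+o_n(1)$.
   Context: A $k$-CSP is a pair $(D,\mathcal R)$ with $D$ a finite domain and $\mathcal R$ a collection of relations $R\subseteq D^k$. An instance $\mathcal I=(V,\mathcal C)$ has variables $V$ and a multiset $\mathcal C$ of constraints $(\sigma,R)$, $R\in\mathcal R$, $\sigma:[k]\to V$ injective; $\mathrm{Val}_{\mathcal I}(x)=\Pr_{(\sigma,R)\sim\mathcal C}[x\circ\sigma\in R]$. Binomial $\rho$-random instance: on $n$ variables, each $k$-subset $e$ is independently selected with probability $p$; for each selected $e$ independently pick a uniformly random bijection $\sigma:[k]\to e$ and $R\sim\rho$ and add $(\sigma,R)$; expected number of constraints $p\binom nk$. A distribution on $D^k$ is $t$-wise $\nu$-independent if all its marginals on $t$-subsets $T\subseteq[k]$ equal $\nu^T$. $\mathrm{opt}_t(\rho)$ is the maximum of $\mathbb E_{R\sim\rho}\Pr_{x\sim\mu^R}[x\in R]$ over all distributions $\nu$ on $D$ and all tuples $(\mu^R)_{R\in\mathcal R}$ of $t$-wise $\nu$-independent distributions on $D^k$.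 Pseudo-distributions: indeterminates $x_{v,a}$ ($v\in V,a\in D$); a degree-$d$ pseudo-distribution is a linear functional $\widetilde{\mathbb E}$ on polynomials of degree $\le d$ with $\widetilde{\mathbb E}[1]=1$, $\widetilde{\mathbb E}[q^2]\ge0$ for $\deg q\le d/2$, and $\widetilde{\mathbb E}[hq]=0$ for $h\in\{\sum_a x_{v,a}^2-1\}\cup\{x_{v,a}x_{v,a'}:a\neq a'\}$ and $\deg(hq)\le d$. The value is $\widetilde{\mathbb E}\,\mathrm{Val}_{\mathcal I}(x)$ where $\mathrm{Val}_{\mathcal I}(x)=\frac1{|\mathcal C|}\sum_{(\sigma,R)\in\mathcal C}\sum_{b\in R}\prod_{i=1}^k x_{\sigma(i),b_i}$.
   Formalization: Proved for t ≤ k and, for all large n, Δ ≥ 2, Δn at most binom(n,k), and degree bound c_k n/(Δ^{2/(t-1)} log Δ) at least k; the claim fails for Δ slightly above 1 (random 3-XOR) and for t > k, and the value is undefined below degree k. *)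

theory Defs
  imports "HOL-Probability.Probability" "HOL-Probability.Product_PMF" "HOL-Library.Poly_Mapping"
begin

section \<open>Constraint satisfaction problems\<close>

text \<open>
  The index set \<open>[k]\<close> is \<open>{..<k}\<close>, and \<open>S\<^sup>k\<close> is the set of functions \<open>[k] \<rightarrow> S\<close>, represented
  extensionally (value \<open>undefined\<close> outside \<open>[k]\<close>).
\<close>

abbreviation tuples :: "nat \<Rightarrow> 'a set \<Rightarrow> (nat \<Rightarrow> 'a) set" where
  "tuples k S \<equiv> {..<k} \<rightarrow>\<^sub>E S"

type_synonym 'd relation = "(nat \<Rightarrow> 'd) set"

type_synonym ('v, 'd) constraint = "(nat \<Rightarrow> 'v) \<times> 'd relation"

definition is_csp :: "nat \<Rightarrow> 'd set \<Rightarrow> 'd relation set \<Rightarrow> bool" where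
  "is_csp k D \<R> \<longleftrightarrow> finite D \<and> D \<noteq> {} \<and> (\<forall>R\<in>\<R>. R \<subseteq> tuples k D)"

subsection \<open>Binomial random instances\<close>

definition random_constraint ::
    "nat \<Rightarrow> 'd relation pmf \<Rightarrow> 'v set \<Rightarrow> ('v, 'd) constraint pmf" where
  "random_constraint k \<rho> e =
     pair_pmf (pmf_of_set {\<sigma> \<in> tuples k e. bij_betw \<sigma> {..<k} e}) \<rho>"

text \<open>
  The variable set is \<open>{..<n}\<close>; only the multiset of constraints is random.  The outcome at a
  \<open>k\<close>-subset \<open>e\<close> is \<open>None\<close> if \<open>e\<close> is not selected.
\<close>

definition random_instance ::
    "nat \<Rightarrow> nat \<Rightarrow> real \<Rightarrow> 'd relation pmf \<Rightarrow> (nat, 'd) constraint multiset pmf" where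
  "random_instance k n p \<rho> =
     (let E = {e. e \<subseteq> {..<n} \<and> card e = k} in
      map_pmf (\<lambda>f. \<Sum>e\<in>E. case f e of None \<Rightarrow> {#} | Some c \<Rightarrow> {#c#})
        (Pi_pmf E None
          (\<lambda>e. bernoulli_pmf p \<bind> (\<lambda>selected.
                 if selected then map_pmf Some (random_constraint k \<rho> e)
                 else return_pmf None))))"

subsection \<open>The optimum over \<open>t\<close>-wise independent distributions\<close>

definition twise_independent ::
    "nat \<Rightarrow> nat \<Rightarrow> 'd pmf \<Rightarrow> (nat \<Rightarrow> 'd) pmf \<Rightarrow> bool" where
  "twise_independent k t \<nu> \<mu> \<longleftrightarrow>
     (\<forall>T. T \<subseteq> {..<k} \<and> card T = t \<longrightarrow>
        map_pmf (\<lambda>x. restrict x T) \<mu> = Pi_pmf T undefined (\<lambda>_. \<nu>))"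

text \<open>
  The supremum is over a nonempty set of numbers in \<open>[0,1]\<close> and is attained: for finite \<open>D\<close> the
  admissible \<open>\<nu>\<close> and \<open>\<mu>\<close> form a compact set.
\<close>

definition opt ::
    "nat \<Rightarrow> 'd set \<Rightarrow> 'd relation set \<Rightarrow> nat \<Rightarrow> 'd relation pmf \<Rightarrow> real" where
  "opt k D \<R> t \<rho> =
     Sup {measure_pmf.expectation \<rho> (\<lambda>R. measure_pmf.prob (\<mu> R) R) | \<nu> \<mu>.
            set_pmf \<nu> \<subseteq> D \<and>
            (\<forall>R\<in>\<R>. set_pmf (\<mu> R) \<subseteq> tuples k D \<and> twise_independent k t \<nu> (\<mu> R))}"

section \<open>Pseudo-distributions\<close>

text \<open>
  Real polynomials in commuting indeterminates indexed by \<open>'x\<close>: finitely supported maps from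
  monomials (finitely supported exponent vectors) to coefficients.
\<close>

type_synonym 'x mpolynomial = "('x \<Rightarrow>\<^sub>0 nat) \<Rightarrow>\<^sub>0 real"

definition Var :: "'x \<Rightarrow> 'x mpolynomial" where
  "Var i = Poly_Mapping.single (Poly_Mapping.single i 1) 1"

definition Const :: "real \<Rightarrow> 'x mpolynomial" where
  "Const c = Poly_Mapping.single 0 c"

definition monomial_degree :: "('x \<Rightarrow>\<^sub>0 nat) \<Rightarrow> nat" where
  "monomial_degree m = (\<Sum>i\<in>Poly_Mapping.keys m. Poly_Mapping.lookup m i)"

definition polys :: "'x set \<Rightarrow> 'x mpolynomial set" where
  "polys I = {q. \<forall>m\<in>Poly_Mapping.keys q. Poly_Mapping.keys m \<subseteq> I}"

definition degree_le :: "'x mpolynomial \<Rightarrow> nat \<Rightarrow> bool" where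
  "degree_le q d \<longleftrightarrow> (\<forall>m\<in>Poly_Mapping.keys q. monomial_degree m \<le> d)"

definition label_constraints :: "'v set \<Rightarrow> 'd set \<Rightarrow> ('v \<times> 'd) mpolynomial set" where
  "label_constraints V D =
     {(\<Sum>a\<in>D. Var (v, a) ^ 2) - 1 | v. v \<in> V} \<union>
     {Var (v, a) * Var (v, b) | v a b. v \<in> V \<and> a \<in> D \<and> b \<in> D \<and> a \<noteq> b}"

text \<open>
  The functional is a total function, but only its values on \<open>{q \<in> polys (V \<times> D). degree_le q d}\<close>
  are meaningful.
\<close>

definition pseudo_distribution ::
    "'v set \<Rightarrow> 'd set \<Rightarrow> nat \<Rightarrow> (('v \<times> 'd) mpolynomial \<Rightarrow> real) \<Rightarrow> bool" where
  "pseudo_distribution V D d \<mu> \<longleftrightarrow>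
     (\<forall>p\<in>polys (V \<times> D). \<forall>q\<in>polys (V \<times> D). degree_le p d \<and> degree_le q d \<longrightarrow>
        \<mu> (p + q) = \<mu> p + \<mu> q) \<and>
     (\<forall>c. \<forall>q\<in>polys (V \<times> D). degree_le q d \<longrightarrow> \<mu> (Const c * q) = c * \<mu> q) \<and>
     \<mu> 1 = 1 \<and>
     (\<forall>q\<in>polys (V \<times> D). degree_le q (d div 2) \<longrightarrow> 0 \<le> \<mu> (q ^ 2)) \<and>
     (\<forall>h\<in>label_constraints V D. \<forall>q\<in>polys (V \<times> D). degree_le (h * q) d \<longrightarrow> \<mu> (h * q) = 0)"

definition val_poly :: "nat \<Rightarrow> ('v, 'd) constraint multiset \<Rightarrow> ('v \<times> 'd) mpolynomial" where
  "val_poly k C =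
     Const (1 / real (size C)) * (\<Sum>(\<sigma>, R)\<in>#C. \<Sum>b\<in>R. \<Prod>i<k. Var (\<sigma> i, b i))"

end

theory Submission
  imports Defs
begin

text \<open>
  Fix near-optimal \<open>\<nu>\<close> and \<open>\<mu>\<^sup>R\<close>, and let \<open>u e = \<mu>\<^sup>R / \<nu>\<^sup>k - 1\<close> be the relative density of the
  constraint at the hyperedge \<open>e\<close>, minus one.  The pseudo-expectation of \<open>F\<close> is
  \<open>\<Sum>X. E\<^sub>\<nu>[(\<Prod>e\<in>X. u e) * F]\<close> over all sets \<open>X\<close> of at most \<open>N\<close> constraints.  By \<open>t\<close>-wise
  independence a nonzero term needs, for every \<open>e\<close> in \<open>X\<close>, a set of more than \<open>t\<close> variables of
  \<open>e\<close> such that every variable not seen by \<open>F\<close> is used at least twice.  In a hypergraph in which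
  every small set \<open>X\<close> spans at least \<open>(k - (t + 1 - \<zeta>) / 2) * card X\<close> variables, such \<open>X\<close> are
  small and lie in a small closure, on which the pseudo-expectation is an honest expectation.
  Positivity is a Gram--Schmidt argument: process the indicators of partial assignments to \<open>S\<close> by
  increasing \<open>card S\<close> and project each one only onto earlier indicators inside the closure of
  \<open>S\<close>.  The residual is orthogonal to all earlier indicators, because averaging an indicator
  of \<open>T\<close> onto the closure yields functions of fewer than \<open>card T\<close> variables.
  A random hypergraph expands by a first moment bound with \<open>\<zeta> = 1 / (4 ln \<Delta>)\<close>, and the
  constraints on which the pseudo-expectation differs from \<open>\<mu>\<^sup>R\<close> are few by another one.
\<close>

section \<open>Averaging over independent coordinates\<close>

text \<open>Positivity is the obstacle. On one closure the functional is integration against a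
  nonnegative density, but a polynomial of degree \<open>r\<close> mixes indicators of sets without
  a common small closure, so no single honest distribution computes its square. After
  orthogonalization every residual lives on one closure, and only the squares of residuals have to
  be nonnegative.

  The exponents come from the first moment. Families of \<open>j\<close> edges confined to
  \<open>(k - (t + 1 - \<zeta>) / 2) * j\<close> variables number in expectation at most
  \<open>(const * \<Delta> * (j / n) powr ((t - 1 - \<zeta>) / 2)) ^ j\<close>. This decays for
  \<open>j\<close> up to order \<open>n / \<Delta> powr (2 / (t - 1))\<close> as long as
  \<open>\<Delta> powr \<zeta>\<close> is bounded, hence \<open>\<zeta>\<close> of order
  \<open>1 / ln \<Delta>\<close>. The closure of \<open>r\<close> variables can have size of order
  \<open>r / \<zeta>\<close>; this turns the range of \<open>j\<close> into the degree and is the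
  source of the factor \<open>ln \<Delta>\<close>.\<close>

definition depends :: "(('v \<Rightarrow> 'd) \<Rightarrow> real) \<Rightarrow> 'v set \<Rightarrow> bool" where
  "depends F S \<longleftrightarrow> (\<forall>x y. (\<forall>v\<in>S. x v = y v) \<longrightarrow> F x = F y)"

lemma depends_mono: "depends F S \<Longrightarrow> S \<subseteq> T \<Longrightarrow> depends F T"
  unfolding depends_def by blast

lemma depends_const [simp]: "depends (\<lambda>x. c) S"
  unfolding depends_def by blast

lemma depends_mult: "depends F S \<Longrightarrow> depends G S \<Longrightarrow> depends (\<lambda>x. F x * G x) S"
  unfolding depends_def by metis

lemma depends_diff: "depends F S \<Longrightarrow> depends G S \<Longrightarrow> depends (\<lambda>x. F x - G x) S"
  unfolding depends_def by metis

lemma depends_prod: "(\<And>i. i \<in> I \<Longrightarrow> depends (F i) S) \<Longrightarrow> depends (\<lambda>x. \<Prod>i\<in>I. F i x) S"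
  unfolding depends_def by (intro allI impI prod.cong) auto

lemma depends_sum: "(\<And>i. i \<in> I \<Longrightarrow> depends (F i) S) \<Longrightarrow> depends (\<lambda>x. \<Sum>i\<in>I. F i x) S"
  unfolding depends_def by (intro allI impI sum.cong) auto

locale weights =
  fixes A :: "'d set" and w :: "'d \<Rightarrow> real"
  assumes finA: "finite A" and wpos: "\<And>a. a \<in> A \<Longrightarrow> w a \<ge> 0" and wsum: "(\<Sum>a\<in>A. w a) = 1"
begin

definition avg :: "'v \<Rightarrow> (('v \<Rightarrow> 'd) \<Rightarrow> real) \<Rightarrow> ('v \<Rightarrow> 'd) \<Rightarrow> real" where
  "avg v F x = (\<Sum>a\<in>A. w a * F (x(v := a)))"

text \<open>Conditional expectation given the coordinates outside \<open>Z\<close>. The result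
  remains a function of the whole assignment, so that the operators for different sets
  compose.\<close>

definition avgs :: "'v set \<Rightarrow> (('v \<Rightarrow> 'd) \<Rightarrow> real) \<Rightarrow> ('v \<Rightarrow> 'd) \<Rightarrow> real" where
  "avgs Z F x = (\<Sum>y\<in>PiE Z (\<lambda>_. A). (\<Prod>v\<in>Z. w (y v)) * F (override_on x y Z))"

lemma avgs_empty [simp]: "avgs {} F = F"
  by (auto simp: avgs_def)

lemma avgs_insert:
  assumes "finite Z" "v \<notin> Z"
  shows "avgs (insert (v :: 'a) Z) F = avg v (avgs Z F)"
proof
  fix x :: "'a \<Rightarrow> 'd"
  have inj: "inj_on (\<lambda>(a, y). y(v := a)) (A \<times> PiE Z (\<lambda>_. A))"
    using inj_combinator[OF assms(2), of "\<lambda>_. A"] by simp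
  have ov: "override_on x (y(v := a)) (insert v Z) = override_on (x(v := a)) y Z" for y a
    using assms(2) by (auto simp: override_on_def fun_eq_iff)
  have pr: "(\<Prod>u\<in>insert v Z. w ((y(v := a)) u)) = w a * (\<Prod>u\<in>Z. w (y u))" for y a
  proof -
    have "(\<Prod>u\<in>Z. w ((y(v := a)) u)) = (\<Prod>u\<in>Z. w (y u))"
      using assms(2) by (intro prod.cong) auto
    then show ?thesis using assms by simp
  qed
  have "avgs (insert v Z) F x
      = (\<Sum>(a, y)\<in>A \<times> PiE Z (\<lambda>_. A). w a * (\<Prod>u\<in>Z. w (y u)) * F (override_on (x(v := a)) y Z))"
    unfolding avgs_def PiE_insert_eq
    by (subst sum.reindex[OF inj]) (rule sum.cong, simp, simp only: o_def case_prod_beta pr ov fst_conv snd_conv)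
  also have "\<dots> = avg v (avgs Z F) x"
    by (simp add: avg_def avgs_def sum.cartesian_product[symmetric] sum_distrib_left mult.assoc)
  finally show "avgs (insert v Z) F x = avg v (avgs Z F) x" .
qed

lemma avg_commute: "avg u (avg v F) = avg v (avg u F)"
proof (cases "u = v")
  case False
  then show ?thesis
    unfolding avg_def fun_eq_iff sum_distrib_left
    by (subst sum.swap) (auto intro!: sum.cong simp: fun_upd_twist)
qed simp

lemma avgs_avg:
  assumes "finite Z"
  shows "avgs Z (avg v F) = avg v (avgs Z F)"
  using assms
proof (induction Z)
  case (insert u Z)
  then show ?case by (simp add: avgs_insert avg_commute[of u v])
qed simp

lemma avgs_Un:
  assumes "finite Y" "finite Z" "Y \<inter> Z = {}"
  shows "avgs (Y \<union> Z) F = avgs Y (avgs Z F)"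
  using assms(1,3)
proof (induction Y)
  case (insert u Y)
  then show ?case using assms(2) by (simp add: avgs_insert)
qed simp

lemma avg_mult_left:
  assumes "depends F S" "v \<notin> S"
  shows "avg v (\<lambda>x. F x * G x) = (\<lambda>x. F x * avg v G x)"
proof
  fix x
  have "F (x(v := a)) = F x" for a
    using assms unfolding depends_def by (intro assms(1)[unfolded depends_def, rule_format]) auto
  then show "avg v (\<lambda>x. F x * G x) x = F x * avg v G x"
    by (simp add: avg_def sum_distrib_left algebra_simps)
qed

lemma avgs_mult_left:
  assumes "depends F S" "finite Z" "Z \<inter> S = {}"
  shows "avgs Z (\<lambda>x. F x * G x) = (\<lambda>x. F x * avgs Z G x)"
  using assms(2,3)
proof (induction Z)
  case (insert v Z)
  then show ?case using avg_mult_left[OF assms(1)] by (simp add: avgs_insert)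
qed simp

lemma avg_const [simp]: "avg v (\<lambda>x. c) = (\<lambda>x. c)"
  by (simp add: avg_def sum_distrib_right[symmetric] wsum fun_eq_iff)

lemma avgs_const:
  assumes "finite Z"
  shows "avgs Z (\<lambda>x. c) = (\<lambda>x. c)"
  using assms by induction (simp_all add: avgs_insert)

lemma avg_indep: "depends F S \<Longrightarrow> v \<notin> S \<Longrightarrow> avg v F = F"
  using avg_mult_left[of F S v "\<lambda>_. 1"] by simp

lemma avg_depends:
  assumes "depends F S"
  shows "depends (avg v F) (S - {v})"
  using assms unfolding depends_def avg_def
  by (intro allI impI sum.cong arg_cong2[of _ _ _ _ "(*)"]) auto

lemma avgs_depends:
  assumes "finite Z" "depends F S"
  shows "depends (avgs Z F) (S - Z)"
  using assms
proof (induction Z)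
  case (insert v Z)
  then have "depends (avg v (avgs Z F)) (S - Z - {v})" by (intro avg_depends) auto
  then show ?case using insert by (simp add: avgs_insert Diff_insert[symmetric])
qed simp

lemma avg_idem: "avg v (avg v F) = avg v F"
proof -
  have "depends F UNIV" by (auto simp: depends_def intro!: arg_cong[of _ _ F])
  then show ?thesis by (meson avg_depends avg_indep DiffE singletonI)
qed

lemma avg_diff: "avg v (\<lambda>x. F x - G x) = (\<lambda>x. avg v F x - avg v G x)"
  by (simp add: avg_def fun_eq_iff algebra_simps sum_subtractf)

lemma avgs_diff: "avgs Z (\<lambda>x. F x - G x) = (\<lambda>x. avgs Z F x - avgs Z G x)"
  by (simp add: avgs_def fun_eq_iff algebra_simps sum_subtractf)

lemma avgs_add: "avgs Z (\<lambda>x. F x + G x) x = avgs Z F x + avgs Z G x"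
  by (simp add: avgs_def algebra_simps sum.distrib)

lemma avgs_sum: "avgs Z (\<lambda>x. \<Sum>i\<in>I. F i x) x = (\<Sum>i\<in>I. avgs Z (F i) x)"
  unfolding avgs_def by (subst sum.swap) (simp add: sum_distrib_left)

lemma avgs_cmult: "avgs Z (\<lambda>x. c * F x) x = c * avgs Z F x"
  by (simp add: avgs_def sum_distrib_left algebra_simps)

text \<open>The tower property: an inner average over a coordinate of \<open>V\<close> is idempotent
  with the outer one.\<close>

lemma avgs_absorb:
  assumes "finite V" "v \<in> V"
  shows "avgs V (avg v F) = avgs V F"
proof -
  have V: "V = insert v (V - {v})" using assms by auto
  have "avgs V (avg v F) = avg v (avgs (V - {v}) (avg v F))"
    by (subst V, subst avgs_insert) (use assms in auto)
  also have "\<dots> = avg v (avgs (V - {v}) F)"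
    using assms by (simp add: avgs_avg avg_idem)
  also have "\<dots> = avgs V F"
    by (subst (2) V, subst avgs_insert) (use assms in auto)
  finally show ?thesis .
qed

lemma avgs_absorbs:
  assumes "finite V" "Z \<subseteq> V"
  shows "avgs V (avgs Z F) = avgs V F"
proof -
  have "finite Z" using assms finite_subset by auto
  then show ?thesis using assms(2)
  proof (induction Z)
    case (insert v Z)
    then show ?case using assms(1) by (simp add: avgs_insert avgs_absorb)
  qed simp
qed

section \<open>Efron--Stein decomposition in a chosen set of coordinates\<close>

definition efron_stein_decomposition ::
    "'v set \<Rightarrow> 'v set \<Rightarrow> (('v \<Rightarrow> 'd) \<Rightarrow> real) \<Rightarrow> ('v set \<Rightarrow> ('v \<Rightarrow> 'd) \<Rightarrow> real) \<Rightarrow> bool" where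
  "efron_stein_decomposition Y S u g \<longleftrightarrow>
     (\<forall>x. u x = (\<Sum>B\<in>Pow Y. g B x)) \<and>
     (\<forall>B\<in>Pow Y. depends (g B) (B \<union> (S - Y)) \<and> (\<forall>v\<in>B. avg v (g B) = (\<lambda>x. 0)) \<and>
        (\<forall>v. avg v u = (\<lambda>x. 0) \<longrightarrow> avg v (g B) = (\<lambda>x. 0)) \<and>
        (avgs (Y - B) u = (\<lambda>x. 0) \<longrightarrow> g B = (\<lambda>x. 0)))"

text \<open>Induction on \<open>Y\<close>: \<open>u\<close> splits into \<open>avg v u\<close> and
  \<open>u - avg v u\<close>, both decomposed in the remaining coordinates; the second supplies the
  components containing \<open>v\<close>. The clause that a vanishing average of \<open>u\<close>
  passes to every component carries the induction: it makes the new components average to zero in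
  \<open>v\<close> itself.\<close>

lemma efron_stein_exists:
  assumes "finite Y" "depends u S"
  shows "\<exists>g. efron_stein_decomposition Y S u g"
  using assms
proof (induction Y arbitrary: u S)
  case empty
  then show ?case by (intro exI[of _ "\<lambda>_. u"]) (auto simp: efron_stein_decomposition_def)
next
  case (insert v Y)
  define u1 where "u1 = avg v u"
  define u2 where "u2 = (\<lambda>x. u x - u1 x)"
  have d1: "depends u1 (S - {v})" unfolding u1_def by (intro avg_depends insert)
  have d2: "depends u2 (S \<union> {v})" unfolding u2_def
    by (intro depends_diff depends_mono[OF d1] depends_mono[OF insert.prems]) auto
  from insert.IH[OF d1] obtain g1 where G1: "efron_stein_decomposition Y (S - {v}) u1 g1" by blast
  have g1: "\<And>x. u1 x = (\<Sum>B\<in>Pow Y. g1 B x)"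
     "\<And>B. B \<subseteq> Y \<Longrightarrow> depends (g1 B) (B \<union> (S - {v} - Y))"
     "\<And>B w. B \<subseteq> Y \<Longrightarrow> w \<in> B \<Longrightarrow> avg w (g1 B) = (\<lambda>x. 0)"
     "\<And>B w. B \<subseteq> Y \<Longrightarrow> avg w u1 = (\<lambda>x. 0) \<Longrightarrow> avg w (g1 B) = (\<lambda>x. 0)"
     "\<And>B. B \<subseteq> Y \<Longrightarrow> avgs (Y - B) u1 = (\<lambda>x. 0) \<Longrightarrow> g1 B = (\<lambda>x. 0)"
    using G1 unfolding efron_stein_decomposition_def by (simp, blast+)
  from insert.IH[OF d2] obtain g2 where G2: "efron_stein_decomposition Y (S \<union> {v}) u2 g2" by blast
  have g2: "\<And>x. u2 x = (\<Sum>B\<in>Pow Y. g2 B x)"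
     "\<And>B. B \<subseteq> Y \<Longrightarrow> depends (g2 B) (B \<union> ((S \<union> {v}) - Y))"
     "\<And>B w. B \<subseteq> Y \<Longrightarrow> w \<in> B \<Longrightarrow> avg w (g2 B) = (\<lambda>x. 0)"
     "\<And>B w. B \<subseteq> Y \<Longrightarrow> avg w u2 = (\<lambda>x. 0) \<Longrightarrow> avg w (g2 B) = (\<lambda>x. 0)"
     "\<And>B. B \<subseteq> Y \<Longrightarrow> avgs (Y - B) u2 = (\<lambda>x. 0) \<Longrightarrow> g2 B = (\<lambda>x. 0)"
    using G2 unfolding efron_stein_decomposition_def by (simp, blast+)
  have av2: "avg w u2 = (\<lambda>x. avg w u x - avg v (avg w u) x)" for w
    unfolding u2_def u1_def by (simp add: avg_diff avg_commute[of w v])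
  have av1: "avg w u1 = avg v (avg w u)" for w
    unfolding u1_def by (rule avg_commute)
  define g where "g B = (if v \<in> B then g2 (B - {v}) else g1 B)" for B
  have v: "v \<notin> Y" and finY: "finite Y" by fact+
  have disj: "Pow Y \<inter> insert v ` Pow Y = {}" using v by auto
  have inj: "inj_on (insert v) (Pow Y)" using v by (auto simp: inj_on_def)
  have sum: "u x = (\<Sum>B\<in>Pow (insert v Y). g B x)" for x
  proof -
    have "(\<Sum>B\<in>Pow (insert v Y). g B x) = (\<Sum>B\<in>Pow Y. g B x) + (\<Sum>B\<in>Pow Y. g (insert v B) x)"
      unfolding Pow_insert using disj finY
      by (subst sum.union_disjoint) (auto simp: sum.reindex[OF inj])
    also have "(\<Sum>B\<in>Pow Y. g B x) = (\<Sum>B\<in>Pow Y. g1 B x)"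
      using v by (intro sum.cong) (auto simp: g_def)
    also have "(\<Sum>B\<in>Pow Y. g (insert v B) x) = (\<Sum>B\<in>Pow Y. g2 B x)"
      using v by (intro sum.cong refl) (auto simp: g_def insert_Diff_if intro!: arg_cong[of _ _ "\<lambda>B. g2 B x"])
    finally show ?thesis using g1(1)[of x] g2(1)[of x] by (simp add: u2_def)
  qed
  have P: "depends (g B) (B \<union> (S - insert v Y)) \<and> (\<forall>v\<in>B. avg v (g B) = (\<lambda>x. 0)) \<and>
        (\<forall>v. avg v u = (\<lambda>x. 0) \<longrightarrow> avg v (g B) = (\<lambda>x. 0)) \<and>
        (avgs (insert v Y - B) u = (\<lambda>x. 0) \<longrightarrow> g B = (\<lambda>x. 0))" if B: "B \<subseteq> insert v Y" for B
  proof (cases "v \<in> B")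
    case True
    define B' where "B' = B - {v}"
    have B': "B' \<subseteq> Y" and gB: "g B = g2 B'" using B True by (auto simp: B'_def g_def)
    have "depends (g B) (B \<union> (S - insert v Y))"
      unfolding gB by (rule depends_mono[OF g2(2)[OF B']]) (use True in \<open>auto simp: B'_def\<close>)
    moreover have "avg w (g B) = (\<lambda>x. 0)" if "w \<in> B" for w
    proof (cases "w = v")
      case True
      have "avg v u2 = (\<lambda>x. 0)" by (simp add: av2 avg_idem)
      then show ?thesis unfolding gB True by (rule g2(4)[OF B'])
    next
      case False
      then show ?thesis unfolding gB using g2(3)[OF B'] that by (auto simp: B'_def)
    qed
    moreover have "avg w (g B) = (\<lambda>x. 0)" if "avg w u = (\<lambda>x. 0)" for w
      unfolding gB by (intro g2(4)[OF B']) (simp add: av2 that)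
    moreover have "g B = (\<lambda>x. 0)" if "avgs (insert v Y - B) u = (\<lambda>x. 0)"
    proof -
      have eq: "insert v Y - B = Y - B'" using True v by (auto simp: B'_def)
      have "avgs (Y - B') u2 = (\<lambda>x. 0)"
        unfolding u2_def avgs_diff u1_def using that finY by (simp add: eq avgs_avg)
      then show ?thesis unfolding gB by (rule g2(5)[OF B'])
    qed
    ultimately show ?thesis by blast
  next
    case False
    then have B': "B \<subseteq> Y" and gB: "g B = g1 B" using B by (auto simp: g_def)
    have "depends (g B) (B \<union> (S - insert v Y))"
      unfolding gB by (rule depends_mono[OF g1(2)[OF B']]) auto
    moreover have "avg w (g B) = (\<lambda>x. 0)" if "w \<in> B" for w
      unfolding gB using g1(3)[OF B' that] .
    moreover have "avg w (g B) = (\<lambda>x. 0)" if "avg w u = (\<lambda>x. 0)" for w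
      unfolding gB by (intro g1(4)[OF B']) (simp add: av1 that)
    moreover have "g B = (\<lambda>x. 0)" if "avgs (insert v Y - B) u = (\<lambda>x. 0)"
    proof -
      have eq: "insert v Y - B = insert v (Y - B)" using False by auto
      have "avgs (Y - B) u1 = (\<lambda>x. 0)"
        unfolding u1_def using that v finY by (simp add: eq avgs_avg avgs_insert)
      then show ?thesis unfolding gB by (rule g1(5)[OF B'])
    qed
    ultimately show ?thesis by blast
  qed
  show ?case
    unfolding efron_stein_decomposition_def using sum P by (intro exI[of _ g]) blast
qed

end

section \<open>Pseudo-expectations of expanding constraint hypergraphs\<close>

text \<open>\<open>f\<close> selects more than \<open>t\<close> variables of each hyperedge in \<open>B\<close>; the set \<open>M\<close> collects the variables
  that may be selected only once.\<close>

definition admissible :: "nat \<Rightarrow> 'v set set \<Rightarrow> 'v set \<Rightarrow> ('v set \<Rightarrow> 'v set) \<Rightarrow> bool" where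
  "admissible t B M f \<longleftrightarrow> (\<forall>e\<in>B. f e \<subseteq> e \<and> t < card (f e)) \<and>
     (\<forall>v\<in>(\<Union>e\<in>B. f e) - M. \<exists>e1\<in>B. \<exists>e2\<in>B. e1 \<noteq> e2 \<and> v \<in> f e1 \<and> v \<in> f e2)"

text \<open>Double counting of the selected incidences, the variables of \<open>M\<close> being the old ones.\<close>

lemma admissible_count:
  assumes admissible: "admissible t B (M \<union> T) f" and finB: "finite B" and B: "\<And>e. e \<in> B \<Longrightarrow> finite e \<and> card e = k"
  shows "2 * card (\<Union>B - M) + (t + 1) * card B + card ((\<Union>e\<in>B. f e) \<inter> M)
    \<le> 2 * k * card B + card ((\<Union>e\<in>B. f e) \<inter> T - M)"
proof -
  let ?U = "\<Union>e\<in>B. f e"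
  have fsub: "f e \<subseteq> e" and ft: "t + 1 \<le> card (f e)" if "e \<in> B" for e
    using admissible that unfolding admissible_def by fastforce+
  have finf: "finite (f e)" if "e \<in> B" for e
    using B fsub that finite_subset by metis
  have finU: "finite ?U" using finf finB by auto
  define deg where "deg v = card {e\<in>B. v \<in> f e}" for v
  have sumdeg: "(\<Sum>v\<in>?U. deg v) = (\<Sum>e\<in>B. card (f e))"
  proof -
    have "(\<Sum>v\<in>?U. deg v) = (\<Sum>v\<in>?U. \<Sum>e\<in>B. if v \<in> f e then 1 else 0)"
      unfolding deg_def using finB by (intro sum.cong refl) (simp add: sum.If_cases Int_def)
    also have "\<dots> = (\<Sum>e\<in>B. \<Sum>v\<in>?U. if v \<in> f e then 1 else 0)" by (rule sum.swap)
    also have "\<dots> = (\<Sum>e\<in>B. card (f e))"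
    proof (intro sum.cong refl)
      fix e assume "e \<in> B"
      then have "?U \<inter> {v. v \<in> f e} = f e" by auto
      then show "(\<Sum>v\<in>?U. if v \<in> f e then 1 else 0) = card (f e)"
        using finU by (simp add: sum.If_cases)
    qed
    finally show ?thesis .
  qed
  have deg1: "1 \<le> deg v" if "v \<in> ?U" for v
    using that finB by (auto simp: deg_def Suc_le_eq card_gt_0_iff)
  have deg2: "2 \<le> deg v" if v: "v \<in> ?U" "v \<notin> M" "v \<notin> T" for v
  proof -
    obtain e1 e2 where "e1 \<in> B" "e2 \<in> B" "e1 \<noteq> e2" "v \<in> f e1" "v \<in> f e2"
      using admissible v unfolding admissible_def by blast
    then have "card {e1, e2} \<le> deg v"
      unfolding deg_def using finB by (intro card_mono) auto
    then show ?thesis using \<open>e1 \<noteq> e2\<close> by simp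
  qed
  have "2 * card (?U - M) = (\<Sum>v\<in>?U - M. 2)" by simp
  \<comment> \<open>A selected variable outside \<open>M\<close> has degree at least two, except
    that one in \<open>T\<close> may have degree one and is granted the missing unit.\<close>
  also have "\<dots> \<le> (\<Sum>v\<in>?U - M. deg v + (if v \<in> T then 1 else 0))"
    using deg1 deg2 by (intro sum_mono) fastforce
  also have "\<dots> = (\<Sum>v\<in>?U - M. deg v) + card (?U \<inter> T - M)"
  proof -
    have "(?U - M) \<inter> T = ?U \<inter> T - M" by auto
    then show ?thesis using finU by (simp add: sum.distrib sum.If_cases)
  qed
  finally have 1: "2 * card (?U - M) \<le> (\<Sum>v\<in>?U - M. deg v) + card (?U \<inter> T - M)" .
  have "card (?U \<inter> M) = (\<Sum>v\<in>?U \<inter> M. 1)" by simp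
  also have "\<dots> \<le> (\<Sum>v\<in>?U \<inter> M. deg v)" using deg1 by (intro sum_mono) auto
  finally have 2: "card (?U \<inter> M) + (\<Sum>v\<in>?U - M. deg v) \<le> (\<Sum>e\<in>B. card (f e))"
    unfolding sumdeg[symmetric] sum.Int_Diff[OF finU, of deg M] by simp
  \<comment> \<open>The remaining variables are unselected in some edge, at most
    \<open>k - card (f e)\<close> for each \<open>e\<close>. They count twice and selected
    incidences once, so an edge accounts for \<open>2 * k - card (f e)\<close>, at most
    \<open>2 * k - (t + 1)\<close>.\<close>
  have "\<Union>B - M \<subseteq> (?U - M) \<union> (\<Union>e\<in>B. e - f e)" by auto
  then have "card (\<Union>B - M) \<le> card ((?U - M) \<union> (\<Union>e\<in>B. e - f e))"
    using finU finB B by (intro card_mono) auto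
  also have "\<dots> \<le> card (?U - M) + card (\<Union>e\<in>B. e - f e)" by (rule card_Un_le)
  also have "card (\<Union>e\<in>B. e - f e) \<le> (\<Sum>e\<in>B. card (e - f e))"
    using finB by (rule card_UN_le)
  finally have 3: "card (\<Union>B - M) \<le> card (?U - M) + (\<Sum>e\<in>B. card (e - f e))" by simp
  have "card (e - f e) + card (f e) = k" if "e \<in> B" for e
    using B[OF that] fsub[OF that] by (metis card_Diff_subset card_mono finite_subset le_add_diff_inverse2)
  then have "(\<Sum>e\<in>B. card (e - f e) + card (f e)) = (\<Sum>e\<in>B. k)" by (intro sum.cong) auto
  then have 4: "(\<Sum>e\<in>B. card (e - f e)) + (\<Sum>e\<in>B. card (f e)) = k * card B"
    by (simp add: sum.distrib)
  have 5: "(t + 1) * card B \<le> (\<Sum>e\<in>B. card (f e))"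
    using sum_mono[of B "\<lambda>_. t + 1" "\<lambda>e. card (f e)"] ft by (simp add: mult.commute)
  show ?thesis using 1 2 3 4 5 by linarith
qed

text \<open>\<open>u e\<close> stands for a relative density minus one: \<open>u_nonneg\<close> says
  that the density is nonnegative, and \<open>u_avgs\<close> is \<open>t\<close>-wise independence.
  \<open>x0\<close> supplies the values outside \<open>V\<close>, which averaging over
  \<open>V\<close> leaves untouched.\<close>

locale local_csp = weights A w for A :: "'d set" and w +
  fixes V :: "'v set" and C :: "'v set set" and k t :: nat
    and u :: "'v set \<Rightarrow> ('v \<Rightarrow> 'd) \<Rightarrow> real" and N :: nat and x0 :: "'v \<Rightarrow> 'd"
  assumes finV: "finite V" and CV: "\<And>e. e \<in> C \<Longrightarrow> e \<subseteq> V \<and> card e = k"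
    and u_depends: "\<And>e. e \<in> C \<Longrightarrow> depends (u e) e"
    and u_nonneg: "\<And>e x. e \<in> C \<Longrightarrow> 0 \<le> 1 + u e x"
    and u_avgs: "\<And>e Z. e \<in> C \<Longrightarrow> Z \<subseteq> e \<Longrightarrow> card (e - Z) \<le> t \<Longrightarrow> avgs Z (u e) = (\<lambda>x. 0)"
begin

definition expect :: "(('v \<Rightarrow> 'd) \<Rightarrow> real) \<Rightarrow> real" where
  "expect F = avgs V F x0"

lemma expect_cong: "(\<And>x. (\<And>v. v \<in> V \<Longrightarrow> x v \<in> A) \<Longrightarrow> F x = G x) \<Longrightarrow> expect F = expect G"
  unfolding expect_def avgs_def
proof (intro sum.cong refl arg_cong2[of _ _ _ _ "(*)"])
  fix y assume eq: "\<And>x. (\<And>v. v \<in> V \<Longrightarrow> x v \<in> A) \<Longrightarrow> F x = G x" and "y \<in> PiE V (\<lambda>_. A)"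
  then show "F (override_on x0 y V) = G (override_on x0 y V)"
    by (intro eq) (auto simp: override_on_def)
qed

lemma expect_nonneg: "(\<And>x. 0 \<le> F x) \<Longrightarrow> 0 \<le> expect F"
  unfolding expect_def avgs_def by (intro sum_nonneg mult_nonneg_nonneg prod_nonneg) (auto intro: wpos)

lemma expect_sum: "expect (\<lambda>x. \<Sum>i\<in>I. F i x) = (\<Sum>i\<in>I. expect (F i))"
  unfolding expect_def by (rule avgs_sum)

lemma expect_cmult: "expect (\<lambda>x. c * F x) = c * expect F"
  unfolding expect_def by (rule avgs_cmult)

lemma expect_add: "expect (\<lambda>x. F x + G x) = expect F + expect G"
  unfolding expect_def by (rule avgs_add)

lemma expect_zero [simp]: "expect (\<lambda>x. 0) = 0"
  using expect_cmult[of 0 "\<lambda>x. 0"] by simp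

lemma expect_one [simp]: "expect (\<lambda>x. 1) = 1"
  unfolding expect_def using avgs_const[OF finV] by metis

lemma expect_avg: "v \<in> V \<Longrightarrow> expect (avg v F) = expect F"
  unfolding expect_def using avgs_absorb[OF finV] by metis

lemma expect_avgs: "Z \<subseteq> V \<Longrightarrow> expect (avgs Z F) = expect F"
  unfolding expect_def using avgs_absorbs[OF finV] by metis

lemma finC: "finite C"
  by (rule finite_subset[of _ "Pow V"]) (use CV finV in auto)

lemma edge_finite: "e \<in> C \<Longrightarrow> finite e \<and> card e = k"
  using CV finV finite_subset by metis

text \<open>Here \<open>t\<close>-wise independence enters: the component on \<open>B\<close>
  vanishes once \<open>u e\<close> averages to zero over \<open>e - B\<close>, which is the case for
  \<open>card B \<le> t\<close>.\<close>

lemma u_efron_stein: "\<exists>g. \<forall>e\<in>C. (\<forall>x. u e x = (\<Sum>B\<in>Pow e. g e B x)) \<and>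
    (\<forall>B\<in>Pow e. depends (g e B) B \<and> (\<forall>v\<in>B. avg v (g e B) = (\<lambda>x. 0)) \<and> (card B \<le> t \<longrightarrow> g e B = (\<lambda>x. 0)))"
proof (rule bchoice, intro ballI)
  fix e assume e: "e \<in> C"
  have fine: "finite e" using CV[OF e] finV finite_subset by auto
  obtain g where g: "efron_stein_decomposition e e (u e) g"
    using efron_stein_exists[OF fine u_depends[OF e]] by blast
  have "g B = (\<lambda>x. 0)" if "B \<subseteq> e" "card B \<le> t" for B
  proof -
    have "e - (e - B) = B" using that by auto
    then have "avgs (e - B) (u e) = (\<lambda>x. 0)" using u_avgs[OF e, of "e - B"] that by auto
    then show ?thesis using g that unfolding efron_stein_decomposition_def by blast
  qed
  moreover have "depends (g B) B" if "B \<subseteq> e" for B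
    using g that unfolding efron_stein_decomposition_def by simp
  ultimately show "\<exists>g. (\<forall>x. u e x = (\<Sum>B\<in>Pow e. g B x)) \<and>
    (\<forall>B\<in>Pow e. depends (g B) B \<and> (\<forall>v\<in>B. avg v (g B) = (\<lambda>x. 0)) \<and> (card B \<le> t \<longrightarrow> g B = (\<lambda>x. 0)))"
    using g unfolding efron_stein_decomposition_def by (intro exI[of _ g]) blast
qed

text \<open>Expand each \<open>u e\<close> into its Efron--Stein components: a variable outside \<open>M \<union> T\<close> that lies in
  exactly one component kills the expectation, and the surviving terms can be averaged over
  everything outside \<open>M\<close>.\<close>

lemma peel:
  assumes B: "B \<subseteq> C" and M: "M \<subseteq> V" and g0: "depends g0 M" and G: "depends G T" and T: "T \<subseteq> V"
    and admissible: "\<And>f h. admissible t B (M \<union> T) f \<Longrightarrow> depends h (((\<Union>e\<in>B. f e) \<union> T) \<inter> M) \<Longrightarrow> expect (\<lambda>x. g0 x * h x) = 0"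
  shows "expect (\<lambda>x. g0 x * ((\<Prod>e\<in>B. u e x) * G x)) = 0"
proof -
  from u_efron_stein obtain g where G': "\<forall>e\<in>C. (\<forall>x. u e x = (\<Sum>B\<in>Pow e. g e B x)) \<and>
    (\<forall>B\<in>Pow e. depends (g e B) B \<and> (\<forall>v\<in>B. avg v (g e B) = (\<lambda>x. 0)) \<and> (card B \<le> t \<longrightarrow> g e B = (\<lambda>x. 0)))" ..
  have
    g1: "\<And>e x. e \<in> C \<Longrightarrow> u e x = (\<Sum>B\<in>Pow e. g e B x)" and
    g2: "\<And>e B. e \<in> C \<Longrightarrow> B \<subseteq> e \<Longrightarrow> depends (g e B) B" and
    g3: "\<And>e B v. e \<in> C \<Longrightarrow> B \<subseteq> e \<Longrightarrow> v \<in> B \<Longrightarrow> avg v (g e B) = (\<lambda>x. 0)" and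
    g4: "\<And>e B. e \<in> C \<Longrightarrow> B \<subseteq> e \<Longrightarrow> card B \<le> t \<Longrightarrow> g e B = (\<lambda>x. 0)"
    using G' by (blast, blast, blast, blast)
  have finB: "finite B" using B finC finite_subset by auto
  have finPow: "\<And>e. e \<in> B \<Longrightarrow> finite (Pow e)" using B CV finV by (meson finite_Pow_iff finite_subset subsetD)
  have expand: "(\<Prod>e\<in>B. u e x) = (\<Sum>f\<in>PiE B Pow. \<Prod>e\<in>B. g e (f e) x)" for x
  proof -
    have "(\<Prod>e\<in>B. u e x) = (\<Prod>e\<in>B. \<Sum>B\<in>Pow e. g e B x)"
      using B g1 by (intro prod.cong) auto
    also have "\<dots> = (\<Sum>f\<in>PiE B Pow. \<Prod>e\<in>B. g e (f e) x)"
      by (rule prod_sum_PiE[OF finB finPow])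
    finally show ?thesis .
  qed
  have zero: "expect (\<lambda>x. g0 x * ((\<Prod>e\<in>B. g e (f e) x) * G x)) = 0" if f: "f \<in> PiE B Pow" for f
  proof -
    have fe: "f e \<subseteq> e" "e \<in> C" "f e \<subseteq> V" if "e \<in> B" for e
      using f that B CV by (auto simp: PiE_iff) blast+
    let ?U = "\<Union>e\<in>B. f e"
    \<comment> \<open>If \<open>f\<close> is not admissible, some component has too few variables,
      or some variable outside \<open>M \<union> T\<close> lies in exactly one of them.\<close>
    consider (small) e where "e \<in> B" "card (f e) \<le> t"
      | (single) v e where "v \<notin> M \<union> T" "e \<in> B" "v \<in> f e" "\<And>e'. e' \<in> B \<Longrightarrow> e' \<noteq> e \<Longrightarrow> v \<notin> f e'"
      | (admissible) "admissible t B (M \<union> T) f"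
      unfolding admissible_def using fe(1) by (metis DiffD1 DiffD2 UN_E linorder_not_le)
    then show ?thesis
    proof cases
      case small
      then have "g e (f e) x = 0" for x
        using g4[of e "f e"] fe by simp
      then have "(\<Prod>e\<in>B. g e (f e) x) = 0" for x
        using finB small(1) by (intro prod_zero) auto
      then show ?thesis by simp
    next
      case single
      let ?R = "\<lambda>x. g0 x * (G x * (\<Prod>e'\<in>B - {e}. g e' (f e') x))"
      have dR: "depends ?R (M \<union> T \<union> (\<Union>e'\<in>B - {e}. f e'))"
      proof (intro depends_mult depends_prod)
        fix e' assume "e' \<in> B - {e}"
        then show "depends (g e' (f e')) (M \<union> T \<union> (\<Union>e'\<in>B - {e}. f e'))"
          by (intro depends_mono[OF g2]) (use fe in auto)
      qed (auto intro: depends_mono[OF g0] depends_mono[OF G])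
      have eq: "(\<lambda>x. g0 x * ((\<Prod>e\<in>B. g e (f e) x) * G x)) = (\<lambda>x. ?R x * g e (f e) x)"
        using finB single(2) by (simp add: prod.remove[of B e] algebra_simps)
      have "expect (\<lambda>x. ?R x * g e (f e) x) = expect (avg v (\<lambda>x. ?R x * g e (f e) x))"
        using single(2,3) fe(3) by (subst expect_avg) blast+
      also have "avg v (\<lambda>x. ?R x * g e (f e) x) = (\<lambda>x. ?R x * avg v (g e (f e)) x)"
        by (rule avg_mult_left[OF dR]) (use single in auto)
      also have "\<dots> = (\<lambda>x. 0)" using g3[of e "f e" v] single fe by simp
      finally show ?thesis unfolding eq by simp
    next
      case admissible
      let ?H = "\<lambda>x. (\<Prod>e\<in>B. g e (f e) x) * G x"
      have dH: "depends ?H (?U \<union> T)"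
      proof (intro depends_mult depends_prod)
        fix e' assume "e' \<in> B"
        then show "depends (g e' (f e')) (?U \<union> T)"
          by (intro depends_mono[OF g2]) (use fe in auto)
      qed (auto intro: depends_mono[OF G])
      have fin: "finite (V - M)" using finV by auto
      have "depends (avgs (V - M) ?H) (?U \<union> T - (V - M))" by (rule avgs_depends[OF fin dH])
      moreover have "?U \<union> T - (V - M) = (?U \<union> T) \<inter> M" using fe(3) T by auto
      ultimately have dav: "depends (avgs (V - M) ?H) ((?U \<union> T) \<inter> M)" by simp
      have "expect (\<lambda>x. g0 x * ?H x) = expect (avgs (V - M) (\<lambda>x. g0 x * ?H x))"
        by (subst expect_avgs) auto
      also have "\<dots> = expect (\<lambda>x. g0 x * avgs (V - M) ?H x)"
        by (subst avgs_mult_left[OF g0 fin]) auto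
      also have "\<dots> = 0" by (rule assms(6)[OF admissible dav])
      finally show ?thesis .
    qed
  qed
  have "expect (\<lambda>x. g0 x * ((\<Prod>e\<in>B. u e x) * G x))
      = expect (\<lambda>x. \<Sum>f\<in>PiE B Pow. g0 x * ((\<Prod>e\<in>B. g e (f e) x) * G x))"
    by (simp add: expand sum_distrib_left sum_distrib_right)
  also have "\<dots> = 0" unfolding expect_sum using zero by (intro sum.neutral) auto
  finally show ?thesis .
qed

end

section \<open>Product expansion and symmetric bilinear forms\<close>

lemma prod_one_plus:
  fixes f :: "'a \<Rightarrow> real"
  assumes "finite K"
  shows "(\<Prod>e\<in>K. 1 + f e) = (\<Sum>Y\<in>Pow K. \<Prod>e\<in>Y. f e)"
  using prod_add[OF assms, of f "\<lambda>_. 1"] by (simp add: add.commute)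

text \<open>Projection onto a span for a form that may be degenerate. In the induction both
  \<open>p\<close> and the new vector \<open>b l\<close> are made orthogonal to the old span, giving
  \<open>p'\<close> and \<open>q\<close>, and then the component along \<open>q\<close> is removed
  from \<open>p'\<close>. Vectors of zero norm are orthogonal to everything, so degeneracy is
  harmless.\<close>

lemma linear_forms_orthogonalize:
  fixes Q :: "('x \<Rightarrow> real) \<Rightarrow> ('x \<Rightarrow> real) \<Rightarrow> real"
  assumes lin: "\<And>F G H c. Q (\<lambda>x. F x + c * G x) H = Q F H + c * Q G H"
    and sym: "\<And>F G. Q F G = Q G F" and pos: "\<And>F. 0 \<le> Q F F" and "finite L"
  shows "\<exists>c. \<forall>i\<in>L. Q (\<lambda>x. p x - (\<Sum>j\<in>L. c j * b j x)) (b i) = 0"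
  using \<open>finite L\<close>
proof (induction L arbitrary: p)
  case (insert l L)
  have null: "Q F G = 0" if "Q G G = 0" for F G
  proof (rule ccontr)
    assume ne: "Q F G \<noteq> 0"
    \<comment> \<open>With this shift the form takes the value \<open>-1\<close> at
      \<open>F + s * G\<close>.\<close>
    define s where "s = - (Q F F + 1) / (2 * Q F G)"
    have "0 \<le> Q (\<lambda>x. F x + s * G x) (\<lambda>x. F x + s * G x)" by (rule pos)
    also have "\<dots> = Q F F + s * Q F G + s * (Q F G + s * Q G G)"
      by (simp only: lin sym[of F "\<lambda>x. F x + s * G x"] sym[of G "\<lambda>x. F x + s * G x"] sym[of G F])
    also have "\<dots> = Q F F + 2 * s * Q F G" using that by simp
    also have "2 * s * Q F G = - (Q F F + 1)" using ne by (simp add: s_def field_simps)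
    finally show False by simp
  qed
  obtain c where c: "\<And>i. i \<in> L \<Longrightarrow> Q (\<lambda>x. p x - (\<Sum>j\<in>L. c j * b j x)) (b i) = 0"
    using insert.IH by blast
  obtain c' where c': "\<And>i. i \<in> L \<Longrightarrow> Q (\<lambda>x. b l x - (\<Sum>j\<in>L. c' j * b j x)) (b i) = 0"
    using insert.IH by blast
  define p' where "p' = (\<lambda>x. p x - (\<Sum>j\<in>L. c j * b j x))"
  define q where "q = (\<lambda>x. b l x - (\<Sum>j\<in>L. c' j * b j x))"
  \<comment> \<open>If \<open>q\<close> has norm zero, nothing has to be removed:
    \<open>null\<close> already gives \<open>Q p' q = 0\<close>.\<close>
  define \<alpha> where "\<alpha> = (if Q q q = 0 then 0 else Q p' q / Q q q)"
  define d where "d j = (if j = l then \<alpha> else c j - \<alpha> * c' j)" for j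
  define R where "R = (\<lambda>x. p x - (\<Sum>j\<in>insert l L. d j * b j x))"
  have sd: "(\<Sum>j\<in>L. d j * b j x) = (\<Sum>j\<in>L. c j * b j x) - \<alpha> * (\<Sum>j\<in>L. c' j * b j x)" for x
    unfolding sum_distrib_left sum_subtractf[symmetric]
    by (intro sum.cong refl) (use insert.hyps in \<open>auto simp: d_def algebra_simps\<close>)
  have R: "R = (\<lambda>x. p' x + (- \<alpha>) * q x)"
    using insert.hyps by (simp add: R_def sd p'_def q_def fun_eq_iff algebra_simps) (simp add: d_def)
  have RL: "Q R (b i) = 0" if "i \<in> L" for i
    unfolding R lin using c[OF that] c'[OF that] by (simp add: p'_def q_def)
  have Rq: "Q R q = 0"
    unfolding R lin using null[of q p'] by (simp add: \<alpha>_def)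
  have span: "Q (\<lambda>x. \<Sum>j\<in>L'. c' j * b j x) R = 0" if "L' \<subseteq> L" for L'
  proof -
    have "finite L'" using that insert.hyps finite_subset by auto
    then show ?thesis using that
    proof (induction L')
      case empty
      then show ?case using lin[of "\<lambda>x. 0" "-1" "\<lambda>x. 0" R] by simp
    next
      case (insert j L')
      have "Q (\<lambda>x. \<Sum>j\<in>insert j L'. c' j * b j x) R = Q (\<lambda>x. (\<Sum>j\<in>L'. c' j * b j x) + c' j * b j x) R"
        using insert.hyps by (simp add: add.commute)
      also have "\<dots> = 0" using insert RL[of j] by (simp only: lin sym[of "b j" R]) simp
      finally show ?case .
    qed
  qed
  have "b l = (\<lambda>x. q x + 1 * (\<Sum>j\<in>L. c' j * b j x))" by (simp add: q_def)
  then have "Q (b l) R = Q q R + 1 * Q (\<lambda>x. \<Sum>j\<in>L. c' j * b j x) R" by (metis lin)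
  then have "Q R (b l) = 0" using span[OF order_refl] Rq sym by simp
  then show ?case using RL unfolding R_def by (intro exI[of _ d]) blast
qed simp

text \<open>\<open>Q\<close> is not assumed positive, only its values at the residuals are. A
  residual is orthogonal to all earlier \<open>b i\<close>, hence to their span, so expanding the
  square of a combination leaves no cross terms.\<close>

lemma triangular_psd:
  fixes Q :: "('x \<Rightarrow> real) \<Rightarrow> ('x \<Rightarrow> real) \<Rightarrow> real"
    and m :: nat
  assumes lin: "\<And>F G H c. Q (\<lambda>x. F x + c * G x) H = Q F H + c * Q G H"
    and sym: "\<And>F G. Q F G = Q G F"
    and res: "\<And>j. j < m \<Longrightarrow> \<exists>c. (\<forall>i<j. Q (\<lambda>x. b j x - (\<Sum>i<j. c i * b i x)) (b i) = 0) \<and>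
      0 \<le> Q (\<lambda>x. b j x - (\<Sum>i<j. c i * b i x)) (\<lambda>x. b j x - (\<Sum>i<j. c i * b i x))"
  shows "0 \<le> Q (\<lambda>x. \<Sum>i<m. a i * b i x) (\<lambda>x. \<Sum>i<m. a i * b i x)"
  using res
proof (induction m arbitrary: a)
  case 0
  show ?case using lin[of "\<lambda>x. 0" "-1" "\<lambda>x. 0"] by simp
next
  case (Suc m)
  obtain c where c: "\<And>i. i < m \<Longrightarrow> Q (\<lambda>x. b m x - (\<Sum>i<m. c i * b i x)) (b i) = 0"
    "0 \<le> Q (\<lambda>x. b m x - (\<Sum>i<m. c i * b i x)) (\<lambda>x. b m x - (\<Sum>i<m. c i * b i x))"
    using Suc.prems[of m] by auto
  define R where "R = (\<lambda>x. b m x - (\<Sum>i<m. c i * b i x))"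
  define a' where "a' i = a i + a m * c i" for i
  define P where "P = (\<lambda>x. \<Sum>i<m. a' i * b i x)"
  have eq: "(\<lambda>x. \<Sum>i<Suc m. a i * b i x) = (\<lambda>x. P x + a m * R x)"
    by (simp add: P_def R_def a'_def algebra_simps sum.distrib sum_distrib_left fun_eq_iff)
  have span: "Q (\<lambda>x. \<Sum>i<l. a' i * b i x) R = 0" if "l \<le> m" for l
    using that
  proof (induction l)
    case 0
    then show ?case using lin[of "\<lambda>x. 0" "-1" "\<lambda>x. 0"] by simp
  next
    case (Suc l)
    then show ?case using c(1)[of l] by (simp add: lin sym[of "b l" R] R_def[symmetric])
  qed
  have "Q (\<lambda>x. P x + a m * R x) (\<lambda>x. P x + a m * R x)
     = Q P P + a m * Q P R + a m * (Q P R + a m * Q R R)"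
    by (simp only: lin sym[of P "\<lambda>x. P x + a m * R x"] sym[of R "\<lambda>x. P x + a m * R x"] sym[of R P])
  also have "\<dots> = Q P P + (a m)\<^sup>2 * Q R R"
    using span[of m] by (simp add: P_def power2_eq_square)
  also have "0 \<le> \<dots>" using Suc.IH[of a'] Suc.prems c(2) by (simp add: P_def R_def)
  finally show ?case unfolding eq .
qed

section \<open>The truncated functional and its honest values on closed sets\<close>

context local_csp
begin

text \<open>The functional is defined on all functions; positivity and locality hold only for those of
  low degree, for which the cut-off \<open>N\<close> is immaterial.\<close>

definition pexpect :: "(('v \<Rightarrow> 'd) \<Rightarrow> real) \<Rightarrow> real" where
  "pexpect F = (\<Sum>X\<in>{X. X \<subseteq> C \<and> card X \<le> N}. expect (\<lambda>x. (\<Prod>e\<in>X. u e x) * F x))"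

lemma pexpect_cong: "(\<And>x. (\<And>v. v \<in> V \<Longrightarrow> x v \<in> A) \<Longrightarrow> F x = G x) \<Longrightarrow> pexpect F = pexpect G"
  unfolding pexpect_def by (intro sum.cong refl expect_cong) auto

lemma pexpect_lin: "pexpect (\<lambda>x. F x + c * G x) = pexpect F + c * pexpect G"
  unfolding pexpect_def sum_distrib_left sum.distrib[symmetric] expect_cmult[symmetric] expect_add[symmetric]
  by (intro sum.cong refl arg_cong[of _ _ expect]) (auto simp: algebra_simps)

definition weight :: "'v set set \<Rightarrow> ('v \<Rightarrow> 'd) \<Rightarrow> real" where
  "weight K x = (\<Prod>e\<in>K. 1 + u e x)"

lemma weight_nonneg: "K \<subseteq> C \<Longrightarrow> 0 \<le> weight K x"
  unfolding weight_def by (intro prod_nonneg) (auto intro: u_nonneg)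

lemma u_dep': "e \<in> C \<Longrightarrow> e \<subseteq> M \<Longrightarrow> depends (u e) M"
  using u_depends depends_mono by blast

lemma depends_prod_u: "K \<subseteq> C \<Longrightarrow> \<Union>K \<subseteq> M \<Longrightarrow> depends (\<lambda>x. \<Prod>e\<in>K. u e x) M"
  by (intro depends_prod u_dep') auto

lemma depends_weight: "K \<subseteq> C \<Longrightarrow> \<Union>K \<subseteq> M \<Longrightarrow> depends (weight K) M"
  unfolding weight_def
proof (intro depends_prod)
  fix e assume "K \<subseteq> C" "\<Union>K \<subseteq> M" "e \<in> K"
  then have "depends (u e) M" by (intro u_dep') auto
  then show "depends (\<lambda>x. 1 + u e x) M" unfolding depends_def by metis
qed

text \<open>With \<open>X = B \<union> Y\<close> and \<open>Y \<subseteq> K\<close>, the sum over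
  \<open>Y\<close> produces the density \<open>weight K\<close>. The cut-off does not factor in this
  way: pairs with \<open>card (B \<union> Y) > N\<close> occur on the right but not on the left. By
  \<open>small\<close> their \<open>B\<close> is not admissible, so \<open>peel\<close> shows that
  they contribute nothing.\<close>

lemma pexpect_split:
  assumes K: "K \<subseteq> C" "\<Union>K \<subseteq> M" "M \<subseteq> V" and F: "depends F M" and G: "depends G T" "T \<subseteq> V"
    and small: "\<And>B f. B \<subseteq> C - K \<Longrightarrow> card B \<le> N \<Longrightarrow> admissible t B (M \<union> T) f \<Longrightarrow> card (B \<union> K) \<le> N"
  shows "pexpect (\<lambda>x. F x * G x)
    = (\<Sum>B\<in>{B. B \<subseteq> C - K \<and> card B \<le> N}. expect (\<lambda>x. (weight K x * F x) * ((\<Prod>e\<in>B. u e x) * G x)))"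
proof -
  define tm where "tm X = expect (\<lambda>x. (\<Prod>e\<in>X. u e x) * (F x * G x))" for X
  have finK: "finite K" using K(1) finC by (rule finite_subset)
  let ?BB = "{B. B \<subseteq> C - K \<and> card B \<le> N}"
  have finBB: "finite ?BB" by (rule finite_subset[of _ "Pow C"]) (use finC in auto)
  have un: "(\<Prod>e\<in>B \<union> Y. u e x) = (\<Prod>e\<in>B. u e x) * (\<Prod>e\<in>Y. u e x)" if "B \<in> ?BB" "Y \<in> Pow K" for B Y x
    using that finC K by (intro prod.union_disjoint) (auto intro: finite_subset)
  have "(\<Sum>B\<in>?BB. expect (\<lambda>x. (weight K x * F x) * ((\<Prod>e\<in>B. u e x) * G x)))
      = (\<Sum>B\<in>?BB. \<Sum>Y\<in>Pow K. tm (B \<union> Y))"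
  proof (intro sum.cong refl)
    fix B assume B: "B \<in> ?BB"
    have "(\<lambda>x. (weight K x * F x) * ((\<Prod>e\<in>B. u e x) * G x))
        = (\<lambda>x. \<Sum>Y\<in>Pow K. (\<Prod>e\<in>B \<union> Y. u e x) * (F x * G x))"
      unfolding weight_def prod_one_plus[OF finK] sum_distrib_right
      by (intro ext sum.cong refl) (use un[OF B] in \<open>simp add: algebra_simps\<close>)
    then show "expect (\<lambda>x. (weight K x * F x) * ((\<Prod>e\<in>B. u e x) * G x)) = (\<Sum>Y\<in>Pow K. tm (B \<union> Y))"
      by (simp add: expect_sum tm_def)
  qed
  also have "\<dots> = (\<Sum>(B, Y)\<in>?BB \<times> Pow K. tm (B \<union> Y))"
    by (rule sum.cartesian_product)
  also have "\<dots> = (\<Sum>(B, Y)\<in>{(B, Y)\<in>?BB \<times> Pow K. card (B \<union> Y) \<le> N}. tm (B \<union> Y))"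
  proof (rule sum.mono_neutral_right)
    show "finite (?BB \<times> Pow K)" using finBB finK by auto
    show "\<forall>i\<in>?BB \<times> Pow K - {(B, Y)\<in>?BB \<times> Pow K. card (B \<union> Y) \<le> N}. (case i of (B, Y) \<Rightarrow> tm (B \<union> Y)) = 0"
    proof (intro ballI)
      fix i assume i: "i \<in> ?BB \<times> Pow K - {(B, Y)\<in>?BB \<times> Pow K. card (B \<union> Y) \<le> N}"
      obtain B Y where iBY: "i = (B, Y)" by force
      have B: "B \<subseteq> C - K" "card B \<le> N" and Y: "Y \<subseteq> K" and big: "\<not> (card (B \<union> Y) \<le> N)"
        using i by (auto simp: iBY)
      have noadm: "\<not> admissible t B (M \<union> T) f" for f
      proof
        assume "admissible t B (M \<union> T) f"
        then have "card (B \<union> K) \<le> N" using small B by blast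
        moreover have "card (B \<union> Y) \<le> card (B \<union> K)"
          using Y B finK finC by (intro card_mono) (auto intro: finite_subset)
        ultimately show False using big by simp
      qed
      have "tm (B \<union> Y) = expect (\<lambda>x. ((\<Prod>e\<in>Y. u e x) * F x) * ((\<Prod>e\<in>B. u e x) * G x))"
        unfolding tm_def using un[of B Y] B Y by (simp add: algebra_simps)
      also have "\<dots> = 0"
      proof (rule peel[where M = M and T = T])
        show "depends (\<lambda>x. (\<Prod>e\<in>Y. u e x) * F x) M"
          using Y K by (intro depends_mult F depends_prod_u) auto
      qed (use B K G noadm in auto)
      finally show "(case i of (B, Y) \<Rightarrow> tm (B \<union> Y)) = 0" by (simp add: iBY)
    qed
  qed auto
  also have "\<dots> = (\<Sum>X\<in>{X. X \<subseteq> C \<and> card X \<le> N}. tm X)"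
  proof (rule sum.reindex_bij_witness[where i = "\<lambda>X. (X - K, X \<inter> K)" and j = "\<lambda>(B, Y). B \<union> Y"])
    fix X assume X: "X \<in> {X. X \<subseteq> C \<and> card X \<le> N}"
    then have "card (X - K) \<le> card X" using finC by (intro card_mono) (auto intro: finite_subset)
    moreover have "X - K \<union> X \<inter> K = X" by auto
    ultimately show "(X - K, X \<inter> K) \<in> {(B, Y)\<in>?BB \<times> Pow K. card (B \<union> Y) \<le> N}" using X by auto
  qed (use K in auto)
  finally show ?thesis unfolding pexpect_def tm_def by simp
qed

text \<open>If nothing can be attached to \<open>M\<close>, only \<open>B = {}\<close> survives in
  \<open>pexpect_split\<close>, and the functional becomes an expectation under the nonnegative
  density \<open>weight K\<close>.\<close>

lemma pexpect_closed:
  assumes K: "K \<subseteq> C" "\<Union>K \<subseteq> M" "M \<subseteq> V" "card K \<le> N" and F: "depends F M"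
    and closed: "\<And>B f. B \<subseteq> C - K \<Longrightarrow> B \<noteq> {} \<Longrightarrow> card B \<le> N \<Longrightarrow> \<not> admissible t B M f"
  shows "pexpect F = expect (\<lambda>x. weight K x * F x)"
proof -
  have "pexpect F = pexpect (\<lambda>x. F x * 1)" by simp
  also have "\<dots> = (\<Sum>B\<in>{B. B \<subseteq> C - K \<and> card B \<le> N}. expect (\<lambda>x. (weight K x * F x) * ((\<Prod>e\<in>B. u e x) * 1)))"
  proof (rule pexpect_split[OF K(1,2,3) F, where T = "{}"])
    fix B f assume "B \<subseteq> C - K" "card B \<le> N" "admissible t B (M \<union> {}) f"
    then have "B = {}" using closed[of B f] by auto
    then show "card (B \<union> K) \<le> N" using K by simp
  qed auto
  also have "\<dots> = (\<Sum>B\<in>{{}}. expect (\<lambda>x. (weight K x * F x) * ((\<Prod>e\<in>B. u e x) * 1)))"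
  proof (rule sum.mono_neutral_right)
    show "finite {B. B \<subseteq> C - K \<and> card B \<le> N}"
      by (rule finite_subset[of _ "Pow C"]) (use finC in auto)
    show "\<forall>B\<in>{B. B \<subseteq> C - K \<and> card B \<le> N} - {{}}. expect (\<lambda>x. (weight K x * F x) * ((\<Prod>e\<in>B. u e x) * 1)) = 0"
    proof
      fix B assume B: "B \<in> {B. B \<subseteq> C - K \<and> card B \<le> N} - {{}}"
      show "expect (\<lambda>x. (weight K x * F x) * ((\<Prod>e\<in>B. u e x) * 1)) = 0"
      proof (rule peel[where M = M and T = "{}"])
        show "depends (\<lambda>x. weight K x * F x) M" using K by (intro depends_mult F depends_weight) auto
      qed (use B closed K in auto)
    qed
  qed auto
  finally show ?thesis by simp
qed

definition cylinder :: "'v set \<Rightarrow> ('v \<Rightarrow> 'd) \<Rightarrow> ('v \<Rightarrow> 'd) \<Rightarrow> real" where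
  "cylinder T a x = (if \<forall>v\<in>T. x v = a v then 1 else 0)"

lemma depends_cylinder: "depends (cylinder T a) T"
  unfolding depends_def cylinder_def by auto

lemma depends_expand:
  assumes h: "depends h U" and U: "finite U" and x: "\<And>v. v \<in> U \<Longrightarrow> x v \<in> A"
  shows "h x = (\<Sum>a\<in>PiE U (\<lambda>_. A). h a * cylinder U a x)"
proof -
  have "(\<Sum>a\<in>PiE U (\<lambda>_. A). h a * cylinder U a x) = (\<Sum>a\<in>{restrict x U}. h a * cylinder U a x)"
  proof (rule sum.mono_neutral_right)
    show "\<forall>a\<in>PiE U (\<lambda>_. A) - {restrict x U}. h a * cylinder U a x = 0"
    proof (intro ballI)
      fix a assume "a \<in> PiE U (\<lambda>_. A) - {restrict x U}"
      then have a: "a \<in> PiE U (\<lambda>_. A)" "a \<noteq> restrict x U" by auto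
      then have "\<exists>v\<in>U. x v \<noteq> a v" by (metis PiE_restrict restrict_ext)
      then show "h a * cylinder U a x = 0" by (auto simp: cylinder_def)
    qed
    show "finite (PiE U (\<lambda>_. A))" using U finA by (intro finite_PiE) auto
    show "{restrict x U} \<subseteq> PiE U (\<lambda>_. A)" using x by auto
  qed
  also have "\<dots> = h (restrict x U)" by (simp add: cylinder_def)
  also have "\<dots> = h x" by (intro h[unfolded depends_def, rule_format]) auto
  finally show ?thesis by simp
qed

end

locale expanding_csp = local_csp A w V C k t u N x0
  for A :: "'d set" and w and V :: "'v set" and C and k t :: nat and u and N :: nat and x0 +
  fixes \<zeta> :: real and r :: nat
  assumes \<zeta>: "0 < \<zeta>" and N: "1 \<le> N" "3 * real r \<le> \<zeta> * N"
    and expansion: "\<And>X. X \<subseteq> C \<Longrightarrow> X \<noteq> {} \<Longrightarrow> card X \<le> 2 * N \<Longrightarrow>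
      (2 * real k - real t - 1 + \<zeta>) * card X \<le> 2 * card (\<Union>X)"
begin

text \<open>Deleting \<open>S\<close> loses at most \<open>card S\<close> variables, so a potential
  that is not too negative contradicts expansion unless \<open>X\<close> is small. Expansion is
  assumed up to \<open>2 * N\<close> because \<open>X\<close> will be the union of a closure and an
  attached set, each of size at most \<open>N\<close>.\<close>

lemma expansion_rel:
  fixes m :: real
  assumes S: "S \<subseteq> V" and X: "X \<subseteq> C" "card X \<le> 2 * N" and m: "0 \<le> m"
    and pot: "- m \<le> (2 * real k - real t - 1) * card X - 2 * card (\<Union>X - S)"
  shows "\<zeta> * card X \<le> 2 * card S + m"
proof (cases "X = {}")
  case False
  have "finite S" using S finV by (rule finite_subset)
  moreover have "finite (\<Union>X)" using X CV by (intro finite_subset[OF _ finV]) blast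
  ultimately have "card (\<Union>X) \<le> card (\<Union>X - S) + card S"
    by (metis card_Un_le card_mono finite_Diff finite_UnI le_trans Un_Diff_cancel2 sup_ge1)
  then have "real (card (\<Union>X)) \<le> card (\<Union>X - S) + card S" by linarith
  then show ?thesis using expansion[OF X(1) False X(2)] pot by (simp add: algebra_simps)
qed (use m in simp)

text \<open>A set \<open>K\<close> of maximal size among those of nonnegative potential plays the role of the closure
  of \<open>S\<close>: whatever can still be attached to \<open>K\<close> and \<open>T\<close> meets the closure in fewer than
  \<open>card T\<close> variables.\<close>

lemma closure_exists:
  assumes S: "S \<subseteq> V" "card S \<le> r"
  obtains K where "K \<subseteq> C" "card K \<le> N"
    "\<And>B T f. B \<subseteq> C - K \<Longrightarrow> B \<noteq> {} \<Longrightarrow> card B \<le> N \<Longrightarrow> T \<subseteq> V \<Longrightarrow> card T \<le> r \<Longrightarrow>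
       admissible t B ((\<Union>K \<union> S) \<union> T) f \<Longrightarrow>
       card (B \<union> K) \<le> N \<and> card (((\<Union>e\<in>B. f e) \<union> T) \<inter> (\<Union>K \<union> S)) < card T"
proof -
  \<comment> \<open>The potential has the threshold of \<open>admissible_count\<close>, without the
    slack \<open>\<zeta>\<close>: attaching an admissible set does not decrease it except for what
    \<open>T\<close> pays.\<close>
  define \<Phi> where "\<Phi> X = (2 * real k - real t - 1) * card X - 2 * card (\<Union>X - S)" for X :: "'v set set"
  define \<K> where "\<K> = {K. K \<subseteq> C \<and> card K \<le> N \<and> 0 \<le> \<Phi> K}"
  have "finite \<K>" unfolding \<K>_def using finC by (auto intro: finite_subset[of _ "Pow C"])
  moreover have "{} \<in> \<K>" by (simp add: \<K>_def \<Phi>_def)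
  ultimately obtain K where K: "K \<in> \<K>" and maxK: "\<And>K'. K' \<in> \<K> \<Longrightarrow> card K' \<le> card K"
  proof -
    assume fin: "finite \<K>" and ne: "{} \<in> \<K>"
    have "Max (card ` \<K>) \<in> card ` \<K>" using fin ne by (intro Max_in) auto
    then obtain K where "K \<in> \<K>" "card K = Max (card ` \<K>)" by auto
    then show thesis using that[of K] fin by simp
  qed
  have KC: "K \<subseteq> C" "card K \<le> N" "0 \<le> \<Phi> K" using K by (auto simp: \<K>_def)
  have finK: "finite K" using KC(1) finC by (rule finite_subset)
  let ?M = "\<Union>K \<union> S"
  have finM: "finite ?M" using KC CV S by (intro finite_subset[OF _ finV]) blast
  have "card (B \<union> K) \<le> N \<and> card (((\<Union>e\<in>B. f e) \<union> T) \<inter> ?M) < card T"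
    if B: "B \<subseteq> C - K" "B \<noteq> {}" "card B \<le> N" and T: "T \<subseteq> V" "card T \<le> r"
      and admissible: "admissible t B (?M \<union> T) f" for B T f
  proof -
    have finB: "finite B" using B(1) finC by (meson Diff_subset finite_subset)
    have finT: "finite T" using T(1) finV by (rule finite_subset)
    have BK: "B \<union> K \<subseteq> C" "card (B \<union> K) = card B + card K"
      using B KC finB finK by (auto intro!: card_Un_disjoint)
    let ?U = "\<Union>e\<in>B. f e"
    have Bk: "finite e \<and> card e = k" if "e \<in> B" for e
      using edge_finite[of e] that B by (meson Diff_subset subset_iff)
    have "\<Union>(B \<union> K) - S = (\<Union>K - S) \<union> (\<Union>B - ?M)" by auto
    then have "card (\<Union>(B \<union> K) - S) = card (\<Union>K - S) + card (\<Union>B - ?M)"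
      using finM finB Bk by (auto intro!: card_Un_disjoint)
    moreover have "2 * card (\<Union>B - ?M) + (t + 1) * card B + card (?U \<inter> ?M)
        \<le> 2 * k * card B + card (?U \<inter> T - ?M)"
      by (rule admissible_count[OF admissible finB Bk])
    then have "real (2 * card (\<Union>B - ?M) + (t + 1) * card B + card (?U \<inter> ?M))
        \<le> real (2 * k * card B + card (?U \<inter> T - ?M))" by (rule of_nat_mono)
    ultimately have pot: "\<Phi> K + card (?U \<inter> ?M) - card (?U \<inter> T - ?M) \<le> \<Phi> (B \<union> K)"
      unfolding \<Phi>_def BK(2) by (simp add: algebra_simps)
    have Tc: "card (T - ?M) + card (T \<inter> ?M) = card T"
      by (metis Int_Diff_Un card_Un_disjoint Int_Diff_disjoint finT finite_Diff finite_Int add.commute)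
    have "card (?U \<inter> T - ?M) \<le> card (T - ?M)"
      using finT by (intro card_mono) auto
    then have UT: "card (?U \<inter> T - ?M) \<le> card T" using Tc by linarith
    \<comment> \<open>Each variable of \<open>T\<close> costs at most one unit of potential.
      Together with \<open>2 * card S\<close> from \<open>expansion_rel\<close> this is the
      \<open>3 * r\<close> of the locale.\<close>
    have "- real (card T) \<le> \<Phi> (B \<union> K)" using pot KC(3) UT by linarith
    then have "\<zeta> * card (B \<union> K) \<le> 2 * card S + real (card T)"
      unfolding \<Phi>_def using expansion_rel[OF S(1) BK(1), where m = "real (card T)"] BK B KC by simp
    also have "\<dots> \<le> \<zeta> * N" using S T N by simp
    finally have BKN: "card (B \<union> K) \<le> N" using \<zeta> by simp
    \<comment> \<open>Otherwise the attachment would keep the potential nonnegative, against the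
      maximality of \<open>K\<close>. This strict inequality gives the strict one in the
      conclusion.\<close>
    have "card (?U \<inter> ?M) < card (?U \<inter> T - ?M)"
    proof (rule ccontr)
      assume "\<not> ?thesis"
      then have "0 \<le> \<Phi> (B \<union> K)" using pot KC(3) by linarith
      then have "B \<union> K \<in> \<K>" using BK BKN by (simp add: \<K>_def)
      then have "card (B \<union> K) \<le> card K" by (rule maxK)
      then show False using BK(2) B(2) finB by simp
    qed
    moreover have "card ((?U \<union> T) \<inter> ?M) \<le> card (?U \<inter> ?M) + card (T \<inter> ?M)"
      by (metis Int_Un_distrib2 card_Un_le)
    ultimately have "card ((?U \<union> T) \<inter> ?M) < card T"
      using Tc \<open>card (?U \<inter> T - ?M) \<le> card (T - ?M)\<close> by linarith
    then show ?thesis using BKN by blast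
  qed
  then show ?thesis using that[of K] KC by blast
qed

text \<open>The empty set is its own closure: a nonempty \<open>B\<close> that is admissible with no
  old variables would have nonnegative potential, which expansion forbids.\<close>

lemma pexpect_one: "pexpect (\<lambda>x. 1) = 1"
proof -
  have "pexpect (\<lambda>x. 1) = expect (\<lambda>x. weight {} x * 1)"
  proof (rule pexpect_closed[where M = "{}"])
    fix B f assume B: "B \<subseteq> C - {}" "B \<noteq> {}" "card B \<le> N"
    show "\<not> admissible t B {} f"
    proof
      assume admissible: "admissible t B {} f"
      have finB: "finite B" using B(1) finC by (meson Diff_subset finite_subset)
      have Bk: "finite e \<and> card e = k" if "e \<in> B" for e
        using edge_finite[of e] that B by (meson Diff_subset subset_iff)
      have "2 * card (\<Union>B - {}) + (t + 1) * card B + card ((\<Union>e\<in>B. f e) \<inter> {})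
        \<le> 2 * k * card B + card ((\<Union>e\<in>B. f e) \<inter> {} - {})"
        by (rule admissible_count) (use admissible finB Bk in auto)
      then have "real (2 * card (\<Union>B) + (t + 1) * card B) \<le> real (2 * k * card B)"
        by (intro of_nat_mono) simp
      then have "0 \<le> (2 * real k - real t - 1) * card B - 2 * card (\<Union>B - {})"
        by (simp add: algebra_simps)
      then have "\<zeta> * card B \<le> 0"
        using expansion_rel[of "{}" B 0] B by simp
      then show False using \<zeta> B finB by (simp add: mult_le_0_iff)
    qed
  qed auto
  then show ?thesis by (simp add: weight_def)
qed

section \<open>Positivity by orthogonalization\<close>

definition basis_list :: "('v set \<times> ('v \<Rightarrow> 'd)) list \<Rightarrow> bool" where
  "basis_list l \<longleftrightarrow> sorted (map (card \<circ> fst) l) \<and>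
     set l = {(T, a). T \<subseteq> V \<and> card T \<le> r \<and> a \<in> PiE T (\<lambda>_. A)}"

lemma basis_list_exists: "\<exists>l. basis_list l"
proof -
  have "{(T, a). T \<subseteq> V \<and> card T \<le> r \<and> a \<in> PiE T (\<lambda>_. A)}
      \<subseteq> (SIGMA T:Pow V. PiE T (\<lambda>_. A))" by auto
  moreover have "finite (SIGMA T:Pow V. PiE T (\<lambda>_. A))"
    using finV finA by (intro finite_SigmaI finite_PiE) (auto intro: finite_subset)
  ultimately have "finite {(T, a). T \<subseteq> V \<and> card T \<le> r \<and> a \<in> PiE T (\<lambda>_. A)}"
    by (rule finite_subset)
  from finite_list[OF this] obtain l where
    "set l = {(T, a). T \<subseteq> V \<and> card T \<le> r \<and> a \<in> PiE T (\<lambda>_. A)}" ..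
  then show ?thesis unfolding basis_list_def
    by (intro exI[of _ "sort_key (card \<circ> fst) l"]) simp
qed

text \<open>The residual is a projection for \<open>Q\<close>, a genuine positive semidefinite form
  on the closure \<open>M\<close>. Against an earlier indicator, every term with \<open>B\<close>
  nonempty or \<open>T\<close> not inside \<open>M\<close> reduces to functions of fewer than
  \<open>card S\<close> variables of \<open>M\<close>. The order by size puts all indicators of such
  sets before \<open>j\<close>, so they belong to \<open>L\<close> and the term vanishes. Indicators
  of sets as large as \<open>S\<close> are covered because the reduction is strict.\<close>

lemma local_orthogonalization:
  assumes l: "basis_list l" and j: "j < length l"
  defines "b \<equiv> \<lambda>i. cylinder (fst (l ! i)) (snd (l ! i))"
  shows "\<exists>c. (\<forall>i<j. pexpect (\<lambda>x. (b j x - (\<Sum>i<j. c i * b i x)) * b i x) = 0) \<and>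
      0 \<le> pexpect (\<lambda>x. (b j x - (\<Sum>i<j. c i * b i x)) * (b j x - (\<Sum>i<j. c i * b i x)))"
proof -
  have elem: "fst (l ! i) \<subseteq> V" "card (fst (l ! i)) \<le> r" if "i < length l" for i
    using nth_mem[OF that] l unfolding basis_list_def by auto
  define S where "S = fst (l ! j)"
  have S: "S \<subseteq> V" "card S \<le> r" using elem[OF j] by (auto simp: S_def)
  have le_S: "card (fst (l ! i)) \<le> card S" if "i < j" for i
    using l that j sorted_nth_mono[of "map (card \<circ> fst) l" i j]
    unfolding basis_list_def S_def by auto
  obtain K where K: "K \<subseteq> C" "card K \<le> N" and KT: "\<And>B T f. B \<subseteq> C - K \<Longrightarrow> B \<noteq> {} \<Longrightarrow> card B \<le> N \<Longrightarrow> T \<subseteq> V \<Longrightarrow> card T \<le> r \<Longrightarrow>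
       admissible t B ((\<Union>K \<union> S) \<union> T) f \<Longrightarrow>
       card (B \<union> K) \<le> N \<and> card (((\<Union>e\<in>B. f e) \<union> T) \<inter> (\<Union>K \<union> S)) < card T"
    using closure_exists[OF S] by blast
  define M where "M = \<Union>K \<union> S"
  have M: "M \<subseteq> V" "\<Union>K \<subseteq> M" "S \<subseteq> M" using K CV S by (auto simp: M_def)
  have noadm: "\<not> admissible t B M f" if "B \<subseteq> C - K" "B \<noteq> {}" "card B \<le> N" for B f
    using KT[of B "{}" f] that by (auto simp: M_def)
  have closed: "pexpect F = expect (\<lambda>x. weight K x * F x)" if "depends F M" for F
    by (rule pexpect_closed[OF K(1) M(2,1) K(2) that noadm])
  define L where "L = {i. i < j \<and> fst (l ! i) \<subseteq> M}"
  have finL: "finite L" by (simp add: L_def)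
  define Q where "Q F G = expect (\<lambda>x. weight K x * (F x * G x))" for F G
  have "\<exists>c. \<forall>i\<in>L. Q (\<lambda>x. b j x - (\<Sum>j\<in>L. c j * b j x)) (b i) = 0"
  proof (rule linear_forms_orthogonalize[where Q = Q and L = L and p = "b j" and b = b])
    show "Q (\<lambda>x. F x + c * G x) H = Q F H + c * Q G H" for F G H c
      unfolding Q_def expect_cmult[symmetric] expect_add[symmetric] by (simp add: algebra_simps)
    show "Q F G = Q G F" for F G by (simp add: Q_def mult.commute)
    show "0 \<le> Q F F" for F unfolding Q_def
      by (intro expect_nonneg mult_nonneg_nonneg[OF weight_nonneg[OF K(1)] zero_le_square])
    show "finite L" by (rule finL)
  qed
  then obtain c where c: "\<And>i. i \<in> L \<Longrightarrow> Q (\<lambda>x. b j x - (\<Sum>j\<in>L. c j * b j x)) (b i) = 0" by blast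
  define R where "R = (\<lambda>x. b j x - (\<Sum>j\<in>L. c j * b j x))"
  define c' where "c' i = (if i \<in> L then c i else 0)" for i
  have "(\<Sum>i<j. c' i * b i x) = (\<Sum>i\<in>L. c i * b i x)" for x
    by (intro sum.mono_neutral_cong_right) (auto simp: c'_def L_def)
  then have R: "(\<lambda>x. b j x - (\<Sum>i<j. c' i * b i x)) = R" by (simp add: R_def)
  have depb: "depends (b i) (fst (l ! i))" for i unfolding b_def by (rule depends_cylinder)
  have depR: "depends R M" unfolding R_def
  proof (intro depends_diff depends_sum depends_mult depends_const)
    show "depends (b j) M" using depb[of j] M(3) unfolding S_def by (rule depends_mono)
    show "depends (b i) M" if "i \<in> L" for i using that depb[of i] depends_mono by (auto simp: L_def)
  qed
  have zero_cylinder: "expect (\<lambda>x. (weight K x * R x) * cylinder U a x) = 0"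
    if U: "U \<subseteq> M" "card U < card S" and a: "a \<in> PiE U (\<lambda>_. A)" for U a
  proof -
    have "(U, a) \<in> set l" using l U a M S unfolding basis_list_def by auto
    then obtain i where i: "i < length l" "l ! i = (U, a)" by (metis in_set_conv_nth)
    have "i < j"
    proof (rule ccontr)
      assume "\<not> i < j"
      then have "card S \<le> card U"
        using l i sorted_nth_mono[of "map (card \<circ> fst) l" j i] j
        unfolding basis_list_def S_def by auto
      then show False using U by simp
    qed
    then have "i \<in> L" using i U by (simp add: L_def)
    then show ?thesis using c[of i] i by (simp add: Q_def R_def b_def mult.assoc)
  qed
  have zero: "expect (\<lambda>x. (weight K x * R x) * h x) = 0" if h: "depends h U" and U: "U \<subseteq> M" "card U < card S" for h :: "('v \<Rightarrow> 'd) \<Rightarrow> real" and U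
  proof -
    have finU: "finite U" using U M finV by (meson finite_subset)
    have "expect (\<lambda>x. (weight K x * R x) * h x)
        = expect (\<lambda>x. \<Sum>a\<in>PiE U (\<lambda>_. A). h a * ((weight K x * R x) * cylinder U a x))"
    proof (rule expect_cong)
      fix x assume "\<And>v. v \<in> V \<Longrightarrow> x v \<in> A"
      then have "h x = (\<Sum>a\<in>PiE U (\<lambda>_. A). h a * cylinder U a x)"
        using U M by (intro depends_expand[OF h finU]) auto
      then show "(weight K x * R x) * h x = (\<Sum>a\<in>PiE U (\<lambda>_. A). h a * ((weight K x * R x) * cylinder U a x))"
        by (simp add: sum_distrib_left algebra_simps)
    qed
    also have "\<dots> = 0" unfolding expect_sum expect_cmult using zero_cylinder[OF U] by simp
    finally show ?thesis .
  qed
  have orth: "pexpect (\<lambda>x. R x * b i x) = 0" if i: "i < j" for i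
  proof -
    define T where "T = fst (l ! i)"
    have T: "T \<subseteq> V" "card T \<le> r" "card T \<le> card S" "depends (b i) T"
      using elem[of i] i j le_S[OF i] depb[of i] by (auto simp: T_def)
    have "pexpect (\<lambda>x. R x * b i x)
        = (\<Sum>B\<in>{B. B \<subseteq> C - K \<and> card B \<le> N}. expect (\<lambda>x. (weight K x * R x) * ((\<Prod>e\<in>B. u e x) * b i x)))"
    proof (rule pexpect_split[OF K(1) M(2,1) depR T(4,1)])
      fix B f assume B: "B \<subseteq> C - K" "card B \<le> N" "admissible t B (M \<union> T) f"
      then show "card (B \<union> K) \<le> N"
        using KT[of B T f] T K by (cases "B = {}") (auto simp: M_def)
    qed
    also have "\<dots> = 0"
    proof (intro sum.neutral ballI)
      fix B assume B: "B \<in> {B. B \<subseteq> C - K \<and> card B \<le> N}"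
      show "expect (\<lambda>x. (weight K x * R x) * ((\<Prod>e\<in>B. u e x) * b i x)) = 0"
      proof (cases "B = {} \<and> T \<subseteq> M")
        case True
        then have "i \<in> L" using i by (simp add: L_def T_def)
        then show ?thesis using c[of i] True by (simp add: Q_def R_def mult.assoc)
      next
        case False
        show ?thesis
        proof (rule peel[OF _ M(1) _ T(4,1)])
          show "depends (\<lambda>x. weight K x * R x) M" by (intro depends_mult depR depends_weight K M)
          fix f and h :: "('v \<Rightarrow> 'd) \<Rightarrow> real"
          assume admissible: "admissible t B (M \<union> T) f" and h: "depends h (((\<Union>e\<in>B. f e) \<union> T) \<inter> M)"
          have "card (((\<Union>e\<in>B. f e) \<union> T) \<inter> M) < card T"
          proof (cases "B = {}")
            case True
            \<comment> \<open>With nothing attached, \<open>T\<close> sticks out of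
              \<open>M\<close>, so \<open>T \<inter> M\<close> is a proper subset of
              \<open>T\<close>.\<close>
            then show ?thesis using False T finV
              by (auto intro!: psubset_card_mono intro: finite_subset)
          next
            case False
            then show ?thesis using KT[of B T f] B T admissible by (auto simp: M_def)
          qed
          then show "expect (\<lambda>x. (weight K x * R x) * h x) = 0"
            using T by (intro zero[OF h]) auto
        qed (use B in auto)
      qed
    qed
    finally show ?thesis .
  qed
  have "0 \<le> pexpect (\<lambda>x. R x * R x)"
    by (subst closed[OF depends_mult[OF depR depR]])
      (intro expect_nonneg mult_nonneg_nonneg[OF weight_nonneg[OF K(1)] zero_le_square])
  then show ?thesis using orth R by (intro exI[of _ c']) metis
qed

text \<open>The shape of a polynomial split into monomials: each \<open>T i\<close> is small
  although their union need not be. The listed indicators span all such sums; they may be linearly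
  dependent, which \<open>triangular_psd\<close> allows.\<close>

lemma pexpect_square_nonneg:
  assumes I: "finite I" and F: "\<And>i. i \<in> I \<Longrightarrow> depends (F i) (T i) \<and> T i \<subseteq> V \<and> card (T i) \<le> r"
  shows "0 \<le> pexpect (\<lambda>x. (\<Sum>i\<in>I. F i x) ^ 2)"
proof -
  obtain l where l: "basis_list l" using basis_list_exists by blast
  define b where "b = (\<lambda>i. cylinder (fst (l ! i)) (snd (l ! i)))"
  let ?m = "length l"
  have one: "\<exists>a. \<forall>x. (\<forall>v\<in>V. x v \<in> A) \<longrightarrow> F i x = (\<Sum>j<?m. a j * b j x)" if i: "i \<in> I" for i
  proof -
    have fin: "finite (T i)" using F[OF i] finV finite_subset by blast
    have fP: "finite (PiE (T i) (\<lambda>_. A))" using fin finA by (intro finite_PiE) auto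
    have "\<exists>j<?m. l ! j = (T i, a)" if "a \<in> PiE (T i) (\<lambda>_. A)" for a
    proof -
      have "(T i, a) \<in> set l" using l F[OF i] that unfolding basis_list_def by auto
      then show ?thesis by (metis in_set_conv_nth)
    qed
    then obtain J where J: "\<And>a. a \<in> PiE (T i) (\<lambda>_. A) \<Longrightarrow> J a < ?m \<and> l ! J a = (T i, a)" by metis
    define c where "c j = (\<Sum>a\<in>{a\<in>PiE (T i) (\<lambda>_. A). J a = j}. F i a)" for j
    have "F i x = (\<Sum>j<?m. c j * b j x)" if x: "\<forall>v\<in>V. x v \<in> A" for x
    proof -
      have "F i x = (\<Sum>a\<in>PiE (T i) (\<lambda>_. A). F i a * cylinder (T i) a x)"
        by (rule depends_expand) (use F[OF i] fin x in auto)
      also have "\<dots> = (\<Sum>a\<in>PiE (T i) (\<lambda>_. A). F i a * b (J a) x)"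
        by (intro sum.cong refl) (simp add: b_def J)
      also have "\<dots> = (\<Sum>j<?m. \<Sum>a\<in>{a\<in>PiE (T i) (\<lambda>_. A). J a = j}. F i a * b (J a) x)"
        by (rule sum.group[symmetric]) (use fP J in auto)
      also have "\<dots> = (\<Sum>j<?m. c j * b j x)"
        by (intro sum.cong refl) (simp add: c_def sum_distrib_right)
      finally show ?thesis .
    qed
    then show ?thesis by blast
  qed
  then obtain a where a: "\<And>i x. i \<in> I \<Longrightarrow> \<forall>v\<in>V. x v \<in> A \<Longrightarrow> F i x = (\<Sum>j<?m. a i j * b j x)"
    by metis
  define c where "c j = (\<Sum>i\<in>I. a i j)" for j
  have "pexpect (\<lambda>x. (\<Sum>i\<in>I. F i x) ^ 2) = pexpect (\<lambda>x. (\<Sum>j<?m. c j * b j x) * (\<Sum>j<?m. c j * b j x))"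
  proof (rule pexpect_cong)
    fix x assume "\<And>v. v \<in> V \<Longrightarrow> x v \<in> A"
    then have "(\<Sum>i\<in>I. F i x) = (\<Sum>i\<in>I. \<Sum>j<?m. a i j * b j x)" by (intro sum.cong refl a) auto
    also have "\<dots> = (\<Sum>j<?m. c j * b j x)"
      by (subst sum.swap) (simp add: c_def sum_distrib_right)
    finally show "(\<Sum>i\<in>I. F i x) ^ 2 = (\<Sum>j<?m. c j * b j x) * (\<Sum>j<?m. c j * b j x)"
      by (simp add: power2_eq_square)
  qed
  also have "0 \<le> \<dots>"
  proof (rule triangular_psd[where Q = "\<lambda>F G. pexpect (\<lambda>x. F x * G x)" and m = ?m and b = b])
    show "pexpect (\<lambda>x. (F x + c * G x) * H x) = pexpect (\<lambda>x. F x * H x) + c * pexpect (\<lambda>x. G x * H x)"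
      for F G H :: "('v \<Rightarrow> 'd) \<Rightarrow> real" and c
      unfolding pexpect_lin[symmetric] by (simp add: algebra_simps)
    show "pexpect (\<lambda>x. F x * G x) = pexpect (\<lambda>x. G x * F x)" for F G by (simp add: mult.commute)
    show "\<exists>c. (\<forall>i<j. pexpect (\<lambda>x. (b j x - (\<Sum>i<j. c i * b i x)) * b i x) = 0) \<and>
      0 \<le> pexpect (\<lambda>x. (b j x - (\<Sum>i<j. c i * b i x)) * (b j x - (\<Sum>i<j. c i * b i x)))"
      if "j < ?m" for j
      using local_orthogonalization[OF l that] unfolding b_def .
  qed
  finally show ?thesis .
qed

section \<open>Exact pseudo-marginals of single constraints\<close>

definition sparse_at :: "'v set \<Rightarrow> bool" where
  "sparse_at e \<longleftrightarrow> (\<forall>X. X \<subseteq> C \<and> e \<in> X \<and> 2 \<le> card X \<and> \<zeta> * card X \<le> t \<and> card X \<le> 2 * N \<longrightarrow>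
     2 * real k * card X - (real t + 1) * card X + t < 2 * card (\<Union>X))"

text \<open>A sparse edge is its own closure, since an admissible \<open>B\<close> attached to it
  would make \<open>insert e B\<close> too dense. The restriction
  \<open>\<zeta> * card X \<le> t\<close> in \<open>sparse_at\<close> follows from expansion for
  such an \<open>X\<close>; it keeps the families to be counted of size at most
  \<open>t / \<zeta>\<close>, on which the first moment bound for dense edges relies.\<close>

lemma pexpect_single:
  assumes e: "e \<in> C" and sparse: "sparse_at e" and F: "depends F e"
  shows "pexpect F = expect (\<lambda>x. (1 + u e x) * F x)"
proof -
  have fe: "finite e" using CV[OF e] finV finite_subset by auto
  have "pexpect F = expect (\<lambda>x. weight {e} x * F x)"
  proof (rule pexpect_closed[where M = e])
    fix B f assume B: "B \<subseteq> C - {e}" "B \<noteq> {}" "card B \<le> N"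
    show "\<not> admissible t B e f"
    proof
      assume admissible: "admissible t B e f"
      have finB: "finite B" using B(1) finC by (meson Diff_subset finite_subset)
      have Bk: "finite e \<and> card e = k" if "e \<in> B" for e
        using edge_finite[of e] that B by (meson Diff_subset subset_iff)
      have BC: "B \<subseteq> C" using B by auto
      let ?q = "card ((\<Union>e\<in>B. f e) \<inter> e)"
      have 0: "2 * card (\<Union>B - e) + (t + 1) * card B + ?q \<le> 2 * k * card B"
        using admissible_count[of t B e "{}" f k] admissible finB Bk by simp
      \<comment> \<open>If no selected variable lay in \<open>e\<close>, then \<open>B\<close> would
        be admissible on its own, which expansion excludes. This unit turns the excess
        \<open>t + 1\<close> of \<open>insert e B\<close> into \<open>t\<close>.\<close>
      have q: "1 \<le> ?q"
      proof (rule ccontr)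
        assume "\<not> ?thesis"
        then have "(\<Union>e\<in>B. f e) \<inter> e = {}" using fe by (metis One_nat_def Suc_leI card_gt_0_iff finite_Int)
        then have "(\<Union>e\<in>B. f e) - ({} \<union> {}) = (\<Union>e\<in>B. f e) - e" by (simp add: Diff_triv)
        then have adm': "admissible t B ({} \<union> {}) f" using admissible unfolding admissible_def by (simp only:)
        have "2 * card (\<Union>B) + (t + 1) * card B \<le> 2 * k * card B"
          using admissible_count[OF adm' finB Bk] by simp
        then have "real (2 * card (\<Union>B) + (t + 1) * card B) \<le> real (2 * k * card B)"
          by (rule of_nat_mono)
        then have "0 \<le> (2 * real k - real t - 1) * card B - 2 * card (\<Union>B - {})"
          by (simp add: algebra_simps)
        then have "\<zeta> * card B \<le> 0"
          using expansion_rel[of "{}" B 0] B BC by simp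
        then show False using \<zeta> B finB by (simp add: mult_le_0_iff)
      qed
      let ?X = "insert e B"
      have X: "?X \<subseteq> C" "card ?X = card B + 1" "2 \<le> card ?X" "card ?X \<le> 2 * N"
      proof -
        have "e \<notin> B" using B(1) by auto
        moreover have "0 < card B" using B finB by (simp add: card_gt_0_iff)
        ultimately show "?X \<subseteq> C" "card ?X = card B + 1" "2 \<le> card ?X" "card ?X \<le> 2 * N"
          using e BC B finB N by auto
      qed
      have "\<Union>?X = e \<union> (\<Union>B - e)" by auto
      then have "card (\<Union>?X) = k + card (\<Union>B - e)"
        using fe CV[OF e] finB Bk card_Un_disjoint[of e "\<Union>B - e"] by simp
      moreover have "real (2 * card (\<Union>B - e) + (t + 1) * card B + 1) \<le> real (2 * k * card B)"
        using 0 q by (intro of_nat_mono) linarith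
      ultimately have bad: "2 * card (\<Union>?X) \<le> 2 * real k * card ?X - (real t + 1) * card ?X + t"
        unfolding X(2) by (simp add: algebra_simps)
      have "(2 * real k - real t - 1 + \<zeta>) * card ?X \<le> 2 * card (\<Union>?X)"
        by (intro expansion) (use X in auto)
      then have "\<zeta> * card ?X \<le> t" using bad by (simp add: algebra_simps)
      then have "2 * real k * card ?X - (real t + 1) * card ?X + t < 2 * card (\<Union>?X)"
        using sparse[unfolded sparse_at_def, rule_format, of ?X] X(1,3,4) by blast
      then show False using bad by linarith
    qed
  qed (use e CV N F in auto)
  then show ?thesis by (simp add: weight_def)
qed

end

section \<open>Evaluation of polynomials\<close>

definition mono_eval :: "('v \<times> 'd \<Rightarrow>\<^sub>0 nat) \<Rightarrow> ('v \<Rightarrow> 'd) \<Rightarrow> real" where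
  "mono_eval m x = (\<Prod>i\<in>Poly_Mapping.keys m. of_bool (x (fst i) = snd i) ^ Poly_Mapping.lookup m i)"

definition poly_eval :: "('v \<times> 'd) mpolynomial \<Rightarrow> ('v \<Rightarrow> 'd) \<Rightarrow> real" where
  "poly_eval q x = (\<Sum>m\<in>Poly_Mapping.keys q. Poly_Mapping.lookup q m * mono_eval m x)"

lemma mono_eval_superset:
  assumes "finite S" "Poly_Mapping.keys m \<subseteq> S"
  shows "mono_eval m x = (\<Prod>i\<in>S. of_bool (x (fst i) = snd i) ^ Poly_Mapping.lookup m i)"
  unfolding mono_eval_def using assms
  by (intro prod.mono_neutral_left) (auto simp: in_keys_iff)

lemma mono_eval_add: "mono_eval (m + m') x = mono_eval m x * mono_eval m' x"
proof -
  let ?S = "Poly_Mapping.keys m \<union> Poly_Mapping.keys m'"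
  have fin: "finite ?S" by simp
  show ?thesis
    using mono_eval_superset[OF fin, of m x] mono_eval_superset[OF fin, of m' x]
      mono_eval_superset[OF fin keys_add, of x]
    by (simp add: lookup_add power_add prod.distrib)
qed

lemma mono_eval_zero [simp]: "mono_eval 0 x = 1"
  by (simp add: mono_eval_def)

lemma poly_eval_superset:
  assumes "finite S" "Poly_Mapping.keys q \<subseteq> S"
  shows "poly_eval q x = (\<Sum>m\<in>S. Poly_Mapping.lookup q m * mono_eval m x)"
  unfolding poly_eval_def using assms
  by (intro sum.mono_neutral_left) (auto simp: in_keys_iff)

lemma poly_eval_add: "poly_eval (p + q) x = poly_eval p x + poly_eval q x"
proof -
  let ?S = "Poly_Mapping.keys p \<union> Poly_Mapping.keys q"
  have fin: "finite ?S" by simp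
  show ?thesis
    using poly_eval_superset[OF fin, of p x] poly_eval_superset[OF fin, of q x]
      poly_eval_superset[OF fin keys_add, of x]
    by (simp add: lookup_add distrib_right sum.distrib)
qed

lemma poly_eval_zero [simp]: "poly_eval 0 x = 0"
  by (simp add: poly_eval_def)

lemma poly_eval_sum: "poly_eval (\<Sum>i\<in>I. p i) x = (\<Sum>i\<in>I. poly_eval (p i) x)"
  by (induction I rule: infinite_finite_induct) (auto simp: poly_eval_add)

lemma poly_eval_single: "poly_eval (Poly_Mapping.single m c) x = c * mono_eval m x"
  by (simp add: poly_eval_def)

lemma poly_mapping_sum_single: "p = (\<Sum>m\<in>Poly_Mapping.keys p. Poly_Mapping.single m (Poly_Mapping.lookup p m))"
proof (rule poly_mapping_eqI)
  fix k
  have "Poly_Mapping.lookup (\<Sum>m\<in>Poly_Mapping.keys p. Poly_Mapping.single m (Poly_Mapping.lookup p m)) k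
     = (\<Sum>m\<in>Poly_Mapping.keys p. if m = k then Poly_Mapping.lookup p m else 0)"
    by (simp add: lookup_sum lookup_single when_def)
  also have "\<dots> = Poly_Mapping.lookup p k"
    by (simp add: in_keys_iff)
  finally show "Poly_Mapping.lookup p k
     = Poly_Mapping.lookup (\<Sum>m\<in>Poly_Mapping.keys p. Poly_Mapping.single m (Poly_Mapping.lookup p m)) k" ..
qed

lemma poly_eval_mult: "poly_eval (p * q) x = poly_eval p x * poly_eval q x"
proof -
  have "p * q = (\<Sum>m\<in>Poly_Mapping.keys p. \<Sum>m'\<in>Poly_Mapping.keys q.
      Poly_Mapping.single (m + m') (Poly_Mapping.lookup p m * Poly_Mapping.lookup q m'))"
    by (subst poly_mapping_sum_single[of p], subst poly_mapping_sum_single[of q])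
      (simp only: sum_product mult_single)
  then have "poly_eval (p * q) x = (\<Sum>m\<in>Poly_Mapping.keys p. \<Sum>m'\<in>Poly_Mapping.keys q.
      (Poly_Mapping.lookup p m * mono_eval m x) * (Poly_Mapping.lookup q m' * mono_eval m' x))"
    by (simp add: poly_eval_sum poly_eval_single mono_eval_add algebra_simps)
  then show ?thesis by (simp add: poly_eval_def sum_product)
qed

lemma poly_eval_Const: "poly_eval (Const c) x = c"
  by (simp add: Const_def poly_eval_single)

lemma poly_eval_one [simp]: "poly_eval 1 x = 1"
  using poly_eval_single[of 0 1 x] by simp

lemma poly_eval_Var: "poly_eval (Var i) x = of_bool (x (fst i) = snd i)"
  by (simp add: Var_def poly_eval_single mono_eval_def)

lemma poly_eval_power: "poly_eval (p ^ n) x = poly_eval p x ^ n"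
  by (induction n) (auto simp: poly_eval_mult)

lemma poly_eval_diff: "poly_eval (p - q) x = poly_eval p x - poly_eval q x"
  using poly_eval_add[of "p - q" q x] by simp

lemma poly_eval_prod: "poly_eval (\<Prod>i\<in>I. p i) x = (\<Prod>i\<in>I. poly_eval (p i) x)"
  by (induction I rule: infinite_finite_induct) (auto simp: poly_eval_mult)

lemma depends_mono_eval: "depends (mono_eval m) (fst ` Poly_Mapping.keys m)"
  unfolding depends_def mono_eval_def
  by (intro allI impI prod.cong) auto

lemma card_fst_keys_le: "card (fst ` Poly_Mapping.keys m) \<le> monomial_degree m"
proof -
  have "card (fst ` Poly_Mapping.keys m) \<le> (\<Sum>i\<in>Poly_Mapping.keys m. 1)"
    using card_image_le[of "Poly_Mapping.keys m" fst] by simp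
  also have "\<dots> \<le> monomial_degree m"
    unfolding monomial_degree_def by (intro sum_mono) (auto simp: in_keys_iff Suc_le_eq)
  finally show ?thesis .
qed

lemma poly_eval_label_constraint:
  assumes h: "h \<in> label_constraints V D" and D: "finite D" and x: "\<And>v. v \<in> V \<Longrightarrow> x v \<in> D"
  shows "poly_eval h x = 0"
proof -
  from h consider v where "v \<in> V" "h = (\<Sum>a\<in>D. Var (v, a) ^ 2) - 1"
    | v a b where "a \<noteq> b" "h = Var (v, a) * Var (v, b)"
    unfolding label_constraints_def by blast
  then show ?thesis
  proof cases
    case 1
    have "(\<Sum>a\<in>D. (of_bool (x v = a) ^ 2 :: real)) = (\<Sum>a\<in>D. if a = x v then 1 else 0)"
      by (intro sum.cong) auto
    then show ?thesis using x[OF 1(1)] D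
      by (simp add: 1 poly_eval_diff poly_eval_sum poly_eval_power poly_eval_Var)
  next
    case 2
    then show ?thesis by (auto simp: poly_eval_mult poly_eval_Var)
  qed
qed

context expanding_csp
begin

text \<open>Linearity and the label constraints hold under evaluation in every degree. Only
  positivity uses the degree: a monomial of degree at most \<open>r\<close> involves at most
  \<open>r\<close> variables.\<close>

lemma pseudo_distribution_pexpect:
  assumes A: "A \<subseteq> D" and D: "finite D" and d: "d div 2 = r"
  shows "pseudo_distribution V D d (\<lambda>q. pexpect (poly_eval q))"
  unfolding pseudo_distribution_def
proof (intro conjI ballI allI impI)
  fix p q :: "('v \<times> 'd) mpolynomial"
  show "pexpect (poly_eval (p + q)) = pexpect (poly_eval p) + pexpect (poly_eval q)"
    using pexpect_lin[of "poly_eval p" 1 "poly_eval q"] by (simp add: poly_eval_add[abs_def])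
next
  fix c and q :: "('v \<times> 'd) mpolynomial"
  show "pexpect (poly_eval (Const c * q)) = c * pexpect (poly_eval q)"
    using pexpect_lin[of "\<lambda>x. 0" c "poly_eval q"] pexpect_lin[of "\<lambda>x. 0" "-1" "\<lambda>x. 0"]
    by (simp add: poly_eval_mult[abs_def] poly_eval_Const)
next
  show "pexpect (poly_eval 1) = 1" using pexpect_one by (simp add: poly_eval_one[abs_def])
next
  fix q :: "('v \<times> 'd) mpolynomial"
  assume q: "q \<in> polys (V \<times> D)" and deg: "degree_le q (d div 2)"
  have "0 \<le> pexpect (\<lambda>x. (\<Sum>m\<in>Poly_Mapping.keys q. Poly_Mapping.lookup q m * mono_eval m x) ^ 2)"
  proof (rule pexpect_square_nonneg[where T = "\<lambda>m. fst ` Poly_Mapping.keys m"])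
    fix m assume m: "m \<in> Poly_Mapping.keys q"
    have "fst ` Poly_Mapping.keys m \<subseteq> V" using q m unfolding polys_def by fastforce
    moreover have "card (fst ` Poly_Mapping.keys m) \<le> r"
      using card_fst_keys_le[of m] deg m d unfolding degree_le_def by fastforce
    ultimately show "depends (\<lambda>x. Poly_Mapping.lookup q m * mono_eval m x) (fst ` Poly_Mapping.keys m) \<and>
        fst ` Poly_Mapping.keys m \<subseteq> V \<and> card (fst ` Poly_Mapping.keys m) \<le> r"
      by (intro conjI depends_mult depends_mono_eval depends_const) auto
  qed simp
  then show "0 \<le> pexpect (poly_eval (q ^ 2))"
    unfolding poly_eval_def[of q, symmetric] poly_eval_power[symmetric] .
next
  fix h q :: "('v \<times> 'd) mpolynomial"
  assume h: "h \<in> label_constraints V D"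
  have "pexpect (poly_eval (h * q)) = pexpect (\<lambda>x. 0)"
    using poly_eval_label_constraint[OF h D] A
    by (intro pexpect_cong) (auto simp: poly_eval_mult)
  also have "\<dots> = 0" using pexpect_lin[of "\<lambda>x. 0" "-1" "\<lambda>x. 0"] by simp
  finally show "pexpect (poly_eval (h * q)) = 0" .
qed

end

section \<open>Deviations of planted constraints\<close>

lemma prob_eqI:
  assumes "\<And>x. x \<in> set_pmf p \<Longrightarrow> x \<in> A \<longleftrightarrow> x \<in> B"
  shows "measure_pmf.prob p A = measure_pmf.prob p B"
proof -
  have "A \<inter> set_pmf p = B \<inter> set_pmf p" using assms by blast
  then show ?thesis using measure_Int_set_pmf by metis
qed

lemma sum_prod_of_bool:
  assumes R: "R \<subseteq> tuples k D" "finite R"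
  shows "(\<Sum>b\<in>R. \<Prod>i<k. of_bool (x (\<sigma> i) = b i)) = (of_bool (restrict (x \<circ> \<sigma>) {..<k} \<in> R) :: real)"
proof -
  let ?z = "restrict (x \<circ> \<sigma>) {..<k}"
  have "(\<Prod>i<k. of_bool (x (\<sigma> i) = b i)) = (if ?z = b then 1 else 0 :: real)" if "b \<in> R" for b
  proof (cases "?z = b")
    case True
    then show ?thesis by auto
  next
    case False
    moreover have "b \<in> extensional {..<k}" using that R by (auto simp: PiE_def)
    moreover have "?z = b" if "b \<in> extensional {..<k}" "\<forall>i<k. x (\<sigma> i) = b i"
      by (rule extensionalityI[of _ "{..<k}"]) (use that in auto)
    ultimately have "\<exists>i<k. x (\<sigma> i) \<noteq> b i" by blast
    then show ?thesis using False by (auto intro!: prod_zero)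
  qed
  then have "(\<Sum>b\<in>R. \<Prod>i<k. of_bool (x (\<sigma> i) = b i)) = (\<Sum>b\<in>R. if ?z = b then 1 else 0 :: real)"
    by (intro sum.cong) auto
  then show ?thesis using R by simp
qed

locale planted_constraint =
  fixes k t :: nat and \<nu> :: "'d pmf" and D :: "'d set" and \<mu> :: "(nat \<Rightarrow> 'd) pmf"
    and \<sigma> :: "nat \<Rightarrow> 'v" and e :: "'v set"
  assumes t: "1 \<le> t" "t \<le> k" and fin\<nu>: "finite (set_pmf \<nu>)"
    and \<sigma>: "bij_betw \<sigma> {..<k} e"
    and \<mu>: "set_pmf \<mu> \<subseteq> tuples k D" and indep: "twise_independent k t \<nu> \<mu>"
begin

sublocale weights "set_pmf \<nu>" "pmf \<nu>"
  by unfold_locales (use fin\<nu> in \<open>auto intro: sum_pmf_eq_1\<close>)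

definition local_tuple :: "('v \<Rightarrow> 'd) \<Rightarrow> nat \<Rightarrow> 'd" where
  "local_tuple x = restrict (x \<circ> \<sigma>) {..<k}"

text \<open>The value 0 off the support of \<open>\<nu>\<close> avoids division by zero, and it lets
  \<open>avgs Z deviation\<close> vanish also at assignments that leave the support outside
  \<open>Z\<close>.\<close>

definition deviation :: "('v \<Rightarrow> 'd) \<Rightarrow> real" where
  "deviation x = (if \<forall>v\<in>e. x v \<in> set_pmf \<nu> then pmf \<mu> (local_tuple x) / (\<Prod>v\<in>e. pmf \<nu> (x v)) - 1 else 0)"

lemma fine: "finite e" and carde: "card e = k"
  using \<sigma> bij_betw_finite bij_betw_same_card by fastforce+

lemma \<sigma>_in: "i < k \<Longrightarrow> \<sigma> i \<in> e"
  using \<sigma> by (auto simp: bij_betw_def)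

lemma depends_local_tuple: "depends (\<lambda>x. g (local_tuple x)) e"
  unfolding depends_def local_tuple_def
  by (intro allI impI arg_cong[of _ _ g] restrict_ext) (auto simp: \<sigma>_in)

lemma depends_deviation: "depends deviation e"
proof -
  have "deviation x = deviation y" if eq: "\<forall>v\<in>e. x v = y v" for x y
  proof -
    have "local_tuple x = local_tuple y" using eq by (auto simp: local_tuple_def \<sigma>_in intro!: restrict_ext)
    moreover have "(\<Prod>v\<in>e. pmf \<nu> (x v)) = (\<Prod>v\<in>e. pmf \<nu> (y v))" using eq by (intro prod.cong) auto
    moreover have "(\<forall>v\<in>e. x v \<in> set_pmf \<nu>) = (\<forall>v\<in>e. y v \<in> set_pmf \<nu>)" using eq by auto
    ultimately show ?thesis by (simp add: deviation_def)
  qed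
  then show ?thesis unfolding depends_def by blast
qed

lemma deviation_nonneg: "0 \<le> 1 + deviation x"
  by (auto simp: deviation_def intro!: divide_nonneg_nonneg prod_nonneg)

text \<open>Multiplying by the \<open>\<nu>\<close>-mass of the fixed coordinates replaces a
  conditional expectation by the \<open>g\<close>-weighted \<open>\<mu>\<close>-mass of a fibre.
  \<open>g = 1\<close> gives the marginals, the indicator of \<open>R\<close> the value of the
  constraint.\<close>

lemma avgs_deviation:
  assumes Z: "Z \<subseteq> e" and x: "\<And>v. v \<in> e \<Longrightarrow> x v \<in> set_pmf \<nu>"
  shows "avgs Z (\<lambda>x. (1 + deviation x) * g (local_tuple x)) x * (\<Prod>v\<in>e - Z. pmf \<nu> (x v))
    = (\<Sum>z\<in>{z \<in> tuples k (set_pmf \<nu>). \<forall>i<k. \<sigma> i \<notin> Z \<longrightarrow> z i = x (\<sigma> i)}. pmf \<mu> z * g z)"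
proof -
  define x' where "x' y = override_on x y Z" for y
  define inv where "inv = the_inv_into {..<k} \<sigma>"
  have inj: "inj_on \<sigma> {..<k}" using \<sigma> by (simp add: bij_betw_def)
  have inv1: "inv (\<sigma> i) = i" if "i < k" for i
    unfolding inv_def using that inj by (intro the_inv_into_f_f) auto
  have inv2: "\<sigma> (inv v) = v" "inv v < k" if "v \<in> e" for v
    using that \<sigma> f_the_inv_into_f_bij_betw[OF \<sigma>] the_inv_into_into[OF inj _ subset_refl, of v]
    by (auto simp: inv_def bij_betw_def)
  have "avgs Z (\<lambda>x. (1 + deviation x) * g (local_tuple x)) x * (\<Prod>v\<in>e - Z. pmf \<nu> (x v))
    = (\<Sum>y\<in>PiE Z (\<lambda>_. set_pmf \<nu>). pmf \<mu> (local_tuple (x' y)) * g (local_tuple (x' y)))"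
    unfolding avgs_def sum_distrib_right
  proof (intro sum.cong refl)
    fix y assume y: "y \<in> PiE Z (\<lambda>_. set_pmf \<nu>)"
    have x'A: "x' y v \<in> set_pmf \<nu>" if "v \<in> e" for v
      using y x[OF that] by (auto simp: x'_def override_on_def)
    have "(\<Prod>v\<in>e. pmf \<nu> (x' y v)) = (\<Prod>v\<in>e - Z. pmf \<nu> (x' y v)) * (\<Prod>v\<in>Z. pmf \<nu> (x' y v))"
      using Z fine by (rule prod.subset_diff)
    also have "(\<Prod>v\<in>e - Z. pmf \<nu> (x' y v)) = (\<Prod>v\<in>e - Z. pmf \<nu> (x v))"
      by (intro prod.cong) (auto simp: x'_def)
    also have "(\<Prod>v\<in>Z. pmf \<nu> (x' y v)) = (\<Prod>v\<in>Z. pmf \<nu> (y v))"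
      by (intro prod.cong) (auto simp: x'_def)
    finally have pr: "(\<Prod>v\<in>e. pmf \<nu> (x' y v)) = (\<Prod>v\<in>e - Z. pmf \<nu> (x v)) * (\<Prod>v\<in>Z. pmf \<nu> (y v))" .
    have "(\<Prod>v\<in>e. pmf \<nu> (x' y v)) \<noteq> 0"
      using x'A fine by (simp add: set_pmf_iff)
    then have "(1 + deviation (x' y)) * ((\<Prod>v\<in>e - Z. pmf \<nu> (x v)) * (\<Prod>v\<in>Z. pmf \<nu> (y v))) = pmf \<mu> (local_tuple (x' y))"
      using x'A unfolding pr[symmetric] deviation_def by simp
    from arg_cong[OF this, of "\<lambda>r. r * g (local_tuple (x' y))"]
    show "(\<Prod>v\<in>Z. pmf \<nu> (y v)) * ((1 + deviation (override_on x y Z)) * g (local_tuple (override_on x y Z))) *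
        (\<Prod>v\<in>e - Z. pmf \<nu> (x v)) = pmf \<mu> (local_tuple (x' y)) * g (local_tuple (x' y))"
      unfolding x'_def[symmetric] by (simp only: mult_ac)
  qed
  also have "\<dots> = (\<Sum>z\<in>{z \<in> tuples k (set_pmf \<nu>). \<forall>i<k. \<sigma> i \<notin> Z \<longrightarrow> z i = x (\<sigma> i)}. pmf \<mu> z * g z)"
  proof (rule sum.reindex_bij_witness[where i = "\<lambda>z. restrict (z \<circ> inv) Z" and j = "\<lambda>y. local_tuple (x' y)"])
    fix y assume y: "y \<in> PiE Z (\<lambda>_. set_pmf \<nu>)"
    show "restrict (local_tuple (x' y) \<circ> inv) Z = y"
    proof (rule PiE_ext[OF _ y])
      show "restrict (local_tuple (x' y) \<circ> inv) Z v = y v" if "v \<in> Z" for v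
        using that Z inv2[of v] by (auto simp: local_tuple_def x'_def)
      show "restrict (local_tuple (x' y) \<circ> inv) Z \<in> PiE Z (\<lambda>_. set_pmf \<nu>)"
        using y Z inv2 by (auto simp: local_tuple_def x'_def subset_iff)
    qed
    show "local_tuple (x' y) \<in> {z \<in> tuples k (set_pmf \<nu>). \<forall>i<k. \<sigma> i \<notin> Z \<longrightarrow> z i = x (\<sigma> i)}"
      using y x \<sigma>_in by (auto simp: local_tuple_def x'_def override_on_def)
  next
    fix z assume z: "z \<in> {z \<in> tuples k (set_pmf \<nu>). \<forall>i<k. \<sigma> i \<notin> Z \<longrightarrow> z i = x (\<sigma> i)}"
    show "local_tuple (x' (restrict (z \<circ> inv) Z)) = z"
    proof
      fix i show "local_tuple (x' (restrict (z \<circ> inv) Z)) i = z i"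
        using z inv1[of i] by (auto simp: local_tuple_def x'_def override_on_def restrict_def PiE_def extensional_def)
    qed
    show "restrict (z \<circ> inv) Z \<in> PiE Z (\<lambda>_. set_pmf \<nu>)"
      using z inv2 Z by (auto simp: PiE_iff)
  qed auto
  finally show ?thesis .
qed

text \<open>Ensures that the density with respect to \<open>\<nu>\<close> misses no mass of
  \<open>\<mu>\<close>. Every coordinate lies in a set of size \<open>t \<ge> 1\<close>, and the
  marginal there is a power of \<open>\<nu>\<close>.\<close>

lemma support: "set_pmf \<mu> \<subseteq> tuples k (set_pmf \<nu>)"
proof
  fix z assume z: "z \<in> set_pmf \<mu>"
  have "z i \<in> set_pmf \<nu>" if i: "i < k" for i
  proof -
    obtain T' where T': "T' \<subseteq> {..<k} - {i}" "card T' = t - 1"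
    proof -
      have "t - 1 \<le> card ({..<k} - {i})" using t i by simp
      then show thesis using that obtain_subset_with_card_n by metis
    qed
    define T where "T = insert i T'"
    have T: "T \<subseteq> {..<k}" "card T = t"
      using T' t i by (auto simp: T_def card_insert_if finite_subset)
    have "finite T" using T by (auto intro: finite_subset)
    have "restrict z T \<in> set_pmf (Pi_pmf T undefined (\<lambda>_. \<nu>))"
      using indep T z unfolding twise_independent_def by (metis imageI set_map_pmf)
    then have "restrict z T i \<in> set_pmf \<nu>"
      using \<open>finite T\<close> by (auto simp: set_Pi_pmf PiE_dflt_def T_def split: if_splits)
    then show ?thesis by (simp add: T_def)
  qed
  then show "z \<in> tuples k (set_pmf \<nu>)"
    using z \<mu> by (auto simp: PiE_iff)
qed

lemma avgs_deviation_zero: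
  assumes Z: "Z \<subseteq> e" "card (e - Z) \<le> t"
  shows "avgs Z deviation = (\<lambda>x. 0)"
proof -
  have main: "avgs Z deviation x = 0" if Z: "Z \<subseteq> e" "card (e - Z) = t" for Z x
  proof (cases "\<forall>v\<in>e - Z. x v \<in> set_pmf \<nu>")
    case False
    then obtain v where v: "v \<in> e" "v \<notin> Z" "x v \<notin> set_pmf \<nu>" by blast
    then have "deviation (override_on x y Z) = 0" for y by (auto simp: deviation_def override_on_def)
    then show ?thesis by (simp add: avgs_def)
  next
    case x: True
    have finZ: "finite Z" using Z(1) fine by (rule finite_subset)
    obtain a where a: "a \<in> set_pmf \<nu>" using set_pmf_not_empty[of \<nu>] by blast
    \<comment> \<open>\<open>avgs Z\<close> does not see the values on \<open>Z\<close>, so they may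
      be moved into the support, as \<open>avgs_deviation\<close> requires.\<close>
    define x1 where "x1 = override_on x (\<lambda>_. a) Z"
    have x1: "x1 v \<in> set_pmf \<nu>" if "v \<in> e" for v
      using that x a by (auto simp: x1_def override_on_def)
    have "avgs Z deviation x = avgs Z deviation x1"
      using avgs_depends[OF finZ depends_deviation] by (auto simp: depends_def x1_def override_on_def)
    define T where "T = {i. i < k \<and> \<sigma> i \<notin> Z}"
    have bij: "bij_betw \<sigma> T (e - Z)"
      using \<sigma> unfolding bij_betw_def T_def by (auto intro: inj_on_subset)
    have T: "T \<subseteq> {..<k}" "card T = t" "finite T"
      using bij_betw_same_card[OF bij] Z by (auto simp: T_def)
    let ?S = "{z \<in> tuples k (set_pmf \<nu>). \<forall>i<k. \<sigma> i \<notin> Z \<longrightarrow> z i = x1 (\<sigma> i)}"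
    have finS: "finite ?S" using fin\<nu> by (auto intro!: finite_subset[of ?S "tuples k (set_pmf \<nu>)"] finite_PiE)
    have "(\<Sum>z\<in>?S. pmf \<mu> z * 1) = measure_pmf.prob \<mu> ?S"
      using finS by (simp add: measure_measure_pmf_finite)
    also have "\<dots> = measure_pmf.prob \<mu> ((\<lambda>z. restrict z T) -` {restrict (x1 \<circ> \<sigma>) T})"
    proof (rule prob_eqI)
      have "(\<forall>i<k. \<sigma> i \<notin> Z \<longrightarrow> z i = x1 (\<sigma> i)) \<longleftrightarrow> restrict z T = restrict (x1 \<circ> \<sigma>) T" for z
        unfolding T_def by (auto simp: fun_eq_iff restrict_def)
      then show "z \<in> ?S \<longleftrightarrow> z \<in> (\<lambda>z. restrict z T) -` {restrict (x1 \<circ> \<sigma>) T}" if "z \<in> set_pmf \<mu>" for z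
        unfolding mem_Collect_eq vimage_singleton_eq using that support by blast
    qed
    also have "\<dots> = pmf (map_pmf (\<lambda>z. restrict z T) \<mu>) (restrict (x1 \<circ> \<sigma>) T)"
      by (simp add: pmf_map)
    also have "map_pmf (\<lambda>z. restrict z T) \<mu> = Pi_pmf T undefined (\<lambda>_. \<nu>)"
      using indep T unfolding twise_independent_def by blast
    also have "pmf \<dots> (restrict (x1 \<circ> \<sigma>) T) = (\<Prod>i\<in>T. pmf \<nu> (x1 (\<sigma> i)))"
      using T by (subst pmf_Pi') auto
    also have "\<dots> = (\<Prod>v\<in>e - Z. pmf \<nu> (x1 v))"
      by (rule prod.reindex_bij_betw[OF bij, of "\<lambda>v. pmf \<nu> (x1 v)"])
    finally have "avgs Z (\<lambda>x. (1 + deviation x) * 1) x1 * (\<Prod>v\<in>e - Z. pmf \<nu> (x1 v)) = (\<Prod>v\<in>e - Z. pmf \<nu> (x1 v))"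
      using avgs_deviation[OF Z(1) x1, where g = "\<lambda>_. 1"] by simp
    moreover have "(\<Prod>v\<in>e - Z. pmf \<nu> (x1 v)) \<noteq> 0"
      using x1 fine by (simp add: set_pmf_iff)
    ultimately have "avgs Z (\<lambda>x. (1 + deviation x) * 1) x1 = 1" by simp
    then have "avgs Z deviation x1 = 0" using avgs_add[of Z "\<lambda>_. 1" deviation x1] avgs_const[OF finZ, of 1] by simp
    then show ?thesis using \<open>avgs Z deviation x = avgs Z deviation x1\<close> by simp
  qed
  have finZ: "finite Z" using Z(1) fine by (rule finite_subset)
  have "card e = card (e - Z) + card Z"
    using Z fine finZ by (simp add: card_Diff_subset card_mono)
  then have "k - t \<le> card Z" using Z carde by simp
  \<comment> \<open>A subset \<open>Z0\<close> leaving exactly \<open>t\<close> coordinates already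
    averages to zero; averaging further keeps zero.\<close>
  then obtain Z0 where Z0: "Z0 \<subseteq> Z" "card Z0 = k - t"
    by (rule obtain_subset_with_card_n)
  have finZ0: "finite Z0" using Z0(1) finZ by (rule finite_subset)
  have "card (e - Z0) = t"
    using Z0 Z fine finZ0 carde t by (simp add: card_Diff_subset)
  then have 0: "avgs Z0 deviation = (\<lambda>x. 0)" using main[of Z0] Z0 Z by auto
  have "avgs Z deviation = avgs ((Z - Z0) \<union> Z0) deviation" using Z0 by (simp add: Un_absorb2)
  also have "\<dots> = avgs (Z - Z0) (avgs Z0 deviation)" using finZ finZ0 by (intro avgs_Un) auto
  also have "\<dots> = (\<lambda>x. 0)" using finZ by (simp add: 0 avgs_const)
  finally show ?thesis .
qed

lemma avgs_deviation_value:
  assumes V: "finite V" "e \<subseteq> V" and R: "R \<subseteq> tuples k D" "finite R"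
  shows "avgs V (\<lambda>x. (1 + deviation x) * (\<Sum>b\<in>R. \<Prod>i<k. of_bool (x (\<sigma> i) = b i))) x = measure_pmf.prob \<mu> R"
proof -
  define g :: "(nat \<Rightarrow> 'd) \<Rightarrow> real" where "g z = of_bool (z \<in> R)" for z
  have g: "(\<Sum>b\<in>R. \<Prod>i<k. of_bool (x (\<sigma> i) = b i)) = g (local_tuple x)" for x
    unfolding g_def local_tuple_def by (rule sum_prod_of_bool[OF R])
  obtain a where a: "a \<in> set_pmf \<nu>" using set_pmf_not_empty[of \<nu>] by blast
  let ?F = "\<lambda>x. (1 + deviation x) * g (local_tuple x)"
  have "depends (\<lambda>x. 1 - (0 - deviation x)) e" by (intro depends_diff depends_const depends_deviation)
  then have dF: "depends ?F e" by (intro depends_mult depends_local_tuple) simp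
  have d0: "depends (avgs e ?F) {}" using avgs_depends[OF fine dF] by simp
  have "avgs V ?F x = avgs V (avgs e ?F) x" using avgs_absorbs[OF V] by metis
  also have "avgs e ?F = (\<lambda>_. avgs e ?F (\<lambda>_. a))" using d0 unfolding depends_def by auto
  also have "avgs V \<dots> x = avgs e ?F (\<lambda>_. a)" using V by (simp add: avgs_const)
  also have "\<dots> = (\<Sum>z\<in>{z \<in> tuples k (set_pmf \<nu>). \<forall>i<k. \<sigma> i \<notin> e \<longrightarrow> z i = a}. pmf \<mu> z * g z)"
    using avgs_deviation[of e "\<lambda>_. a" g] a by simp
  also have "{z \<in> tuples k (set_pmf \<nu>). \<forall>i<k. \<sigma> i \<notin> e \<longrightarrow> z i = a} = tuples k (set_pmf \<nu>)"
    using \<sigma>_in by auto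
  also have "(\<Sum>z\<in>tuples k (set_pmf \<nu>). pmf \<mu> z * g z) = (\<Sum>z\<in>tuples k (set_pmf \<nu>) \<inter> R. pmf \<mu> z)"
  proof -
    have "finite (tuples k (set_pmf \<nu>))" using fin\<nu> by (intro finite_PiE) auto
    from sum.inter_restrict[OF this, of "pmf \<mu>" R] show ?thesis
      unfolding g_def by (simp add: if_distrib[of "(*) _"] of_bool_def cong: if_cong)
  qed
  also have "\<dots> = measure_pmf.prob \<mu> (tuples k (set_pmf \<nu>) \<inter> R)"
    using R by (simp add: measure_measure_pmf_finite)
  also have "\<dots> = measure_pmf.prob \<mu> R"
    by (rule prob_eqI) (use support in blast)
  finally show ?thesis unfolding g .
qed

end

section \<open>From a selected hypergraph to a pseudo-distribution\<close>

definition instance_of :: "'v set set \<Rightarrow> ('v set \<Rightarrow> ('v, 'd) constraint option) \<Rightarrow> ('v, 'd) constraint multiset" where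
  "instance_of E f = (\<Sum>e\<in>E. case f e of None \<Rightarrow> {#} | Some c \<Rightarrow> {#c#})"

definition selected :: "'v set set \<Rightarrow> ('v set \<Rightarrow> ('v, 'd) constraint option) \<Rightarrow> 'v set set" where
  "selected E f = {e\<in>E. f e \<noteq> None}"

lemma sum_mset_instance_of:
  assumes "finite E"
  shows "(\<Sum>c\<in>#instance_of E f. h c) = (\<Sum>e\<in>selected E f. h (the (f e)))"
proof -
  have "(\<Sum>c\<in>#instance_of E f. h c) = (\<Sum>e\<in>E. case f e of None \<Rightarrow> 0 | Some c \<Rightarrow> h c)"
    using assms unfolding instance_of_def by induction (auto split: option.splits)
  also have "\<dots> = (\<Sum>e\<in>selected E f. h (the (f e)))"
    using assms by (intro sum.mono_neutral_cong_right) (auto simp: selected_def split: option.splits)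
  finally show ?thesis .
qed

lemma size_instance_of:
  fixes f :: "'v set \<Rightarrow> ('v, 'd) constraint option"
  assumes "finite E"
  shows "size (instance_of E f) = card (selected E f)"
proof -
  have "size M = (\<Sum>c\<in>#M. 1)" for M :: "('v, 'd) constraint multiset" by (induction M) auto
  then show ?thesis using sum_mset_instance_of[OF assms, where h = "\<lambda>_. 1 :: nat" and f = f] by simp
qed

text \<open>The only edges whose planted marginal may disagree with the pseudo-expectation.\<close>

definition dense_edges :: "nat \<Rightarrow> nat \<Rightarrow> real \<Rightarrow> nat \<Rightarrow> 'v set set \<Rightarrow> 'v set set" where
  "dense_edges k t \<zeta> N S = {e\<in>S. \<exists>X. X \<subseteq> S \<and> e \<in> X \<and> 2 \<le> card X \<and> \<zeta> * real (card X) \<le> real t \<and> card X \<le> 2 * N \<and>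
     2 * card (\<Union>X) \<le> 2 * real k * card X - (real t + 1) * card X + t}"

text \<open>The deterministic half. An edge that is not dense contributes exactly its planted
  probability. A dense one errs by at most one, because a 0/1 predicate and its complement are
  squares, so its pseudo-expectation lies in \<open>[0, 1]\<close>; these squares involve
  \<open>k\<close> variables, hence \<open>k \<le> r\<close>.\<close>

lemma sos_solution:
  fixes f :: "'v set \<Rightarrow> ('v, 'd) constraint option" and \<mu> :: "'d relation \<Rightarrow> (nat \<Rightarrow> 'd) pmf"
  assumes csp: "is_csp k D \<R>" and t: "1 \<le> t" "t \<le> k" and \<nu>: "set_pmf \<nu> \<subseteq> D"
    and \<mu>: "\<And>R. R \<in> \<R> \<Longrightarrow> set_pmf (\<mu> R) \<subseteq> tuples k D \<and> twise_independent k t \<nu> (\<mu> R)"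
    and V: "finite V" and E: "\<And>e. e \<in> E \<Longrightarrow> e \<subseteq> V \<and> card e = k"
    and f: "\<And>e \<sigma> R. e \<in> E \<Longrightarrow> f e = Some (\<sigma>, R) \<Longrightarrow> bij_betw \<sigma> {..<k} e \<and> R \<in> \<R>"
    and par: "0 < \<zeta>" "1 \<le> N" "3 * real r \<le> \<zeta> * N" "k \<le> r"
    and expansion: "\<And>X. X \<subseteq> selected E f \<Longrightarrow> X \<noteq> {} \<Longrightarrow> card X \<le> 2 * N \<Longrightarrow>
      (2 * real k - real t - 1 + \<zeta>) * card X \<le> 2 * card (\<Union>X)"
  shows "\<exists>\<Lambda>. pseudo_distribution V D (2 * r) \<Lambda> \<and>
    \<bar>\<Lambda> (val_poly k (instance_of E f)) -
      (\<Sum>e\<in>selected E f. measure_pmf.prob (\<mu> (snd (the (f e)))) (snd (the (f e)))) / card (selected E f)\<bar>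
    \<le> card (dense_edges k t \<zeta> N (selected E f)) / card (selected E f)"
proof -
  let ?S = "selected E f"
  define \<sigma> where "\<sigma> e = fst (the (f e))" for e
  define R where "R e = snd (the (f e))" for e
  define u where "u e = planted_constraint.deviation k \<nu> (\<mu> (R e)) (\<sigma> e) e" for e
  have D: "finite D" and RD: "\<And>R. R \<in> \<R> \<Longrightarrow> R \<subseteq> tuples k D" using csp by (auto simp: is_csp_def)
  have finR: "finite R" if "R \<in> \<R>" for R
    using RD[OF that] D by (meson finite_PiE finite_lessThan finite_subset)
  have fin\<nu>: "finite (set_pmf \<nu>)" using \<nu> D by (rule finite_subset)
  have S: "e \<in> E" "f e = Some (\<sigma> e, R e)" if "e \<in> ?S" for e
    using that by (auto simp: selected_def \<sigma>_def R_def)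
  have RS: "R e \<in> \<R>" "bij_betw (\<sigma> e) {..<k} e" if "e \<in> ?S" for e
    using f[OF S[OF that]] by auto
  have finE: "finite E" using E V by (intro finite_subset[of E "Pow V"]) auto
  have pc: "planted_constraint k t \<nu> D (\<mu> (R e)) (\<sigma> e) e" if "e \<in> ?S" for e
    by unfold_locales (use t fin\<nu> RS[OF that] \<mu> in auto)
  interpret weights "set_pmf \<nu>" "pmf \<nu>"
    by unfold_locales (use fin\<nu> in \<open>auto intro: sum_pmf_eq_1\<close>)
  interpret expanding_csp "set_pmf \<nu>" "pmf \<nu>" V ?S k t u N "\<lambda>_. undefined" \<zeta> r
  proof unfold_locales
    fix e assume e: "e \<in> ?S"
    show "e \<subseteq> V \<and> card e = k" using E S[OF e] by blast
    show "depends (u e) e" unfolding u_def by (rule planted_constraint.depends_deviation[OF pc[OF e]])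
    show "0 \<le> 1 + u e x" for x unfolding u_def by (rule planted_constraint.deviation_nonneg[OF pc[OF e]])
    show "avgs Z (u e) = (\<lambda>x. 0)" if "Z \<subseteq> e" "card (e - Z) \<le> t" for Z
      unfolding u_def using planted_constraint.avgs_deviation_zero[OF pc[OF e] that] .
  qed (use V par expansion in auto)
  define P where "P e x = (\<Sum>b\<in>R e. \<Prod>i<k. of_bool (x (\<sigma> e i) = b i) :: real)" for e and x :: "'v \<Rightarrow> 'd"
  have P: "P e x = of_bool (restrict (x \<circ> \<sigma> e) {..<k} \<in> R e)" if "e \<in> ?S" for e x
    unfolding P_def using RS(1)[OF that] RD finR by (intro sum_prod_of_bool) auto
  have eval: "poly_eval (val_poly k (instance_of E f)) x = (\<Sum>e\<in>?S. 1 / card ?S * P e x)" for x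
    unfolding val_poly_def poly_eval_mult poly_eval_Const size_instance_of[OF finE]
      sum_mset_instance_of[OF finE] poly_eval_sum
    unfolding sum_distrib_left
    by (intro sum.cong refl)
      (simp add: poly_eval_sum poly_eval_prod poly_eval_Var P_def R_def \<sigma>_def case_prod_beta)
  have pexpect_lincomb: "pexpect (\<lambda>x. \<Sum>e\<in>X. c * F e x) = (\<Sum>e\<in>X. c * pexpect (F e))" if "finite X" for X c F
    using that
  proof (induction X)
    case empty
    then show ?case using pexpect_lin[of "\<lambda>x. 0" "-1" "\<lambda>x. 0"] by simp
  next
    case (insert e X)
    then show ?case using pexpect_lin[of "\<lambda>x. \<Sum>e\<in>X. c * F e x" c "F e"] by (simp add: add.commute)
  qed
  have finS: "finite ?S" using finE by (simp add: selected_def)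
  have val: "pexpect (poly_eval (val_poly k (instance_of E f))) = (\<Sum>e\<in>?S. 1 / card ?S * pexpect (P e))"
    unfolding eval by (rule pexpect_lincomb[OF finS])
  define g where "g e = measure_pmf.prob (\<mu> (R e)) (R e)" for e
  have depP: "depends (P e) e" if e: "e \<in> ?S" for e
    unfolding depends_def
  proof (intro allI impI)
    fix x y :: "'v \<Rightarrow> 'd"
    assume "\<forall>v\<in>e. x v = y v"
    moreover have "\<sigma> e i \<in> e" if "i < k" for i using RS(2)[OF e] that by (auto simp: bij_betw_def)
    ultimately show "P e x = P e y" unfolding P_def by (intro sum.cong prod.cong) auto
  qed
  have sq: "0 \<le> pexpect (\<lambda>x. (F x) ^ 2)" if "depends F e" "e \<in> ?S" for F e
    using pexpect_square_nonneg[of "{()}" "\<lambda>_. F" "\<lambda>_. e"] that E[of e] S[of e] par by simp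
  have bounds: "0 \<le> pexpect (P e) \<and> pexpect (P e) \<le> 1" if e: "e \<in> ?S" for e
  proof
    have "P e x = (P e x) ^ 2" for x by (simp add: P[OF e])
    then show "0 \<le> pexpect (P e)" using sq[OF depP[OF e] e] by simp
    have "0 \<le> pexpect (\<lambda>x. (1 - P e x) ^ 2)" using e by (intro sq[of _ e] depends_diff depends_const depP)
    also have "(\<lambda>x. (1 - P e x) ^ 2) = (\<lambda>x. 1 + (-1) * P e x)" by (simp add: P[OF e] fun_eq_iff)
    finally show "pexpect (P e) \<le> 1" unfolding pexpect_lin pexpect_one by simp
  qed
  have good: "pexpect (P e) = g e" if e: "e \<in> ?S" and ne: "e \<notin> dense_edges k t \<zeta> N ?S" for e
  proof -
    have "sparse_at e" unfolding sparse_at_def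
    proof (intro allI impI, rule ccontr)
      fix X assume X: "X \<subseteq> ?S \<and> e \<in> X \<and> 2 \<le> card X \<and> \<zeta> * card X \<le> t \<and> card X \<le> 2 * N"
        and "\<not> 2 * real k * card X - (real t + 1) * card X + t < 2 * card (\<Union>X)"
      then have "e \<in> dense_edges k t \<zeta> N ?S"
        unfolding dense_edges_def using e by (intro CollectI conjI exI[of _ X]) auto
      then show False using ne by simp
    qed
    then have "pexpect (P e) = expect (\<lambda>x. (1 + u e x) * P e x)" by (rule pexpect_single[OF e _ depP[OF e]])
    also have "\<dots> = g e"
      unfolding expect_def u_def P_def g_def
      by (rule planted_constraint.avgs_deviation_value[OF pc[OF e] V])
        (use E S(1)[OF e] RD finR RS[OF e] in auto)
    finally show ?thesis .
  qed
  let ?B = "dense_edges k t \<zeta> N ?S"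
  have B: "?B \<subseteq> ?S" by (auto simp: dense_edges_def)
  have "\<bar>(\<Sum>e\<in>?S. pexpect (P e) - g e)\<bar> \<le> (\<Sum>e\<in>?S. \<bar>pexpect (P e) - g e\<bar>)" by (rule sum_abs)
  also have "\<dots> = (\<Sum>e\<in>?B. \<bar>pexpect (P e) - g e\<bar>)"
    using finS B good by (intro sum.mono_neutral_right) auto
  also have "\<dots> \<le> (\<Sum>e\<in>?B. 1)"
  proof (intro sum_mono)
    fix e assume "e \<in> ?B"
    then have "0 \<le> pexpect (P e) \<and> pexpect (P e) \<le> 1" using bounds B by blast
    moreover have "0 \<le> g e \<and> g e \<le> 1" by (simp add: g_def)
    ultimately show "\<bar>pexpect (P e) - g e\<bar> \<le> 1" by linarith
  qed
  finally have "\<bar>(\<Sum>e\<in>?S. pexpect (P e) - g e)\<bar> \<le> card ?B" by simp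
  then have "\<bar>(\<Sum>e\<in>?S. pexpect (P e) - g e)\<bar> / card ?S \<le> card ?B / card ?S"
    by (rule divide_right_mono) simp
  moreover have "pexpect (poly_eval (val_poly k (instance_of E f))) - (\<Sum>e\<in>?S. g e) / card ?S
      = (\<Sum>e\<in>?S. pexpect (P e) - g e) / card ?S"
    unfolding val by (simp add: sum_subtractf diff_divide_distrib sum_divide_distrib)
  ultimately have "\<bar>pexpect (poly_eval (val_poly k (instance_of E f))) - (\<Sum>e\<in>?S. g e) / card ?S\<bar> \<le> card ?B / card ?S"
    by simp
  moreover have "pseudo_distribution V D (2 * r) (\<lambda>q. pexpect (poly_eval q))"
    by (rule pseudo_distribution_pexpect[OF \<nu> D]) simp
  ultimately show ?thesis unfolding g_def R_def by blast
qed

section \<open>Counting dense subhypergraphs\<close>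

text \<open>One term of the exponential series at \<open>m\<close> is at most the whole sum.\<close>

lemma fact_ge_power: "(real m / exp 1) ^ m \<le> fact m"
proof -
  have "(\<Sum>i\<in>{m}. real m ^ i /\<^sub>R fact i) \<le> suminf (\<lambda>i. real m ^ i /\<^sub>R fact i)"
    using summable_exp_generic[of "real m"] by (intro sum_le_suminf) auto
  then have "real m ^ m / fact m \<le> exp (real m)"
    by (simp add: exp_def divide_inverse mult.commute)
  also have "exp (real m) = exp 1 ^ m" by (simp add: exp_of_nat_mult[symmetric])
  finally show ?thesis by (simp add: power_divide field_simps)
qed

lemma binomial_le_exp:
  assumes "1 \<le> j"
  shows "real (m choose j) \<le> (exp 1 * real m / j) ^ j"
proof -
  have "real (m choose j) * fact j \<le> real m ^ j"
  proof (cases "j \<le> m")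
    case True
    have "(fact m :: nat) = (fact j * (m choose j)) * fact (m - j)"
      using binomial_fact_lemma[OF True] by (simp add: mult_ac)
    then have "(fact m :: nat) div fact (m - j) = fact j * (m choose j)" by simp
    then have "fact j * (m choose j) \<le> m ^ j" using fact_div_fact_le_pow[OF True] by simp
    then have "real (fact j * (m choose j)) \<le> real (m ^ j)" by (rule of_nat_mono)
    then show ?thesis by (simp add: mult.commute)
  qed (simp add: binomial_eq_0)
  moreover have "real (m choose j) * (real j / exp 1) ^ j \<le> real (m choose j) * fact j"
    by (intro mult_left_mono fact_ge_power) simp
  ultimately have "real (m choose j) * (real j / exp 1) ^ j \<le> real m ^ j" by linarith
  then show ?thesis using assms by (simp add: power_divide power_mult_distrib field_simps)
qed

lemma binomial_ratio_le:
  assumes "v \<le> n"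
  shows "real (v choose k) * real n ^ k \<le> real (n choose k) * real v ^ k"
proof (induction k)
  case (Suc k)
  have absorb: "real (m choose Suc k) * (k + 1) = real (m choose k) * (real m - k)" if "k \<le> m" for m
  proof -
    have "Suc k * (m choose Suc k) = (m - k) * (m choose k)"
      by (metis binomial_absorb_comp mult.commute binomial_absorption Suc_times_binomial_eq add.commute)
    then have "real (Suc k * (m choose Suc k)) = real ((m - k) * (m choose k))" by simp
    then show ?thesis using that by (simp add: of_nat_diff algebra_simps)
  qed
  show ?case
  proof (cases "k \<le> v")
    case True
    have "(real (v choose Suc k) * real n ^ Suc k) * (k + 1) = (real (v choose Suc k) * (k + 1)) * real n ^ Suc k"
      by (simp only: mult_ac)
    also have "\<dots> = (real (v choose k) * real n ^ k) * ((real v - k) * n)"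
      unfolding absorb[OF True] by (simp only: power_Suc mult_ac)
    also have "\<dots> \<le> (real (n choose k) * real v ^ k) * ((real n - k) * v)"
    proof (rule mult_mono[OF Suc.IH])
      show "(real v - real k) * real n \<le> (real n - real k) * real v"
        using assms by (simp add: algebra_simps mult_left_mono)
    qed (use True assms in auto)
    also have "\<dots> = (real (n choose k) * (real n - k)) * real v ^ Suc k"
      by (simp only: power_Suc mult_ac)
    also have "\<dots> = (real (n choose Suc k) * real v ^ Suc k) * (k + 1)"
      unfolding absorb[OF order_trans[OF True assms], symmetric] by (simp only: mult_ac)
    finally show ?thesis by (simp add: mult_le_cancel_right)
  qed (simp add: binomial_eq_0)
qed simp

text \<open>Collects the constants per edge in \<open>term_bound\<close>: \<open>exp 1\<close> for
  each of at most \<open>k\<close> vertices and for the choice of the edge, and powers of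
  \<open>k\<close> from replacing \<open>v\<close> by \<open>k * j\<close>.\<close>

definition growth :: "nat \<Rightarrow> real" where
  "growth k = exp (real k + 1) * real k ^ (k + 1)"

lemma growth_ge: "1 \<le> k \<Longrightarrow> real k \<le> growth k" "1 \<le> k \<Longrightarrow> 1 \<le> growth k"
proof -
  assume k: "1 \<le> k"
  have "real k * 1 \<le> real k * real k ^ k" using k by (intro mult_left_mono one_le_power) auto
  then have "1 * real k \<le> exp (real k + 1) * real k ^ (k + 1)"
    using k by (intro mult_mono) auto
  then show "real k \<le> growth k" by (simp add: growth_def)
  then show "1 \<le> growth k" using k by linarith
qed

text \<open>A first moment for \<open>j\<close> edges inside \<open>v\<close> vertices: the factor
  \<open>(n / v) ^ v\<close> for the vertices cancels \<open>v\<close> of the \<open>k * j\<close>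
  factors \<open>v / n\<close> coming from the edges. Any real lower bound \<open>s\<close> for the
  remaining exponent will do, so the rounding in \<open>v\<close> never reaches the
  estimates.\<close>

lemma term_bound:
  fixes \<Delta> s p :: real
  assumes k: "1 \<le> k" "k \<le> n" and j: "1 \<le> j" "k * j \<le> n" and v: "v \<le> k * j"
    and s: "0 \<le> s" "s \<le> real k * j - v" "s \<le> (real k + 1) * j" and \<Delta>: "0 \<le> \<Delta>"
    and p: "p = \<Delta> * n / real (n choose k)"
  shows "real (n choose v) * real ((v choose k) choose j) * p ^ j
    \<le> growth k ^ j * (real j / n) powr s * (\<Delta> * n / j) ^ j"
proof (cases "v = 0")
  case True
  then show ?thesis using k j \<Delta> by (simp add: binomial_eq_0 growth_def)
next
  case False
  have n: "0 < real n" using k by linarith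
  have vn: "v \<le> n" using v j by linarith
  have C: "0 < real (n choose k)" using k by simp
  have "real (v choose k) * p \<le> \<Delta> * n * (real v / n) ^ k"
  proof -
    have "real (v choose k) / real (n choose k) \<le> (real v / n) ^ k"
      using binomial_ratio_le[OF vn, of k] n C by (simp add: power_divide field_simps)
    then have "\<Delta> * n * (real (v choose k) / real (n choose k)) \<le> \<Delta> * n * (real v / n) ^ k"
      using \<Delta> by (intro mult_left_mono) auto
    then show ?thesis by (simp add: p mult_ac)
  qed
  then have vp: "exp 1 * (real (v choose k) * p) / j \<le> exp 1 * (\<Delta> * n * (real v / n) ^ k) / j"
    by (intro divide_right_mono mult_left_mono) auto
  have p0: "0 \<le> p" using \<Delta> by (simp add: p)
  have "real (n choose v) * (real ((v choose k) choose j) * p ^ j)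
      \<le> (exp 1 * real n / v) ^ v * ((exp 1 * real (v choose k) / j) ^ j * p ^ j)"
    using False j p0 by (intro mult_mono binomial_le_exp) auto
  also have "(exp 1 * real (v choose k) / j) ^ j * p ^ j = (exp 1 * (real (v choose k) * p) / j) ^ j"
    by (simp add: power_mult_distrib[symmetric] mult_ac)
  also have "(exp 1 * real n / v) ^ v * \<dots> \<le> (exp 1 * real n / v) ^ v * (exp 1 * (\<Delta> * n * (real v / n) ^ k) / j) ^ j"
    using vp p0 by (intro mult_left_mono power_mono) auto
  also have "\<dots> = exp 1 ^ (v + j) * (real v / n) ^ (k * j - v) * (\<Delta> * n / j) ^ j"
  proof -
    have "(real v / n) ^ (k * j) = (real v / n) ^ v * (real v / n) ^ (k * j - v)"
      using v by (simp flip: power_add)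
    moreover have "(real n / v) ^ v * (real v / n) ^ v = 1"
      using n False by (simp flip: power_mult_distrib)
    ultimately have "(real n / v) ^ v * (real v / n) ^ (k * j) = (real v / n) ^ (k * j - v)"
      by (metis mult.assoc mult_1)
    moreover have "(exp 1 * real n / v) ^ v * (exp 1 * (\<Delta> * n * (real v / n) ^ k) / j) ^ j
      = exp 1 ^ (v + j) * ((real n / v) ^ v * (real v / n) ^ (k * j)) * (\<Delta> * n / j) ^ j"
      by (simp add: power_mult_distrib power_divide power_add power_mult[symmetric] mult_ac)
    ultimately show ?thesis by simp
  qed
  also have "\<dots> \<le> (exp (real k + 1) ^ j * (real k ^ ((k + 1) * j) * (real j / n) powr s)) * (\<Delta> * n / j) ^ j"
  proof (intro mult_right_mono mult_mono)
    have "exp 1 ^ (v + j) \<le> (exp 1 :: real) ^ ((k + 1) * j)"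
      using v by (intro power_increasing) auto
    also have "\<dots> = exp (real k + 1) ^ j"
      by (simp add: power_mult exp_of_nat_mult[symmetric] algebra_simps)
    finally show "exp 1 ^ (v + j) \<le> exp (real k + 1) ^ j" .
    have base: "0 < real k * j / n" "real k * j / n \<le> 1"
      using k j n by (auto simp flip: of_nat_mult)
    have "(real v / n) ^ (k * j - v) \<le> (real k * j / n) ^ (k * j - v)"
      using v n by (intro power_mono divide_right_mono) (auto simp flip: of_nat_mult)
    also have "\<dots> = (real k * j / n) powr real (k * j - v)"
      using base by (simp add: powr_realpow)
    also have "\<dots> \<le> (real k * j / n) powr s"
      using base s v by (intro powr_mono') (auto simp: of_nat_diff)
    also have "\<dots> = real k powr s * (real j / n) powr s"
      using k j n by (simp add: powr_mult[symmetric])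
    also have "\<dots> \<le> real k ^ ((k + 1) * j) * (real j / n) powr s"
    proof (intro mult_right_mono)
      have "real k powr s \<le> real k powr real ((k + 1) * j)"
        using k s by (intro powr_mono) (auto simp: algebra_simps)
      moreover have "real k powr real ((k + 1) * j) = real k ^ ((k + 1) * j)"
        using k by (intro powr_realpow) simp
      ultimately show "real k powr s \<le> real k ^ ((k + 1) * j)" by simp
    qed simp
    finally show "(real v / n) ^ (k * j - v) \<le> real k ^ ((k + 1) * j) * (real j / n) powr s" .
  qed (use \<Delta> in auto)
  also have "\<dots> = growth k ^ j * (real j / n) powr s * (\<Delta> * n / j) ^ j"
    unfolding growth_def power_mult_distrib power_mult[symmetric] by (simp only: mult_ac)
  finally show ?thesis by (simp add: mult.assoc)
qed

text \<open>The factor \<open>j\<close> serves twice: as the number of edges of a dense family, and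
  as a bound for \<open>j powr (1 / 4)\<close> in \<open>sparse_term\<close>.\<close>

lemma sum_arith_geometric: "(\<Sum>j=1..J. real j / 4 ^ j) \<le> 1 / 2"
proof -
  have "(\<Sum>j=1..J. real j / 4 ^ j) = 4 / 9 - (3 * real J + 4) / (9 * 4 ^ J)"
  proof (induction J)
    case (Suc J)
    have "4 / 9 - (3 * real J + 4) / (9 * 4 ^ J) + real (Suc J) / 4 ^ Suc J
        = 4 / 9 - (3 * real (Suc J) + 4) / (9 * 4 ^ Suc J)"
      by (simp add: field_simps)
    then show ?case using Suc by simp
  qed simp
  moreover have "0 \<le> (3 * real J + 4) / (9 * 4 ^ J)" by simp
  ultimately show ?thesis by linarith
qed

text \<open>The choice of \<open>\<zeta>\<close> makes \<open>\<Delta> powr \<zeta>\<close> a constant, and \<open>\<gamma>\<close> makes the first moment of the dense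
  sets decay geometrically in their size \<open>j \<le> \<gamma> * n / y\<close>.\<close>

locale density =
  fixes k t n :: nat and \<Delta> \<gamma> y L \<zeta> :: real
  assumes t: "2 \<le> t" "t \<le> k" and kn: "k \<le> n" and \<Delta>: "2 \<le> \<Delta>"
    and \<gamma>: "\<gamma> = (1 / (8 * growth k)) ^ 4"
    and y: "y = \<Delta> powr (2 / (real t - 1))" and L: "L = ln \<Delta>" and \<zeta>: "\<zeta> = 1 / (4 * L)"
    and degree: "real k \<le> \<gamma> / 50 * n / (y * L)"
begin

lemma n_pos: "0 < real n" using t kn by linarith
lemma k1: "1 \<le> k" using t by linarith
lemma G: "1 \<le> growth k" "real k \<le> growth k" using growth_ge[OF k1] by auto
lemma \<gamma>_pos: "0 < \<gamma>" using G by (simp add: \<gamma>)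
lemma y_pos: "0 < y" using \<Delta> by (simp add: y)
lemma y_ge1: "1 \<le> y" using \<Delta> t by (auto simp: y intro!: ge_one_powr_ge_zero)
lemma L_ge: "1 / 2 \<le> L"
proof -
  have "1 / 2 \<le> ln (2 :: real)" using ln_le_minus_one[of "1 / 2 :: real"] by (simp add: ln_div)
  also have "\<dots> \<le> L" using \<Delta> by (simp add: L)
  finally show ?thesis .
qed
lemma \<zeta>_bounds: "0 < \<zeta>" "\<zeta> \<le> 1 / 2" using L_ge by (auto simp: \<zeta> field_simps)

text \<open>The fourth power in \<open>\<gamma>\<close> matches the bound
  \<open>1 / 4 \<le> \<eta>\<close> in \<open>sparse_term\<close>: with the factors
  \<open>growth k\<close> and 2 there, exactly \<open>1 / 4\<close> remains per edge.\<close>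

lemma \<gamma>_root: "\<gamma> powr (1 / 4) = 1 / (8 * growth k)"
proof -
  have "\<gamma> = (1 / (8 * growth k)) powr 4" using G by (simp add: \<gamma> powr_numeral)
  then have "\<gamma> powr (1 / 4) = (1 / (8 * growth k)) powr (4 * (1 / 4))" by (simp only: powr_powr)
  then show ?thesis using G by simp
qed

lemma \<gamma>_small: "\<gamma> \<le> 1 / (8 * growth k)"
proof -
  have "(1 / (8 * growth k)) ^ 4 \<le> (1 / (8 * growth k)) ^ 1"
    using G by (intro power_decreasing) auto
  then show ?thesis by (simp add: \<gamma>)
qed

lemma \<gamma>_le1: "\<gamma> \<le> 1"
proof -
  have "1 / (8 * growth k) \<le> 1" using G by (simp add: field_simps)
  then show ?thesis using \<gamma>_small by linarith
qed

lemma \<gamma>_k: "real k * \<gamma> \<le> 1"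
proof -
  have "real k * \<gamma> \<le> growth k * (1 / (8 * growth k))"
    using G \<gamma>_small \<gamma>_pos by (intro mult_mono) auto
  then show ?thesis using G by simp
qed

lemma kj_le_n:
  assumes "real j \<le> \<gamma> * n / y"
  shows "k * j \<le> n"
proof -
  have "real k * j \<le> real k * (\<gamma> * n / y)" using assms by (intro mult_left_mono) auto
  also have "\<dots> = (real k * \<gamma>) * (n / y)" by simp
  also have "\<dots> \<le> 1 * (n / y)" using \<gamma>_k y_pos by (intro mult_right_mono) auto
  also have "\<dots> \<le> n" using y_ge1 n_pos by (simp add: field_simps mult_left_mono)
  finally show ?thesis by (simp flip: of_nat_mult)
qed

text \<open>The exponent per edge is \<open>1 + \<eta>\<close>. The 1 cancels \<open>n / j\<close>,
  and \<open>y\<close> is such that \<open>\<Delta> * y powr (- \<eta>)\<close> is only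
  \<open>\<Delta> powr (\<zeta> / s)\<close>, at most \<open>exp (1 / 4)\<close>. One factor
  \<open>q powr (1 / 4)\<close> is kept instead of being bounded by 1; it makes the sum over
  \<open>j\<close> tend to 0 with \<open>y / n\<close>.\<close>

lemma sparse_term:
  assumes j: "1 \<le> j" "real j \<le> \<gamma> * n / y"
  shows "growth k ^ j * (real j / n) powr ((real t + 1 - \<zeta>) * j / 2) * (\<Delta> * n / j) ^ j
    \<le> (y / (\<gamma> * n)) powr (1 / 4) * (real j / 4 ^ j)"
proof -
  define s where "s = real t - 1"
  define \<eta> where "\<eta> = (s - \<zeta>) / 2"
  define q where "q = real j * y / (\<gamma> * n)"
  have s: "1 \<le> s" using t by (simp add: s_def)
  have \<eta>: "1 / 4 \<le> \<eta>" using s \<zeta>_bounds by (simp add: \<eta>_def)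
  have q: "0 < q" "q \<le> 1" using j y_pos \<gamma>_pos n_pos by (auto simp: q_def field_simps)
  have jn: "0 < real j / n" using j n_pos by simp
  have "(real j / n) powr ((real t + 1 - \<zeta>) * j / 2) = (real j / n) powr ((1 + \<eta>) * j)"
    by (simp add: \<eta>_def s_def field_simps)
  also have "\<dots> = ((real j / n) powr (1 + \<eta>)) ^ j"
    using jn j n_pos by (subst powr_power) (auto simp: mult.commute)
  also have "(real j / n) powr (1 + \<eta>) = (real j / n) * (real j / n) powr \<eta>"
    using jn by (simp add: powr_add)
  finally have base: "growth k ^ j * (real j / n) powr ((real t + 1 - \<zeta>) * j / 2) * (\<Delta> * n / j) ^ j
     = (growth k * ((real j / n) * (real j / n) powr \<eta>) * (\<Delta> * n / j)) ^ j"
    by (simp only: power_mult_distrib)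
  have "growth k * ((real j / n) * (real j / n) powr \<eta>) * (\<Delta> * n / j) = growth k * (\<Delta> * (real j / n) powr \<eta>)"
    using j n_pos by simp
  also have "\<Delta> * (real j / n) powr \<eta> = (\<Delta> * y powr (- \<eta>)) * (\<gamma> powr \<eta> * q powr \<eta>)"
  proof -
    have "real j / n = (1 / y) * (\<gamma> * q)" using y_pos \<gamma>_pos n_pos by (simp add: q_def)
    then have "(real j / n) powr \<eta> = (1 / y) powr \<eta> * (\<gamma> powr \<eta> * q powr \<eta>)"
      using y_pos \<gamma>_pos q by (simp only: powr_mult)
    then show ?thesis using y_pos by (simp add: powr_divide powr_minus_divide)
  qed
  also have "growth k * \<dots> \<le> growth k * (2 * (\<gamma> powr (1 / 4) * q powr (1 / 4)))"
  proof (intro mult_left_mono mult_mono)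
    have "2 / (real t - 1) * (- \<eta>) = \<zeta> / s - 1"
      using s by (simp add: \<eta>_def s_def[symmetric] field_simps)
    then have "y powr (- \<eta>) = \<Delta> powr (\<zeta> / s - 1)"
      by (simp only: y powr_powr)
    then have "\<Delta> * y powr (- \<eta>) = \<Delta> powr (\<zeta> / s)"
      using \<Delta> by (simp add: powr_diff)
    also have "\<dots> \<le> \<Delta> powr \<zeta>" using \<Delta> s \<zeta>_bounds by (intro powr_mono) (auto simp: field_simps)
    also have "\<dots> = exp (1 / 4)" using \<Delta> L_ge by (simp add: powr_def \<zeta> L)
    also have "\<dots> \<le> 2"
    proof -
      have "exp (1 / 4 :: real) \<le> 1 + 1 / 4 + (1 / 4)\<^sup>2" by (intro exp_bound) auto
      then show ?thesis by (simp add: power2_eq_square)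
    qed
    finally show "\<Delta> * y powr (- \<eta>) \<le> 2" .
    show "\<gamma> powr \<eta> \<le> \<gamma> powr (1 / 4)" using \<eta> \<gamma>_pos \<gamma>_le1 by (intro powr_mono') auto
    show "q powr \<eta> \<le> q powr (1 / 4)" using \<eta> q by (intro powr_mono') auto
  qed (use G in auto)
  also have "growth k * (2 * (\<gamma> powr (1 / 4) * q powr (1 / 4))) = q powr (1 / 4) / 4"
    using G by (simp add: \<gamma>_root)
  finally have "growth k ^ j * (real j / n) powr ((real t + 1 - \<zeta>) * j / 2) * (\<Delta> * n / j) ^ j
    \<le> (q powr (1 / 4) / 4) ^ j"
    unfolding base using G \<Delta> by (intro power_mono) auto
  also have "\<dots> = (q powr (1 / 4)) ^ j / 4 ^ j" by (simp add: power_divide)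
  also have "\<dots> \<le> q powr (1 / 4) / 4 ^ j"
    using power_decreasing[of 1 j "q powr (1 / 4)"] j q by (intro divide_right_mono) (auto simp: powr_le1)
  also have "q powr (1 / 4) = (y / (\<gamma> * n)) powr (1 / 4) * real j powr (1 / 4)"
    using y_pos \<gamma>_pos n_pos by (simp add: q_def powr_mult[symmetric] mult.commute)
  also have "\<dots> / 4 ^ j \<le> (y / (\<gamma> * n)) powr (1 / 4) * real j / 4 ^ j"
    using powr_mono[of "1/4" 1 "real j"] j by (intro divide_right_mono mult_left_mono) auto
  finally show ?thesis by simp
qed

text \<open>The exponent is \<open>j + (t - 1) / 2 * (j - 1) - 1 / 2\<close>. The \<open>j\<close>
  cancels the powers of \<open>n / j\<close>, the \<open>1 / 2\<close> costs
  \<open>sqrt (n / j)\<close>, one edge keeps its factor \<open>\<Delta>\<close>, and each of the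
  other \<open>j - 1\<close> gains a constant. The resulting order \<open>\<Delta> * sqrt n\<close>
  is negligible against \<open>\<Delta> * n\<close> constraints.\<close>

lemma dense_term:
  assumes j: "2 \<le> j" "\<zeta> * real j \<le> real t" "real j \<le> \<gamma> * n / y"
  shows "growth k ^ j * (real j / n) powr (((real t + 1) * j - t) / 2) * (\<Delta> * n / j) ^ j
    \<le> 4 * \<Delta> * sqrt n / 4 ^ j"
proof -
  define s where "s = real t - 1"
  obtain i where i: "j = Suc i" "1 \<le> i" using j by (cases j) auto
  have s: "1 \<le> s" using t by (simp add: s_def)
  have jn: "0 < real j / n" using j n_pos by simp
  have "(real j / n) powr (((real t + 1) * j - t) / 2) = (real j / n) powr (real j + (s / 2 * i - 1 / 2))"
    by (rule arg_cong[of _ _ "\<lambda>z. _ powr z"]) (simp add: s_def i(1) field_simps)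
  also have "\<dots> = (real j / n) ^ j * ((real j / n) powr (s / 2 * i) * (real j / n) powr (- (1 / 2)))"
    using jn by (simp add: powr_add[symmetric] powr_realpow[symmetric])
  also have "(real j / n) powr (s / 2 * i) = ((real j / n) powr (s / 2)) ^ i"
    using jn j n_pos by (subst powr_power) (auto simp: mult.commute)
  also have "(real j / n) powr (- (1 / 2)) = sqrt (n / j)"
    using jn by (simp add: powr_minus_divide powr_half_sqrt real_sqrt_divide)
  finally have e: "(real j / n) powr (((real t + 1) * j - t) / 2)
    = (real j / n) ^ j * (((real j / n) powr (s / 2)) ^ i * sqrt (n / j))" .
  have "(real j / n) ^ j * (\<Delta> * n / j) ^ j = \<Delta> ^ j"
    using j n_pos by (simp flip: power_mult_distrib)
  then have "growth k ^ j * (real j / n) powr (((real t + 1) * j - t) / 2) * (\<Delta> * n / j) ^ j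
    = growth k ^ j * \<Delta> ^ j * ((real j / n) powr (s / 2)) ^ i * sqrt (n / j)"
    unfolding e by (simp add: mult_ac)
  also have "\<dots> = \<Delta> * (growth k ^ j * (\<Delta> * (real j / n) powr (s / 2)) ^ i) * sqrt (n / j)"
    by (simp add: i(1) power_mult_distrib)
  also have "\<dots> \<le> \<Delta> * ((growth k ^ 2) ^ i * (1 / (4 * growth k ^ 2)) ^ i) * sqrt n"
  proof (intro mult_mono power_mono)
    have "j \<le> 2 * i" using i by simp
    from power_increasing[OF this G(1)]
    show "growth k ^ j \<le> (growth k ^ 2) ^ i" by (simp flip: power_mult)
    have "y powr (s / 2) = \<Delta>" using \<Delta> s by (simp add: y powr_powr s_def[symmetric])
    then have "\<Delta> * (real j / n) powr (s / 2) = (y * (real j / n)) powr (s / 2)"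
      using y_pos jn powr_mult[of y "real j / n" "s / 2"] by simp
    also have "\<dots> \<le> (y * (real j / n)) powr (1 / 2)"
    proof (rule powr_mono')
      have "y * real j \<le> y * (\<gamma> * n / y)" using j y_pos by (intro mult_left_mono) auto
      also have "\<dots> \<le> 1 * n" using \<gamma>_le1 y_pos n_pos by simp
      finally show "y * (real j / n) \<le> 1" using n_pos by (simp add: field_simps)
    qed (use s y_pos jn in auto)
    also have "\<dots> \<le> (4 * \<gamma>) powr (1 / 2)"
    proof (rule powr_mono2)
      \<comment> \<open>The cap \<open>\<zeta> * j \<le> t\<close> makes \<open>j\<close>
        logarithmic in \<open>\<Delta>\<close>; the hypothesis \<open>degree\<close> then makes
        \<open>y * j / n\<close> small.\<close>
      have "real j \<le> 4 * L * k"
      proof -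
        have "real j \<le> 4 * L * t" using j(2) L_ge by (simp add: \<zeta> field_simps)
        also have "\<dots> \<le> 4 * L * k" using t L_ge by (intro mult_left_mono) auto
        finally show ?thesis .
      qed
      then have "y * (real j / n) \<le> y * ((4 * L * k) / n)"
        using y_pos n_pos by (intro mult_left_mono divide_right_mono) auto
      also have "\<dots> = 4 * (y * L * k / n)" by simp
      also have "y * L * k / n \<le> \<gamma> / 50"
        using degree y_pos L_ge n_pos by (simp add: field_simps)
      finally show "y * (real j / n) \<le> 4 * \<gamma>" using \<gamma>_pos by linarith
    qed (use y_pos jn in auto)
    also have "\<dots> = 2 * (1 / (8 * growth k)) ^ 2"
    proof -
      have "(4 * \<gamma>) = (2 * (1 / (8 * growth k)) ^ 2) ^ 2" by (simp add: \<gamma> power_divide power_mult_distrib)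
      then have "(4 * \<gamma>) powr (1 / 2) = sqrt ((2 * (1 / (8 * growth k)) ^ 2) ^ 2)"
        using \<gamma>_pos by (simp only: powr_half_sqrt)
      then show ?thesis unfolding real_sqrt_abs by (subst (asm) abs_of_nonneg) simp_all
    qed
    also have "\<dots> \<le> 1 / (4 * growth k ^ 2)" using G by (simp add: power_divide power_mult_distrib field_simps)
    finally show "\<Delta> * (real j / n) powr (s / 2) \<le> 1 / (4 * growth k ^ 2)" .
    have "1 * real n \<le> real j * n" using j by (intro mult_right_mono) auto
    then show "sqrt (n / j) \<le> sqrt n" using j by (simp add: field_simps)
  qed (use G \<Delta> in auto)
  also have "\<dots> = 4 * \<Delta> * sqrt n / 4 ^ j"
    using G by (simp flip: power_mult_distrib) (simp add: i(1) power_divide)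
  finally show ?thesis .
qed

end

section \<open>Random instances\<close>

lemma integrable_bounded_pmf:
  fixes F :: "'a \<Rightarrow> real"
  assumes "\<And>x. \<bar>F x\<bar> \<le> B"
  shows "integrable (measure_pmf p) F"
  by (rule measure_pmf.integrable_const_bound[where B = B]) (use assms in auto)

lemma prob_markov:
  fixes u :: "'a \<Rightarrow> real"
  assumes "\<And>x. 0 \<le> u x" "\<And>x. u x \<le> B" "0 < c"
  shows "measure_pmf.prob p {x. c \<le> u x} \<le> measure_pmf.expectation p u / c"
  using integral_Markov_inequality_measure[of "measure_pmf p" u "{}" c] assms
    integrable_bounded_pmf[of u B p] by simp

lemma prob_Un_le: "measure_pmf.prob p (A \<union> B) \<le> measure_pmf.prob p A + measure_pmf.prob p B"
  by (rule measure_Un_le) auto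

lemma chebyshev_Pi_pmf:
  fixes h :: "'a \<Rightarrow> 'b \<Rightarrow> real" and v a :: real
  assumes E: "finite E" and bound: "\<And>e x. \<bar>h e x\<bar> \<le> 1"
    and mean: "\<And>e. e \<in> E \<Longrightarrow> measure_pmf.expectation (q e) (h e) = 0"
    and var: "\<And>e. e \<in> E \<Longrightarrow> measure_pmf.expectation (q e) (\<lambda>x. (h e x)\<^sup>2) \<le> v" and a: "0 < a"
  shows "measure_pmf.prob (Pi_pmf E d q) {f. a \<le> \<bar>\<Sum>e\<in>E. h e (f e)\<bar>} \<le> card E * v / a\<^sup>2"
proof -
  let ?P = "Pi_pmf E d q"
  let ?E = "measure_pmf.expectation ?P"
  have int: "integrable (measure_pmf ?P) (\<lambda>f. h e (f e) * h e' (f e'))" for e e'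
    by (rule integrable_bounded_pmf[of _ 1]) (auto simp: abs_mult intro!: mult_le_one bound)
  have int1: "integrable (measure_pmf ?P) (\<lambda>f. h e (f e))" for e
    by (rule integrable_bounded_pmf[of _ 1]) (auto intro!: bound)
  have comp: "?E (\<lambda>f. g (f e)) = measure_pmf.expectation (q e) g" if "e \<in> E" for e and g :: "'b \<Rightarrow> real"
    using integral_map_pmf[of "\<lambda>f. f e" ?P g] Pi_pmf_component[OF E, of e d q] that by simp
  have cross: "?E (\<lambda>f. h e (f e) * h e' (f e')) = 0" if e: "e \<in> E" "e' \<in> E" "e \<noteq> e'" for e e'
  proof -
    \<comment> \<open>The product rule is applied to the nonnegative factors \<open>1 + h\<close>.
      Expanding their product isolates the covariance, since the means vanish.\<close>
    define F where "F x y = (if x = e \<or> x = e' then 1 + h x y else 1)" for x y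
    have low: "0 \<le> 1 + h x y" for x y using bound[of x y] by linarith
    have F0: "0 \<le> F x y" for x y using low by (simp add: F_def)
    have "\<bar>F x y\<bar> \<le> 2" for x y using bound[of x y] by (auto simp: F_def)
    then have intF: "integrable (measure_pmf (q x)) (F x)" for x by (rule integrable_bounded_pmf)
    have prod: "(\<Prod>x\<in>E. G x) = G e * G e'" if "\<And>x. x \<noteq> e \<Longrightarrow> x \<noteq> e' \<Longrightarrow> G x = 1" for G :: "'a \<Rightarrow> real"
    proof -
      have "(\<Prod>x\<in>E. G x) = (\<Prod>x\<in>{e, e'}. G x)"
        using E e that by (intro prod.mono_neutral_right) auto
      then show ?thesis using e by simp
    qed
    have "?E (\<lambda>f. \<Prod>x\<in>E. F x (f x)) = (\<Prod>x\<in>E. measure_pmf.expectation (q x) (F x))"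
      by (rule expectation_prod_Pi_pmf) (use E F0 intF in auto)
    also have "\<dots> = measure_pmf.expectation (q e) (F e) * measure_pmf.expectation (q e') (F e')"
      by (rule prod) (simp add: F_def[abs_def])
    also have "\<dots> = 1"
    proof -
      have ih: "integrable (measure_pmf (q x)) (h x)" for x
        by (rule integrable_bounded_pmf[of _ 1]) (rule bound)
      have "measure_pmf.expectation (q x) (F x) = 1" if "x = e \<or> x = e'" for x
        using that mean[of x] e ih by (auto simp: F_def[abs_def])
      then show ?thesis by simp
    qed
    also have "(\<lambda>f. \<Prod>x\<in>E. F x (f x)) = (\<lambda>f. 1 + h e (f e) + h e' (f e') + h e (f e) * h e' (f e'))"
      by (intro ext, subst prod) (use e in \<open>auto simp: F_def algebra_simps\<close>)
    also have "?E \<dots> = 1 + ?E (\<lambda>f. h e (f e)) + ?E (\<lambda>f. h e' (f e')) + ?E (\<lambda>f. h e (f e) * h e' (f e'))"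
      using int int1 by simp
    finally show ?thesis using comp mean e by simp
  qed
  have "?E (\<lambda>f. (\<Sum>e\<in>E. h e (f e))\<^sup>2) = ?E (\<lambda>f. \<Sum>e\<in>E. \<Sum>e'\<in>E. h e (f e) * h e' (f e'))"
    by (simp add: power2_eq_square sum_product)
  also have "\<dots> = (\<Sum>e\<in>E. \<Sum>e'\<in>E. ?E (\<lambda>f. h e (f e) * h e' (f e')))"
    using int by (simp add: Bochner_Integration.integral_sum)
  also have "\<dots> = (\<Sum>e\<in>E. ?E (\<lambda>f. h e (f e) * h e (f e)))"
  proof (intro sum.cong refl)
    fix e assume e: "e \<in> E"
    have "(\<Sum>e'\<in>E. ?E (\<lambda>f. h e (f e) * h e' (f e'))) = (\<Sum>e'\<in>{e}. ?E (\<lambda>f. h e (f e) * h e' (f e')))"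
      using cross e E by (intro sum.mono_neutral_right) auto
    then show "(\<Sum>e'\<in>E. ?E (\<lambda>f. h e (f e) * h e' (f e'))) = ?E (\<lambda>f. h e (f e) * h e (f e))" by simp
  qed
  also have "\<dots> \<le> (\<Sum>e\<in>E. v)"
  proof (intro sum_mono)
    fix e assume e: "e \<in> E"
    show "?E (\<lambda>f. h e (f e) * h e (f e)) \<le> v"
      using comp[OF e, of "\<lambda>y. (h e y)\<^sup>2"] var[OF e] by (simp add: power2_eq_square)
  qed
  finally have second: "?E (\<lambda>f. (\<Sum>e\<in>E. h e (f e))\<^sup>2) \<le> card E * v" by simp
  have "\<bar>\<Sum>e\<in>E. h e (f e)\<bar> \<le> real (card E)" for f
    using sum_mono[of E "\<lambda>e. \<bar>h e (f e)\<bar>" "\<lambda>_. 1", OF bound]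
    by (intro order_trans[OF sum_abs]) simp
  then have bd: "(\<Sum>e\<in>E. h e (f e))\<^sup>2 \<le> (real (card E))\<^sup>2" for f
    by (metis abs_ge_zero power2_abs power_mono)
  have "{f. a \<le> \<bar>\<Sum>e\<in>E. h e (f e)\<bar>} = {f. a\<^sup>2 \<le> (\<Sum>e\<in>E. h e (f e))\<^sup>2}"
    using a by (auto simp: abs_le_square_iff[symmetric])
  then have "measure_pmf.prob ?P {f. a \<le> \<bar>\<Sum>e\<in>E. h e (f e)\<bar>} \<le> ?E (\<lambda>f. (\<Sum>e\<in>E. h e (f e))\<^sup>2) / a\<^sup>2"
    using prob_markov[of "\<lambda>f. (\<Sum>e\<in>E. h e (f e))\<^sup>2" "(real (card E))\<^sup>2" "a\<^sup>2" ?P] bd a by simp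
  also have "\<dots> \<le> card E * v / a\<^sup>2" using second a by (intro divide_right_mono) auto
  finally show ?thesis .
qed

lemma expectation_bernoulli_bind:
  fixes F :: "'a \<Rightarrow> real"
  assumes fin: "finite (set_pmf X)" "finite (set_pmf Y)" and p: "0 \<le> p" "p \<le> 1"
  shows "measure_pmf.expectation (bernoulli_pmf p \<bind> (\<lambda>b. if b then X else Y)) F
    = p * measure_pmf.expectation X F + (1 - p) * measure_pmf.expectation Y F"
proof -
  let ?S = "set_pmf X \<union> set_pmf Y"
  let ?Z = "bernoulli_pmf p \<bind> (\<lambda>b. if b then X else Y)"
  have S: "measure_pmf.expectation M F = (\<Sum>a\<in>?S. pmf M a * F a)" if "set_pmf M \<subseteq> ?S" for M
    using that fin by (subst integral_measure_pmf[of ?S]) auto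
  have "set_pmf ?Z \<subseteq> ?S" by (auto split: if_splits)
  moreover have "pmf ?Z a = p * pmf X a + (1 - p) * pmf Y a" for a
    using p by (simp add: pmf_bind mult.commute)
  ultimately have "measure_pmf.expectation ?Z F = (\<Sum>a\<in>?S. (p * pmf X a + (1 - p) * pmf Y a) * F a)"
    by (simp add: S)
  also have "\<dots> = p * (\<Sum>a\<in>?S. pmf X a * F a) + (1 - p) * (\<Sum>a\<in>?S. pmf Y a * F a)"
    by (simp only: distrib_right sum.distrib mult.assoc sum_distrib_left)
  finally show ?thesis by (simp add: S)
qed

section \<open>The law of one hyperedge and the count of confined families\<close>

definition hyperedge_pmf :: "nat \<Rightarrow> 'd relation pmf \<Rightarrow> real \<Rightarrow> 'v set \<Rightarrow> ('v, 'd) constraint option pmf" where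
  "hyperedge_pmf k \<rho> p e = bernoulli_pmf p \<bind> (\<lambda>selected.
     if selected then map_pmf Some (random_constraint k \<rho> e) else return_pmf None)"

abbreviation all_edges :: "nat \<Rightarrow> nat \<Rightarrow> nat set set" where
  "all_edges k n \<equiv> {e. e \<subseteq> {..<n} \<and> card e = k}"

lemma random_instance_eq:
  "random_instance k n p \<rho> = map_pmf (instance_of (all_edges k n))
     (Pi_pmf (all_edges k n) None (hyperedge_pmf k \<rho> p))"
  by (simp add: random_instance_def Let_def instance_of_def[abs_def] hyperedge_pmf_def[abs_def])

lemma finite_bijections:
  assumes "finite e" "card e = k"
  shows "finite {\<sigma> \<in> tuples k e. bij_betw \<sigma> {..<k} e}" "{\<sigma> \<in> tuples k e. bij_betw \<sigma> {..<k} e} \<noteq> {}"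
proof -
  show "finite {\<sigma> \<in> tuples k e. bij_betw \<sigma> {..<k} e}"
    by (rule finite_subset[OF _ finite_PiE[of "{..<k}" "\<lambda>_. e"]]) (use assms in auto)
  obtain h where h: "bij_betw h {..<k} e"
    using ex_bij_betw_nat_finite[OF assms(1)] assms(2) by (auto simp: atLeast0LessThan)
  then have "bij_betw (restrict h {..<k}) {..<k} e"
    by (subst bij_betw_cong[of _ _ h]) auto
  then have "restrict h {..<k} \<in> {\<sigma> \<in> tuples k e. bij_betw \<sigma> {..<k} e}"
    by (auto simp: bij_betw_def)
  then show "{\<sigma> \<in> tuples k e. bij_betw \<sigma> {..<k} e} \<noteq> {}" by blast
qed

lemma set_hyperedge_pmf:
  assumes "finite e" "card e = k" "Some (\<sigma>, R) \<in> set_pmf (hyperedge_pmf k \<rho> p e)"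
  shows "bij_betw \<sigma> {..<k} e" "R \<in> set_pmf \<rho>"
  using assms(3) set_pmf_of_set[OF finite_bijections(2,1)[OF assms(1,2)]]
  by (auto simp: hyperedge_pmf_def random_constraint_def split: if_splits)

lemma expectation_hyperedge_pmf:
  fixes F :: "'d relation option \<Rightarrow> real"
  assumes e: "finite e" "card e = k" and \<rho>: "finite (set_pmf \<rho>)" and p: "0 \<le> p" "p \<le> 1"
  shows "measure_pmf.expectation (hyperedge_pmf k \<rho> p e) (\<lambda>z. F (map_option snd z))
    = p * measure_pmf.expectation \<rho> (\<lambda>R. F (Some R)) + (1 - p) * F None"
proof -
  have fin: "finite (set_pmf (map_pmf Some (random_constraint k \<rho> e)))"
    using set_pmf_of_set[OF finite_bijections(2,1)[OF e]] finite_bijections(1)[OF e] \<rho>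
    by (simp add: random_constraint_def)
  have "measure_pmf.expectation (map_pmf Some (random_constraint k \<rho> e)) (\<lambda>z. F (map_option snd z))
     = measure_pmf.expectation (map_pmf snd (random_constraint k \<rho> e)) (\<lambda>R. F (Some R))"
    by simp
  also have "map_pmf snd (random_constraint k \<rho> e) = \<rho>"
    by (simp add: random_constraint_def map_snd_pair_pmf)
  finally show ?thesis
    unfolding hyperedge_pmf_def by (subst expectation_bernoulli_bind[OF fin _ p]) auto
qed

lemma prob_hyperedge_selected:
  assumes p: "0 \<le> p" "p \<le> 1"
  shows "measure_pmf.prob (hyperedge_pmf k \<rho> p e) {z. z \<noteq> None} = p"
proof -
  have "pmf (hyperedge_pmf k \<rho> p e) None = 1 - p"
    using p by (simp add: hyperedge_pmf_def pmf_bind pmf_map_outside)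
  moreover have "{z. z \<noteq> None} = space (measure_pmf (hyperedge_pmf k \<rho> p e)) - {None}" by auto
  ultimately show ?thesis
    by (simp only: measure_pmf.prob_compl sets_measure_pmf UNIV_I) (simp add: pmf.rep_eq)
qed

lemma prob_selected_superset:
  fixes E X :: "'v set set" and \<rho> :: "'d relation pmf"
  assumes E: "finite E" and X: "X \<subseteq> E" and p: "0 \<le> p" "p \<le> 1"
  shows "measure_pmf.prob (Pi_pmf E None (hyperedge_pmf k \<rho> p)) {f. X \<subseteq> selected E f} = p ^ card X"
proof -
  have "{f :: 'v set \<Rightarrow> ('v, 'd) constraint option. X \<subseteq> selected E f} = Pi E (\<lambda>e. if e \<in> X then {z. z \<noteq> None} else UNIV)"
    using X by (auto simp: selected_def Pi_def split: if_splits)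
  then have "measure_pmf.prob (Pi_pmf E None (hyperedge_pmf k \<rho> p)) {f. X \<subseteq> selected E f}
      = (\<Prod>e\<in>E. measure_pmf.prob (hyperedge_pmf k \<rho> p e) (if e \<in> X then {z. z \<noteq> None} else UNIV))"
    by (simp only: measure_Pi_pmf_Pi[OF E])
  also have "\<dots> = (\<Prod>e\<in>E. if e \<in> X then p else 1)"
    using prob_hyperedge_selected[OF p] by (intro prod.cong) auto
  also have "\<dots> = p ^ card X" using E X by (simp add: prod.If_cases Int_absorb1)
  finally show ?thesis .
qed

text \<open>A family on at most \<open>v\<close> vertices lies inside a vertex set of size exactly
  \<open>v\<close>; the overcount is harmless in a union bound.\<close>

lemma card_confined_families:
  assumes v: "v \<le> n"
  shows "card {X. X \<subseteq> all_edges k n \<and> card X = j \<and> card (\<Union>X) \<le> v}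
    \<le> (n choose v) * ((v choose k) choose j)"
proof -
  let ?W = "{W. W \<subseteq> {..<n} \<and> card W = v}"
  let ?F = "\<lambda>W. {X. X \<subseteq> {e. e \<subseteq> W \<and> card e = k} \<and> card X = j}"
  have finW: "finite ?W" by simp
  have fin: "finite (?F W)" if "W \<in> ?W" for W
  proof -
    have "finite W" using that finite_subset by auto
    then show ?thesis by (auto intro!: finite_subset[of _ "Pow (Pow W)"])
  qed
  have "{X. X \<subseteq> all_edges k n \<and> card X = j \<and> card (\<Union>X) \<le> v} \<subseteq> (\<Union>W\<in>?W. ?F W)"
  proof
    fix X assume X: "X \<in> {X. X \<subseteq> all_edges k n \<and> card X = j \<and> card (\<Union>X) \<le> v}"
    then have "\<Union>X \<subseteq> {..<n}" by blast
    then obtain W where "\<Union>X \<subseteq> W" "W \<subseteq> {..<n}" "card W = v"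
      using exists_subset_between[of "\<Union>X" v "{..<n}"] X v by auto
    then show "X \<in> (\<Union>W\<in>?W. ?F W)" using X by blast
  qed
  then have "card {X. X \<subseteq> all_edges k n \<and> card X = j \<and> card (\<Union>X) \<le> v} \<le> card (\<Union>W\<in>?W. ?F W)"
    using finW fin by (intro card_mono finite_UN_I) auto
  also have "\<dots> \<le> (\<Sum>W\<in>?W. card (?F W))" by (rule card_UN_le[OF finW])
  also have "\<dots> = (\<Sum>W\<in>?W. (v choose k) choose j)"
  proof (intro sum.cong refl)
    fix W assume W: "W \<in> ?W"
    then have "finite W" using finite_subset by auto
    then show "card (?F W) = (v choose k) choose j" using W by (simp add: n_subsets)
  qed
  also have "\<dots> = (n choose v) * ((v choose k) choose j)" by (simp add: n_subsets)
  finally show ?thesis .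
qed

text \<open>The weight \<open>c\<close> is 1 for the failure of expansion, and the size of the
  family when counting the dense edges it contains.\<close>

lemma sum_confined_families:
  fixes c :: "nat \<Rightarrow> real"
  assumes c: "\<And>j. 0 \<le> c j" and p: "0 \<le> p" and J: "finite J" and v: "\<And>j. j \<in> J \<Longrightarrow> v j \<le> n"
  shows "(\<Sum>X\<in>{X. X \<subseteq> all_edges k n \<and> card X \<in> J \<and> card (\<Union>X) \<le> v (card X)}. c (card X) * p ^ card X)
    \<le> (\<Sum>j\<in>J. c j * (real (n choose v j) * real ((v j choose k) choose j) * p ^ j))"
proof -
  let ?B = "{X. X \<subseteq> all_edges k n \<and> card X \<in> J \<and> card (\<Union>X) \<le> v (card X)}"
  have finB: "finite ?B" by (rule finite_subset[of _ "Pow (Pow {..<n})"]) auto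
  have "(\<Sum>X\<in>?B. c (card X) * p ^ card X) = (\<Sum>j\<in>J. \<Sum>X\<in>{X\<in>?B. card X = j}. c (card X) * p ^ card X)"
    by (rule sum.group[symmetric]) (use finB J in auto)
  also have "\<dots> = (\<Sum>j\<in>J. card {X\<in>?B. card X = j} * (c j * p ^ j))" by simp
  also have "\<dots> \<le> (\<Sum>j\<in>J. real ((n choose v j) * ((v j choose k) choose j)) * (c j * p ^ j))"
  proof (intro sum_mono mult_right_mono of_nat_mono)
    fix j assume j: "j \<in> J"
    have "{X\<in>?B. card X = j} = {X. X \<subseteq> all_edges k n \<and> card X = j \<and> card (\<Union>X) \<le> v j}"
      using j by auto
    then show "card {X\<in>?B. card X = j} \<le> (n choose v j) * ((v j choose k) choose j)"
      using card_confined_families[OF v[OF j]] by simp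
  qed (use c p in auto)
  finally show ?thesis by (simp add: mult_ac)
qed

section \<open>Failure events of a random instance\<close>

locale random_csp = density k t n \<Delta> \<gamma> y L \<zeta>
  for k t n :: nat and \<Delta> \<gamma> y L \<zeta> :: real +
  fixes \<rho> :: "'d relation pmf" and D :: "'d set" and \<R> :: "'d relation set" and p :: real
    and E :: "nat set set"
  assumes csp: "is_csp k D \<R>" and \<rho>: "set_pmf \<rho> \<subseteq> \<R>"
    and p: "p = \<Delta> * n / real (n choose k)" and \<Delta>n: "\<Delta> * n \<le> real (n choose k)"
    and E: "E = all_edges k n"
begin

abbreviation P where "P \<equiv> Pi_pmf E None (hyperedge_pmf k \<rho> p)"

definition r :: nat where "r = nat \<lceil>\<gamma> / 50 * n / (y * L)\<rceil>"
definition N :: nat where "N = nat \<lceil>3 * real r / \<zeta>\<rceil>"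

lemma choose_pos: "0 < real (n choose k)" using kn by simp

lemma p01: "0 \<le> p" "p \<le> 1"
  using \<Delta>n \<Delta> choose_pos by (auto simp: p)

lemma finE: "finite E" by (simp add: E)

lemma cardE: "real (card E) * p = \<Delta> * n"
  using choose_pos by (simp add: E n_subsets p)

lemma fin\<rho>: "finite (set_pmf \<rho>)"
proof -
  have "\<R> \<subseteq> Pow (tuples k D)" "finite D" using csp by (auto simp: is_csp_def)
  then have "finite \<R>" by (meson finite_PiE finite_Pow_iff finite_lessThan finite_subset)
  then show ?thesis using \<rho> finite_subset by blast
qed

lemma r_ge: "\<gamma> / 50 * n / (y * L) \<le> r" "k \<le> r"
proof -
  show "\<gamma> / 50 * n / (y * L) \<le> r" unfolding r_def by (rule real_nat_ceiling_ge)
  then show "k \<le> r" using degree by linarith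
qed

text \<open>The origin of the 50: with \<open>X\<close> the promised degree, rounding up gives
  \<open>r \<le> 2 * X\<close> and so \<open>3 * r / \<zeta> \<le> 24 * L * X\<close>. Rounding up
  to \<open>N\<close> and doubling stays below \<open>50 * L * X = \<gamma> * n / y\<close>, the
  range of the first moment estimates.\<close>

lemma N_props: "1 \<le> N" "3 * real r \<le> \<zeta> * N" "real (2 * N) \<le> \<gamma> * n / y"
proof -
  define X where "X = \<gamma> / 50 * n / (y * L)"
  have X: "2 \<le> X" using degree t by (simp add: X_def)
  have LX: "L * X = \<gamma> / 50 * n / y" using L_ge y_pos by (simp add: X_def)
  have N_ge: "3 * real r / \<zeta> \<le> N" unfolding N_def by (rule real_nat_ceiling_ge)
  then show "3 * real r \<le> \<zeta> * N" using \<zeta>_bounds by (simp add: field_simps)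
  have "0 < r" using r_ge t by linarith
  then have "0 < 3 * real r / \<zeta>" using \<zeta>_bounds by simp
  then show "1 \<le> N" using N_ge by linarith
  have "real r \<le> X + 1" unfolding r_def X_def[symmetric] using X by linarith
  then have "real r \<le> 2 * X" using X by linarith
  then have "3 * real r / \<zeta> \<le> 24 * (L * X)"
    using L_ge mult_left_mono[of "real r" "2 * X" "12 * L"] by (simp add: \<zeta>)
  moreover have "real N \<le> 3 * real r / \<zeta> + 1"
    unfolding N_def using \<open>0 < 3 * real r / \<zeta>\<close> by linarith
  moreover have "1 \<le> L * X" using mult_mono[of "1/2" L 2 X] L_ge X by simp
  ultimately have "real (2 * N) \<le> 50 * (L * X)" by simp
  then show "real (2 * N) \<le> \<gamma> * n / y" unfolding LX by simp
qed

definition expanding :: "nat set set \<Rightarrow> bool" where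
  "expanding S \<longleftrightarrow> (\<forall>X. X \<subseteq> S \<and> X \<noteq> {} \<and> card X \<le> 2 * N \<longrightarrow>
     (2 * real k - real t - 1 + \<zeta>) * card X \<le> 2 * card (\<Union>X))"

lemma j_bounds:
  assumes "j \<le> 2 * N"
  shows "real j \<le> \<gamma> * n / y" "k * j \<le> n"
proof -
  show "real j \<le> \<gamma> * n / y" using N_props(3) assms by linarith
  then show "k * j \<le> n" by (rule kj_le_n)
qed

lemma prob_not_expanding:
  "measure_pmf.prob P {f. \<not> expanding (selected E f)} \<le> (y / (\<gamma> * n)) powr (1 / 4)"
proof -
  define v where "v j = nat \<lfloor>(2 * real k - real t - 1 + \<zeta>) * real j / 2\<rfloor>" for j :: nat
  define J where "J = {1..2 * N}"
  define B where "B = {X. X \<subseteq> all_edges k n \<and> card X \<in> J \<and> card (\<Union>X) \<le> v (card X)}"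
  have pos: "0 \<le> 2 * real k - real t - 1 + \<zeta>" using t \<zeta>_bounds by simp
  have v: "real (v j) \<le> (2 * real k - real t - 1 + \<zeta>) * real j / 2" for j
    unfolding v_def using pos by (intro of_nat_floor) simp
  have vk: "v j \<le> k * j" for j
  proof -
    have "(2 * real k - real t - 1 + \<zeta>) * real j \<le> (2 * real k) * real j"
      using \<zeta>_bounds t by (intro mult_right_mono) auto
    then have "real (v j) \<le> real k * j" using v[of j] by linarith
    then show ?thesis by (simp flip: of_nat_mult)
  qed
  have vn: "v j \<le> n" if "j \<in> J" for j
    using vk[of j] j_bounds[of j] that by (auto simp: J_def)
  have finB: "finite B" unfolding B_def by (rule finite_subset[of _ "Pow (Pow {..<n})"]) auto
  have BE: "X \<subseteq> E" if "X \<in> B" for X using that by (auto simp: B_def E)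
  have "{f :: nat set \<Rightarrow> (nat, 'd) constraint option. \<not> expanding (selected E f)} \<subseteq> (\<Union>X\<in>B. {f. X \<subseteq> selected E f})"
  proof
    fix f assume "f \<in> {f :: nat set \<Rightarrow> (nat, 'd) constraint option. \<not> expanding (selected E f)}"
    then obtain X where X: "X \<subseteq> selected E f" "X \<noteq> {}" "card X \<le> 2 * N"
      "\<not> (2 * real k - real t - 1 + \<zeta>) * card X \<le> 2 * card (\<Union>X)"
      by (auto simp: expanding_def)
    have XE: "X \<subseteq> E" using X(1) by (auto simp: selected_def)
    then have "finite X" using finE finite_subset by auto
    then have "card X \<in> J" using X by (auto simp: J_def Suc_le_eq card_gt_0_iff)
    moreover have "card (\<Union>X) \<le> v (card X)"
      unfolding v_def using X(4) by (intro le_nat_floor) simp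
    ultimately have "X \<in> B" using XE by (simp add: B_def E)
    then show "f \<in> (\<Union>X\<in>B. {f. X \<subseteq> selected E f})" using X(1) by blast
  qed
  then have "measure_pmf.prob P {f. \<not> expanding (selected E f)}
      \<le> measure_pmf.prob P (\<Union>X\<in>B. {f. X \<subseteq> selected E f})"
    by (intro measure_pmf.finite_measure_mono) auto
  also have "\<dots> \<le> (\<Sum>X\<in>B. measure_pmf.prob P {f. X \<subseteq> selected E f})"
    by (rule measure_UNION_le[OF finB]) auto
  also have "\<dots> = (\<Sum>X\<in>B. 1 * p ^ card X)"
    using prob_selected_superset[OF finE BE p01] by (intro sum.cong) auto
  also have "\<dots> \<le> (\<Sum>j\<in>J. 1 * (real (n choose v j) * real ((v j choose k) choose j) * p ^ j))"
    unfolding B_def by (rule sum_confined_families) (use p01 vn in \<open>auto simp: J_def\<close>)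
  also have "\<dots> \<le> (\<Sum>j\<in>J. (y / (\<gamma> * n)) powr (1 / 4) * (real j / 4 ^ j))"
  proof (intro sum_mono)
    fix j assume j: "j \<in> J"
    then have j': "1 \<le> j" "real j \<le> \<gamma> * n / y" "k * j \<le> n" using j_bounds by (auto simp: J_def)
    have "real (n choose v j) * real ((v j choose k) choose j) * p ^ j
      \<le> growth k ^ j * (real j / n) powr ((real t + 1 - \<zeta>) * j / 2) * (\<Delta> * n / j) ^ j"
    proof (rule term_bound[OF k1 kn j'(1,3) vk _ _ _ _ p])
      show "0 \<le> (real t + 1 - \<zeta>) * j / 2" using \<zeta>_bounds by simp
      show "(real t + 1 - \<zeta>) * j / 2 \<le> real k * j - v j"
        using v[of j] by (simp add: field_simps)
      have "(real t + 1 - \<zeta>) / 2 * j \<le> (real k + 1) * j"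
        using t \<zeta>_bounds by (intro mult_right_mono) auto
      then show "(real t + 1 - \<zeta>) * j / 2 \<le> (real k + 1) * j" by simp
    qed (use \<Delta> in auto)
    also have "\<dots> \<le> (y / (\<gamma> * n)) powr (1 / 4) * (real j / 4 ^ j)"
      by (rule sparse_term[OF j'(1,2)])
    finally show "1 * (real (n choose v j) * real ((v j choose k) choose j) * p ^ j)
      \<le> (y / (\<gamma> * n)) powr (1 / 4) * (real j / 4 ^ j)" by simp
  qed
  also have "\<dots> = (y / (\<gamma> * n)) powr (1 / 4) * (\<Sum>j=1..2 * N. real j / 4 ^ j)"
    by (simp add: J_def sum_distrib_left)
  also have "\<dots> \<le> (y / (\<gamma> * n)) powr (1 / 4) * 1"
    using sum_arith_geometric[of "2 * N"] by (intro mult_left_mono) auto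
  finally show ?thesis by simp
qed

lemma prob_many_dense:
  fixes a :: real
  assumes a: "0 < a"
  shows "measure_pmf.prob P {f. a \<le> card (dense_edges k t \<zeta> N (selected E f))} \<le> 2 * \<Delta> * sqrt n / a"
proof -
  define v where "v j = ((2 * k - t - 1) * j + t) div 2" for j :: nat
  define J where "J = {j. 2 \<le> j \<and> \<zeta> * real j \<le> real t \<and> j \<le> 2 * N}"
  have finJ: "finite J" by (rule finite_subset[of _ "{..2 * N}"]) (auto simp: J_def)
  define B where "B = {X. X \<subseteq> all_edges k n \<and> card X \<in> J \<and> card (\<Union>X) \<le> v (card X)}"
  have kt: "t + 1 \<le> 2 * k" using t by linarith
  have v: "2 * real (v j) \<le> (2 * real k - real t - 1) * j + t" for j
  proof -
    have "2 * v j \<le> (2 * k - t - 1) * j + t" by (simp add: v_def)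
    then have "real (2 * v j) \<le> real ((2 * k - t - 1) * j + t)" by (rule of_nat_mono)
    then have "2 * real (v j) \<le> real (2 * k - t - 1) * j + t"
      by (simp only: of_nat_add of_nat_mult of_nat_numeral)
    moreover have "real (2 * k - t - 1) = 2 * real k - real t - 1" using kt by linarith
    ultimately show ?thesis by (simp only:)
  qed
  have vk: "v j \<le> k * j" if "j \<in> J" for j
  proof -
    have "real t * 1 \<le> (real t + 1) * j" using that by (intro mult_mono) (auto simp: J_def)
    then have "real (v j) \<le> real k * j" using v[of j] by (simp add: algebra_simps)
    then show ?thesis by (simp flip: of_nat_mult)
  qed
  have vn: "v j \<le> n" if "j \<in> J" for j
    using vk[OF that] j_bounds[of j] that by (auto simp: J_def)
  have finB: "finite B" unfolding B_def by (rule finite_subset[of _ "Pow (Pow {..<n})"]) auto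
  have BE: "X \<subseteq> E" if "X \<in> B" for X using that by (auto simp: B_def E)
  \<comment> \<open>Every dense edge lies in some family of \<open>B\<close>, which accounts for at
    most \<open>card X\<close> of them. This overcount is a combination of events of known
    probability, ready for Markov.\<close>
  define u where "u f = (\<Sum>X\<in>B. real (card X) * indicator {f. X \<subseteq> selected E f} f)"
    for f :: "nat set \<Rightarrow> (nat, 'd) constraint option"
  have dense_le: "real (card (dense_edges k t \<zeta> N (selected E f))) \<le> u f" for f
  proof -
    let ?S = "selected E f"
    have finS: "finite ?S" using finE by (simp add: selected_def)
    let ?B = "{X \<in> B. X \<subseteq> ?S}"
    have "dense_edges k t \<zeta> N ?S \<subseteq> \<Union>?B"
    proof
      fix e assume "e \<in> dense_edges k t \<zeta> N ?S"
      then obtain X where X: "X \<subseteq> ?S" "e \<in> X" "2 \<le> card X" "\<zeta> * real (card X) \<le> real t" "card X \<le> 2 * N"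
        "2 * card (\<Union>X) \<le> 2 * real k * card X - (real t + 1) * card X + t"
        by (auto simp: dense_edges_def)
      have "real (2 * card (\<Union>X)) \<le> real ((2 * k - t - 1) * card X + t)"
      proof -
        have "real (2 * k - t - 1) = 2 * real k - real t - 1" using kt by linarith
        then have "real ((2 * k - t - 1) * card X + t) = (2 * real k - real t - 1) * card X + t"
          by (simp only: of_nat_add of_nat_mult)
        then show ?thesis using X(6) by (simp only:) (simp add: algebra_simps)
      qed
      then have "2 * card (\<Union>X) \<le> (2 * k - t - 1) * card X + t" by (simp only: of_nat_le_iff)
      then have "card (\<Union>X) \<le> v (card X)" by (simp add: v_def)
      then have "X \<in> ?B" using X by (auto simp: B_def J_def E selected_def)
      then show "e \<in> \<Union>?B" using X(2) by blast
    qed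
    moreover have "finite (\<Union>?B)" by (rule finite_subset[OF _ finS]) auto
    ultimately have "card (dense_edges k t \<zeta> N ?S) \<le> card (\<Union>?B)" by (intro card_mono)
    also have "\<dots> \<le> (\<Sum>X\<in>?B. card X)" using finB card_Union_le_sum_card by simp
    finally have "real (card (dense_edges k t \<zeta> N ?S)) \<le> (\<Sum>X\<in>?B. real (card X))"
      by (simp flip: of_nat_sum)
    also have "\<dots> = u f"
      unfolding u_def using finB by (intro sum.mono_neutral_cong_left) auto
    finally show ?thesis .
  qed
  have u0: "0 \<le> u f" for f unfolding u_def by (intro sum_nonneg) auto
  have u1: "u f \<le> (\<Sum>X\<in>B. real (card X))" for f
    unfolding u_def by (intro sum_mono) (auto simp: indicator_def)
  have "{f. a \<le> card (dense_edges k t \<zeta> N (selected E f))} \<subseteq> {f. a \<le> u f}"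
    using dense_le order_trans by blast
  then have "measure_pmf.prob P {f. a \<le> card (dense_edges k t \<zeta> N (selected E f))}
      \<le> measure_pmf.prob P {f. a \<le> u f}"
    by (intro measure_pmf.finite_measure_mono) auto
  also have "\<dots> \<le> measure_pmf.expectation P u / a" by (rule prob_markov[OF u0 u1 a])
  also have "measure_pmf.expectation P u = (\<Sum>X\<in>B. real (card X) * measure_pmf.prob P {f. X \<subseteq> selected E f})"
  proof -
    have "integrable (measure_pmf P) (\<lambda>f. real (card X) * indicator Q f)" for X :: "nat set set" and Q
      by (rule integrable_bounded_pmf[of _ "real (card X)"]) (auto simp: indicator_def)
    then have "measure_pmf.expectation P u
        = (\<Sum>X\<in>B. measure_pmf.expectation P (\<lambda>f. real (card X) * indicator {f. X \<subseteq> selected E f} f))"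
      unfolding u_def by (intro Bochner_Integration.integral_sum)
    moreover have "measure_pmf.expectation P (\<lambda>f. real (card X) * indicator Q f)
        = real (card X) * measure_pmf.prob P Q" for X :: "nat set set" and Q
      by simp
    ultimately show ?thesis by (simp only:)
  qed
  also have "\<dots> = (\<Sum>X\<in>B. real (card X) * p ^ card X)"
    using prob_selected_superset[OF finE BE p01] by (intro sum.cong) auto
  also have "\<dots> \<le> (\<Sum>j\<in>J. real j * (real (n choose v j) * real ((v j choose k) choose j) * p ^ j))"
    unfolding B_def by (rule sum_confined_families) (use p01 vn finJ in auto)
  also have "\<dots> \<le> (\<Sum>j\<in>J. 4 * \<Delta> * sqrt n * (real j / 4 ^ j))"
  proof (intro sum_mono)
    fix j assume j: "j \<in> J"
    then have j': "1 \<le> j" "2 \<le> j" "\<zeta> * real j \<le> real t" "real j \<le> \<gamma> * n / y" "k * j \<le> n"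
      using j_bounds by (auto simp: J_def)
    have "real (n choose v j) * real ((v j choose k) choose j) * p ^ j
      \<le> growth k ^ j * (real j / n) powr (((real t + 1) * j - t) / 2) * (\<Delta> * n / j) ^ j"
    proof (rule term_bound[OF k1 kn j'(1,5) vk[OF j] _ _ _ _ p])
      have "real t * 1 \<le> (real t + 1) * j" using j' by (intro mult_mono) auto
      then show "0 \<le> ((real t + 1) * j - t) / 2" by simp
      show "((real t + 1) * j - t) / 2 \<le> real k * j - v j"
        using v[of j] by (simp add: field_simps)
      have "(real t + 1) * j \<le> 2 * (real k + 1) * j"
        using t by (intro mult_right_mono) auto
      then show "((real t + 1) * j - t) / 2 \<le> (real k + 1) * j" by (simp add: algebra_simps)
    qed (use \<Delta> in auto)
    also have "\<dots> \<le> 4 * \<Delta> * sqrt n / 4 ^ j" by (rule dense_term[OF j'(2,3,4)])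
    finally have "real j * (real (n choose v j) * real ((v j choose k) choose j) * p ^ j)
      \<le> real j * (4 * \<Delta> * sqrt n / 4 ^ j)" by (intro mult_left_mono) auto
    then show "real j * (real (n choose v j) * real ((v j choose k) choose j) * p ^ j)
      \<le> 4 * \<Delta> * sqrt n * (real j / 4 ^ j)" by (simp add: mult_ac)
  qed
  also have "\<dots> \<le> (\<Sum>j=1..2 * N. 4 * \<Delta> * sqrt n * (real j / 4 ^ j))"
    using \<Delta> by (intro sum_mono2) (auto simp: J_def)
  also have "\<dots> = 4 * \<Delta> * sqrt n * (\<Sum>j=1..2 * N. real j / 4 ^ j)"
    by (simp add: sum_distrib_left)
  also have "\<dots> \<le> 4 * \<Delta> * sqrt n * (1 / 2)"
    using sum_arith_geometric[of "2 * N"] \<Delta> by (intro mult_left_mono) auto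
  finally show ?thesis using a by (simp add: divide_right_mono)
qed

text \<open>Chebyshev with variance at most \<open>p\<close> per hyperedge; over all hyperedges this
  sums to at most the expected number \<open>\<Delta> * n\<close> of constraints.\<close>

lemma prob_deviation:
  fixes F :: "'d relation option \<Rightarrow> real"
  assumes bound: "\<And>z. \<bar>F z\<bar> \<le> 1"
    and mean: "p * measure_pmf.expectation \<rho> (\<lambda>R. F (Some R)) + (1 - p) * F None = 0"
    and var: "p * measure_pmf.expectation \<rho> (\<lambda>R. (F (Some R))\<^sup>2) + (1 - p) * (F None)\<^sup>2 \<le> p"
    and a: "0 < a"
  shows "measure_pmf.prob P {f. a \<le> \<bar>\<Sum>e\<in>E. F (map_option snd (f e))\<bar>} \<le> \<Delta> * n / a\<^sup>2"
proof -
  have e: "finite e" "card e = k" if "e \<in> E" for e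
    using that finite_subset[of e "{..<n}"] by (auto simp: E)
  have "measure_pmf.prob P {f. a \<le> \<bar>\<Sum>e\<in>E. F (map_option snd (f e))\<bar>} \<le> card E * p / a\<^sup>2"
  proof (rule chebyshev_Pi_pmf[OF finE _ _ _ a])
    fix e assume eE: "e \<in> E"
    show "measure_pmf.expectation (hyperedge_pmf k \<rho> p e) (\<lambda>z. F (map_option snd z)) = 0"
      using expectation_hyperedge_pmf[OF e[OF eE] fin\<rho> p01, of F] mean by simp
    show "measure_pmf.expectation (hyperedge_pmf k \<rho> p e) (\<lambda>z. (F (map_option snd z))\<^sup>2) \<le> p"
      using expectation_hyperedge_pmf[OF e[OF eE] fin\<rho> p01, of "\<lambda>z. (F z)\<^sup>2"] var by simp
  qed (rule bound)
  then show ?thesis by (simp add: cardE)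
qed

lemma prob_sos_solution:
  assumes \<nu>: "set_pmf \<nu> \<subseteq> D"
    and \<mu>: "\<And>R. R \<in> \<R> \<Longrightarrow> set_pmf (\<mu> R) \<subseteq> tuples k D \<and> twise_independent k t \<nu> (\<mu> R)"
  defines "m \<equiv> measure_pmf.expectation \<rho> (\<lambda>R. measure_pmf.prob (\<mu> R) R)"
  shows "1 - ((y / (\<gamma> * n)) powr (1 / 4) + 2 * n powr (- 1 / 4) + 4 / n + n powr (- 1 / 2))
    \<le> measure_pmf.prob (random_instance k n p \<rho>)
        {C. \<exists>d \<Lambda>. \<gamma> / 50 * n / (y * L) \<le> real d \<and> pseudo_distribution {..<n} D d \<Lambda> \<and>
          \<bar>\<Lambda> (val_poly k C) - m\<bar> \<le> 4 * n powr (- 1 / 4)}"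
proof -
  define M where "M = \<Delta> * n"
  \<comment> \<open>At this scale both tests succeed: Markov for the dense edges leaves order
    \<open>n powr (- 1 / 4)\<close>, and Chebyshev for the planted value leaves
    \<open>n powr (- 1 / 2)\<close>.\<close>
  define \<delta> where "\<delta> = real n powr (- 1 / 4)"
  have \<delta>: "0 < \<delta>" using n_pos by (simp add: \<delta>_def)
  have Mn: "real n \<le> M" using \<Delta> n_pos mult_right_mono[of 1 \<Delta> "real n"] by (simp add: M_def)
  have M: "0 < M" using Mn n_pos by linarith
  define g where "g R = measure_pmf.prob (\<mu> R) R" for R
  have g01: "0 \<le> g R" "g R \<le> 1" for R by (auto simp: g_def)
  have intg: "integrable (measure_pmf \<rho>) g"
    by (rule integrable_bounded_pmf[of _ 1]) (use g01 in auto)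
  have m: "m = measure_pmf.expectation \<rho> g" by (simp add: m_def g_def[abs_def])
  have m01: "0 \<le> m" "m \<le> 1"
  proof -
    show "0 \<le> m" unfolding m by (rule Bochner_Integration.integral_nonneg) (rule g01)
    show "m \<le> 1" unfolding m by (rule measure_pmf.integral_le_const[OF intg]) (use g01 in auto)
  qed
  \<comment> \<open>Both have mean zero under the law of one hyperedge: \<open>G\<close> compares
    the planted value of a selected constraint with \<open>m\<close>, and \<open>H\<close> centres
    the number of constraints.\<close>
  define G where "G z = (case z of None \<Rightarrow> 0 | Some R \<Rightarrow> g R - m)" for z
  define H where "H z = (case z of None \<Rightarrow> - p | Some R \<Rightarrow> 1 - p)" for z :: "'d relation option"
  define Y where "Y f = (\<Sum>e\<in>E. G (map_option snd (f e)))" for f :: "nat set \<Rightarrow> (nat, 'd) constraint option"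
  define Z where "Z f = (\<Sum>e\<in>E. H (map_option snd (f e)))" for f :: "nat set \<Rightarrow> (nat, 'd) constraint option"
  let ?S = "\<lambda>f. selected E f"
  have Ysel: "Y f = (\<Sum>e\<in>?S f. g (snd (the (f e)))) - card (?S f) * m" for f
  proof -
    have "Y f = (\<Sum>e\<in>?S f. g (snd (the (f e))) - m)"
      unfolding Y_def using finE
      by (intro sum.mono_neutral_cong_right) (auto simp: selected_def G_def split: option.splits)
    then show ?thesis by (simp add: sum_subtractf)
  qed
  have Zsel: "Z f = card (?S f) - M" for f
  proof -
    have "Z f = (\<Sum>e\<in>E. (if e \<in> ?S f then 1 else 0) - p)"
      unfolding Z_def by (intro sum.cong) (auto simp: selected_def H_def split: option.splits)
    also have "\<dots> = card (E \<inter> ?S f) - card E * p"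
      using finE by (simp add: sum_subtractf sum.If_cases)
    also have "E \<inter> ?S f = ?S f" by (auto simp: selected_def)
    finally show ?thesis by (simp add: cardE M_def)
  qed
  define F1 where "F1 = {f :: nat set \<Rightarrow> (nat, 'd) constraint option. \<not> expanding (?S f)}"
  define F2 where "F2 = {f :: nat set \<Rightarrow> (nat, 'd) constraint option. M * \<delta> \<le> card (dense_edges k t \<zeta> N (?S f))}"
  define F3 where "F3 = {f. M / 2 \<le> \<bar>Z f\<bar>}"
  define F4 where "F4 = {f. M * \<delta> \<le> \<bar>Y f\<bar>}"
  have P1: "measure_pmf.prob P F1 \<le> (y / (\<gamma> * n)) powr (1 / 4)"
    unfolding F1_def by (rule prob_not_expanding)
  have P2: "measure_pmf.prob P F2 \<le> 2 * n powr (- 1 / 4)"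
  proof -
    have "measure_pmf.prob P F2 \<le> 2 * \<Delta> * sqrt n / (M * \<delta>)"
      unfolding F2_def using M \<delta> by (intro prob_many_dense) simp
    also have "\<dots> = 2 * (n powr (1 / 2) / (n powr 1 * n powr (- 1 / 4)))"
      using \<Delta> n_pos by (simp add: M_def \<delta>_def powr_half_sqrt)
    also have "\<dots> = 2 * n powr (1 / 2 - (1 + - 1 / 4))" by (simp only: powr_add powr_diff)
    finally show ?thesis by simp
  qed
  have P3: "measure_pmf.prob P F3 \<le> 4 / n"
  proof -
    have "measure_pmf.prob P F3 \<le> \<Delta> * n / (M / 2)\<^sup>2"
      unfolding F3_def Z_def
    proof (rule prob_deviation)
      show "\<bar>H z\<bar> \<le> 1" for z using p01 by (auto simp: H_def split: option.splits)
      have "p * (1 - p)\<^sup>2 + (1 - p) * p\<^sup>2 = p * (1 - p)" by (simp add: power2_eq_square algebra_simps)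
      also have "\<dots> \<le> p" using p01 by (simp add: mult_left_le)
      finally show "p * measure_pmf.expectation \<rho> (\<lambda>R. (H (Some R))\<^sup>2) + (1 - p) * (H None)\<^sup>2 \<le> p"
        by (simp add: H_def)
    qed (use M in \<open>auto simp: H_def algebra_simps\<close>)
    also have "\<dots> = 4 / M" using M by (simp add: M_def[symmetric] power2_eq_square)
    also have "\<dots> \<le> 4 / n" using Mn n_pos by (intro divide_left_mono) auto
    finally show ?thesis .
  qed
  have P4: "measure_pmf.prob P F4 \<le> n powr (- 1 / 2)"
  proof -
    have "measure_pmf.prob P F4 \<le> \<Delta> * n / (M * \<delta>)\<^sup>2"
      unfolding F4_def Y_def
    proof (rule prob_deviation)
      show "\<bar>G z\<bar> \<le> 1" for z
        using g01 m01 by (auto simp: G_def abs_le_iff split: option.splits) (smt (verit))+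
      show "p * measure_pmf.expectation \<rho> (\<lambda>R. G (Some R)) + (1 - p) * G None = 0"
        using intg by (simp add: G_def m)
      have "measure_pmf.expectation \<rho> (\<lambda>R. (g R - m)\<^sup>2) \<le> 1"
      proof (rule measure_pmf.integral_le_const)
        have "\<bar>g R - m\<bar> \<le> 1" for R using g01[of R] m01 by linarith
        then have sq: "(g R - m)\<^sup>2 \<le> 1" for R using abs_square_le_1 by blast
        then show "AE R in measure_pmf \<rho>. (g R - m)\<^sup>2 \<le> 1" by simp
        show "integrable (measure_pmf \<rho>) (\<lambda>R. (g R - m)\<^sup>2)"
          by (rule integrable_bounded_pmf[of _ 1]) (use sq in auto)
      qed
      then have "p * measure_pmf.expectation \<rho> (\<lambda>R. (g R - m)\<^sup>2) \<le> p * 1"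
        using p01 by (intro mult_left_mono) auto
      then show "p * measure_pmf.expectation \<rho> (\<lambda>R. (G (Some R))\<^sup>2) + (1 - p) * (G None)\<^sup>2 \<le> p"
        by (simp add: G_def)
    qed (use M \<delta> in auto)
    also have "\<dots> = 1 / (M * \<delta>\<^sup>2)" using M by (simp add: M_def[symmetric] power2_eq_square)
    also have "\<delta>\<^sup>2 = n powr (- 1 / 2)"
      by (simp add: \<delta>_def power2_eq_square powr_add[symmetric])
    also have "1 / (M * n powr (- 1 / 2)) \<le> 1 / (n * n powr (- 1 / 2))"
      using Mn n_pos by (intro divide_left_mono mult_right_mono mult_pos_pos) auto
    also have "\<dots> = n powr (0 - (1 + - 1 / 2))"
      using n_pos by (simp only: powr_add powr_diff) simp
    finally show ?thesis by simp
  qed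
  define good where "good = {C. \<exists>d \<Lambda>. \<gamma> / 50 * n / (y * L) \<le> real d \<and> pseudo_distribution {..<n} D d \<Lambda> \<and>
          \<bar>\<Lambda> (val_poly k C) - m\<bar> \<le> 4 * \<delta>}"
  have main: "instance_of E f \<in> good" if f: "f \<in> set_pmf P" and nF: "f \<notin> F1 \<union> F2 \<union> F3 \<union> F4" for f
  proof -
    have fe: "bij_betw \<sigma> {..<k} e \<and> R \<in> \<R>" if e: "e \<in> E" and "f e = Some (\<sigma>, R)" for e \<sigma> R
    proof -
      have "f e \<in> set_pmf (hyperedge_pmf k \<rho> p e)"
        using f e finE by (auto simp: set_Pi_pmf PiE_dflt_def)
      then have "Some (\<sigma>, R) \<in> set_pmf (hyperedge_pmf k \<rho> p e)" using that by simp
      moreover have "finite e" "card e = k" using e finite_subset[of e "{..<n}"] by (auto simp: E)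
      ultimately show ?thesis using set_hyperedge_pmf[of e k \<sigma> R \<rho> p] \<rho> by auto
    qed
    obtain \<Lambda> where \<Lambda>: "pseudo_distribution {..<n} D (2 * r) \<Lambda>"
      "\<bar>\<Lambda> (val_poly k (instance_of E f)) - (\<Sum>e\<in>?S f. g (snd (the (f e)))) / card (?S f)\<bar>
        \<le> card (dense_edges k t \<zeta> N (?S f)) / card (?S f)"
    proof (atomize_elim, unfold g_def, rule sos_solution[OF csp _ t(2) \<nu> \<mu> _ _ fe \<zeta>_bounds(1) N_props(1,2) r_ge(2)])
      show "e \<in> E \<Longrightarrow> e \<subseteq> {..<n} \<and> card e = k" for e by (simp add: E)
      fix X assume "X \<subseteq> ?S f" "X \<noteq> {}" "card X \<le> 2 * N"
      then show "(2 * real k - real t - 1 + \<zeta>) * card X \<le> 2 * card (\<Union>X)"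
        using nF by (auto simp: F1_def expanding_def)
    qed (use t in auto)
    have "\<not> M / 2 \<le> \<bar>card (?S f) - M\<bar>" using nF by (simp add: F3_def Zsel)
    then have S: "M / 2 < card (?S f)" by linarith
    have S0: "0 < real (card (?S f))" using S M by linarith
    have "\<bar>\<Lambda> (val_poly k (instance_of E f)) - m\<bar>
        \<le> card (dense_edges k t \<zeta> N (?S f)) / card (?S f) + \<bar>(\<Sum>e\<in>?S f. g (snd (the (f e)))) / card (?S f) - m\<bar>"
      using \<Lambda>(2) by linarith
    also have "(\<Sum>e\<in>?S f. g (snd (the (f e)))) / card (?S f) - m = Y f / card (?S f)"
      using S0 unfolding Ysel by (simp add: field_simps)
    also have "card (dense_edges k t \<zeta> N (?S f)) / card (?S f) + \<bar>Y f / card (?S f)\<bar>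
        = (card (dense_edges k t \<zeta> N (?S f)) + \<bar>Y f\<bar>) / card (?S f)"
      by (simp add: add_divide_distrib)
    \<comment> \<open>Dense edges and the fluctuation of the planted value cost
      \<open>M * \<delta>\<close> each, spread over more than \<open>M / 2\<close>
      constraints.\<close>
    also have "\<dots> \<le> (M * \<delta> + M * \<delta>) / (M / 2)"
      using nF S M by (intro frac_le) (auto simp: F2_def F4_def)
    also have "\<dots> = 4 * \<delta>" using M by (simp add: field_simps)
    finally have "\<bar>\<Lambda> (val_poly k (instance_of E f)) - m\<bar> \<le> 4 * \<delta>" .
    moreover have "\<gamma> / 50 * n / (y * L) \<le> real (2 * r)" using r_ge(1) by simp
    ultimately show ?thesis using \<Lambda>(1) unfolding good_def by blast
  qed
  have "1 = measure_pmf.prob P UNIV" by simp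
  also have "\<dots> = measure_pmf.prob P ((instance_of E -` good) \<union> (F1 \<union> F2 \<union> F3 \<union> F4))"
    by (rule prob_eqI) (use main in blast)
  also have "\<dots> \<le> measure_pmf.prob P (instance_of E -` good) + measure_pmf.prob P (F1 \<union> F2 \<union> F3 \<union> F4)"
    by (rule prob_Un_le)
  also have "measure_pmf.prob P (F1 \<union> F2 \<union> F3 \<union> F4)
      \<le> measure_pmf.prob P F1 + measure_pmf.prob P F2 + measure_pmf.prob P F3 + measure_pmf.prob P F4"
    using prob_Un_le[of P "F1 \<union> F2 \<union> F3" F4] prob_Un_le[of P "F1 \<union> F2" F3] prob_Un_le[of P F1 F2] by linarith
  finally have "1 \<le> measure_pmf.prob P (instance_of E -` good)
      + ((y / (\<gamma> * n)) powr (1 / 4) + 2 * n powr (- 1 / 4) + 4 / n + n powr (- 1 / 2))"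
    using P1 P2 P3 P4 by linarith
  moreover have "measure_pmf.prob P (instance_of E -` good) = measure_pmf.prob (random_instance k n p \<rho>) good"
    by (simp add: random_instance_eq E)
  ultimately show ?thesis unfolding good_def \<delta>_def by simp
qed

end

section \<open>Approximating the optimum\<close>

text \<open>A diagonal choice: at \<open>n\<close> take the smallest tolerance
  \<open>1 / Suc j\<close>, with \<open>j \<le> n\<close>, that is good from \<open>n\<close>
  on.\<close>

lemma diagonal_tolerance:
  fixes Q :: "nat \<Rightarrow> real \<Rightarrow> real"
  assumes le1: "\<And>n \<tau>. Q n \<tau> \<le> 1" and lim: "\<And>\<tau>. 0 < \<tau> \<Longrightarrow> (\<lambda>n. Q n \<tau>) \<longlonglongrightarrow> 1"
  shows "\<exists>\<epsilon>. \<epsilon> \<longlonglongrightarrow> 0 \<and> (\<lambda>n. Q n (\<epsilon> n)) \<longlonglongrightarrow> 1"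
proof -
  define ok where "ok j n \<longleftrightarrow> (\<forall>m\<ge>n. 1 - 1 / Suc j \<le> Q m (1 / Suc j))" for j n :: nat
  have ok: "\<exists>n. ok j n" for j
  proof -
    have "\<forall>\<^sub>F n in sequentially. 1 - 1 / Suc j < Q n (1 / Suc j)"
      by (rule order_tendstoD(1)[OF lim]) auto
    then show ?thesis unfolding ok_def eventually_sequentially by (meson less_imp_le)
  qed
  have ok_mono: "ok j n'" if "ok j n" "n \<le> n'" for j n n' using that by (auto simp: ok_def)
  \<comment> \<open>Inserting 0 keeps the maximum defined when no \<open>j\<close> qualifies, so
    \<open>ok (J n) n\<close> holds only eventually.\<close>
  define J where "J n = Max (insert 0 {j. j \<le> n \<and> ok j n})" for n
  have fin: "finite (insert 0 {j. j \<le> n \<and> ok j n})" for n by simp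
  have J_ge: "\<forall>\<^sub>F n in sequentially. j \<le> J n" for j
  proof -
    obtain n0 where n0: "ok j n0" using ok by blast
    have "j \<le> J n" if "max n0 j \<le> n" for n
      unfolding J_def using that ok_mono[OF n0, of n] by (intro Max_ge[OF fin]) auto
    then show ?thesis unfolding eventually_sequentially by blast
  qed
  have J_ok: "\<forall>\<^sub>F n in sequentially. ok (J n) n"
  proof -
    obtain n0 where n0: "ok 0 n0" using ok by blast
    have "ok (J n) n" if "n0 \<le> n" for n
      using Max_in[OF fin, of n] ok_mono[OF n0 that] by (auto simp: J_def)
    then show ?thesis unfolding eventually_sequentially by blast
  qed
  define \<epsilon> where "\<epsilon> n = 1 / real (Suc (J n))" for n
  have \<epsilon>: "\<epsilon> \<longlonglongrightarrow> 0"
  proof (rule order_tendstoI)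
    fix a :: real assume "0 < a"
    then obtain j where j: "1 / real (Suc j) < a" using nat_approx_posE by blast
    show "\<forall>\<^sub>F n in sequentially. \<epsilon> n < a"
      using J_ge[of j]
    proof eventually_elim
      case (elim n)
      then have "\<epsilon> n \<le> 1 / real (Suc j)" unfolding \<epsilon>_def by (intro divide_left_mono) auto
      then show ?case using j by linarith
    qed
  qed (auto simp: \<epsilon>_def intro!: always_eventually less_le_trans[of _ 0])
  have "(\<lambda>n. Q n (\<epsilon> n)) \<longlonglongrightarrow> 1"
  proof (rule tendsto_sandwich)
    show "(\<lambda>n. 1 - \<epsilon> n) \<longlonglongrightarrow> 1" using tendsto_diff[OF tendsto_const \<epsilon>, of 1] by simp
    show "\<forall>\<^sub>F n in sequentially. 1 - \<epsilon> n \<le> Q n (\<epsilon> n)"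
      using J_ok by eventually_elim (auto simp: ok_def \<epsilon>_def)
  qed (use le1 in auto)
  then show ?thesis using \<epsilon> by blast
qed

text \<open>Nearly attaining the supremum replaces a compactness argument, and it suffices because
  the tolerance is sent to 0 afterwards. The point mass at a constant assignment shows that the set
  of values is nonempty.\<close>

lemma opt_approx:
  assumes csp: "is_csp k D \<R>" and \<rho>: "set_pmf \<rho> \<subseteq> \<R>" and \<tau>: "0 < \<tau>"
  obtains \<nu> \<mu> where "set_pmf \<nu> \<subseteq> D"
    "\<forall>R\<in>\<R>. set_pmf (\<mu> R) \<subseteq> tuples k D \<and> twise_independent k t \<nu> (\<mu> R)"
    "\<bar>measure_pmf.expectation \<rho> (\<lambda>R. measure_pmf.prob (\<mu> R) R) - opt k D \<R> t \<rho>\<bar> \<le> \<tau>"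
proof -
  define X where "X = {measure_pmf.expectation \<rho> (\<lambda>R. measure_pmf.prob (\<mu> R) R) | \<nu> \<mu>.
            set_pmf \<nu> \<subseteq> D \<and>
            (\<forall>R\<in>\<R>. set_pmf (\<mu> R) \<subseteq> tuples k D \<and> twise_independent k t \<nu> (\<mu> R))}"
  have opt: "opt k D \<R> t \<rho> = Sup X" by (simp add: opt_def X_def)
  obtain a where a: "a \<in> D" using csp by (auto simp: is_csp_def)
  define \<mu>0 where "\<mu>0 = return_pmf (\<lambda>i. if i < k then a else undefined)"
  have "twise_independent k t (return_pmf a) \<mu>0"
    unfolding twise_independent_def \<mu>0_def
  proof (intro allI impI)
    fix T assume T: "T \<subseteq> {..<k} \<and> card T = t"
    then have "finite T" using finite_subset by blast
    then show "map_pmf (\<lambda>x. restrict x T) (return_pmf (\<lambda>i. if i < k then a else undefined))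
        = Pi_pmf T undefined (\<lambda>_. return_pmf a)"
      using T by (auto simp: fun_eq_iff restrict_def)
  qed
  moreover have "set_pmf \<mu>0 \<subseteq> tuples k D" using a by (auto simp: \<mu>0_def PiE_iff extensional_def)
  ultimately have "measure_pmf.expectation \<rho> (\<lambda>R. measure_pmf.prob \<mu>0 R) \<in> X"
    unfolding X_def using a by (intro CollectI exI[of _ "return_pmf a"] exI[of _ "\<lambda>_. \<mu>0"]) auto
  then have ne: "X \<noteq> {}" by blast
  have int: "integrable (measure_pmf \<rho>) (\<lambda>R. measure_pmf.prob (\<mu> R) R)" for \<mu> :: "'a relation \<Rightarrow> (nat \<Rightarrow> 'a) pmf"
    by (rule integrable_bounded_pmf[of _ 1]) auto
  have "x \<le> 1" if "x \<in> X" for x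
    using that unfolding X_def by (auto intro!: measure_pmf.integral_le_const[OF int])
  then have bdd: "bdd_above X" by (intro bdd_aboveI)
  have "Sup X - \<tau> < Sup X" using \<tau> by simp
  from less_cSupD[OF ne this] obtain x where x: "x \<in> X" "Sup X - \<tau> < x" by blast
  then obtain \<nu> \<mu> where \<nu>\<mu>: "x = measure_pmf.expectation \<rho> (\<lambda>R. measure_pmf.prob (\<mu> R) R)"
    "set_pmf \<nu> \<subseteq> D" "\<forall>R\<in>\<R>. set_pmf (\<mu> R) \<subseteq> tuples k D \<and> twise_independent k t \<nu> (\<mu> R)"
    unfolding X_def by blast
  have "x \<le> Sup X" using x bdd by (intro cSup_upper)
  then have "\<bar>x - Sup X\<bar> \<le> \<tau>" using x(2) by linarith
  then show thesis using that[of \<nu> \<mu>] \<nu>\<mu> unfolding opt by blast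
qed

text \<open>The density \<open>\<Delta>\<close> may vary with \<open>n\<close>. The last eventual
  condition says that the promised degree is at least \<open>k\<close>, so that it covers the value
  polynomial; the proof also draws from it that \<open>\<Delta> n powr (2 / (real t - 1))\<close> is
  \<open>o(n)\<close>.\<close>

theorem theorem1p2:
  fixes k :: nat
  shows "\<exists>c>0. \<forall>(t::nat) (D::nat set) (\<R>::nat relation set) (\<rho>::nat relation pmf) (\<Delta>::nat \<Rightarrow> real).
    2 \<le> t \<and> t \<le> k \<and> is_csp k D \<R> \<and> set_pmf \<rho> \<subseteq> \<R> \<and>
    (\<forall>\<^sub>F n in sequentially.
       2 \<le> \<Delta> n \<and> \<Delta> n * real n \<le> real (n choose k) \<and>
       real k \<le> c * real n / (\<Delta> n powr (2 / (real t - 1)) * ln (\<Delta> n)))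
    \<longrightarrow>
    (\<exists>\<epsilon>::nat \<Rightarrow> real. \<epsilon> \<longlonglongrightarrow> 0 \<and>
      (\<lambda>n. measure_pmf.prob (random_instance k n (\<Delta> n * real n / real (n choose k)) \<rho>)
         {C. \<exists>(d::nat) \<mu>.
            c * real n / (\<Delta> n powr (2 / (real t - 1)) * ln (\<Delta> n)) \<le> real d \<and>
            pseudo_distribution {..<n} D d \<mu> \<and>
            \<bar>\<mu> (val_poly k C) - opt k D \<R> t \<rho>\<bar> \<le> \<epsilon> n}) \<longlonglongrightarrow> 1)"
proof (cases "2 \<le> k")
  case False
  then show ?thesis by (intro exI[of _ 1]) auto
next
  case k: True
  define \<gamma> where "\<gamma> = (1 / (8 * growth k)) ^ 4"
  have \<gamma>: "0 < \<gamma>" using growth_ge(2)[of k] k by (simp add: \<gamma>_def)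
  show ?thesis
  proof (intro exI[of _ "\<gamma> / 50"] conjI allI impI, goal_cases)
    case 1
    show ?case using \<gamma> by simp
  next
    case (2 t D \<R> \<rho> \<Delta>)
    then have t: "2 \<le> t" "t \<le> k" and csp: "is_csp k D \<R>" and \<rho>: "set_pmf \<rho> \<subseteq> \<R>"
      and ev: "\<forall>\<^sub>F n in sequentially. 2 \<le> \<Delta> n \<and> \<Delta> n * real n \<le> real (n choose k) \<and>
         real k \<le> \<gamma> / 50 * real n / (\<Delta> n powr (2 / (real t - 1)) * ln (\<Delta> n))" by auto
    define y where "y n = \<Delta> n powr (2 / (real t - 1))" for n
    have y0: "(\<lambda>n. y n / n) \<longlonglongrightarrow> 0"
    proof (rule order_tendstoI)
      fix a :: real assume a: "0 < a"
      \<comment> \<open>A threshold for \<open>ln (\<Delta> n)\<close>. Above it the degree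
        condition alone forces \<open>y n / n < a\<close>; below it \<open>y n\<close> is at most
        the constant \<open>exp (2 * B)\<close>.\<close>
      define B where "B = \<gamma> / 50 / (real k * a)"
      have B: "0 < B" using \<gamma> a k by (simp add: B_def)
      have "(\<lambda>n. exp (2 * B) / real n) \<longlonglongrightarrow> 0" by (rule lim_const_over_n)
      then have "\<forall>\<^sub>F n in sequentially. exp (2 * B) / real n < a" using a by (rule order_tendstoD)
      then show "\<forall>\<^sub>F n in sequentially. y n / n < a"
        using ev eventually_gt_at_top[of 0]
      proof eventually_elim
        case (elim n)
        have L: "0 < ln (\<Delta> n)" using elim by simp
        have y: "0 < y n" using elim by (simp add: y_def)
        show ?case
        proof (cases "B < ln (\<Delta> n)")
          case True
          have "real k * (y n * ln (\<Delta> n)) \<le> \<gamma> / 50 * n"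
            using elim L y by (simp add: y_def[symmetric] pos_le_divide_eq)
          then have "y n / n \<le> \<gamma> / 50 / (real k * ln (\<Delta> n))"
            using k L elim by (simp add: field_simps)
          also have "\<dots> < \<gamma> / 50 / (real k * B)"
            using True B k \<gamma> by (intro divide_strict_left_mono) auto
          also have "\<dots> = a" using k a \<gamma> by (simp add: B_def)
          finally show ?thesis .
        next
          case False
          have "1 \<le> real t - 1" using t by linarith
          then have "2 / (real t - 1) \<le> 2" by (simp add: field_simps)
          then have "y n \<le> \<Delta> n powr 2" unfolding y_def using elim by (intro powr_mono) auto
          also have "\<dots> = exp (2 * ln (\<Delta> n))" using elim by (simp add: powr_def)
          also have "\<dots> \<le> exp (2 * B)" using False by simp
          finally have "y n / n \<le> exp (2 * B) / n" by (intro divide_right_mono) auto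
          then show ?thesis using elim by linarith
        qed
      qed
    qed (auto simp: y_def intro!: always_eventually less_le_trans[of _ 0])
    define err where "err n = (y n / (\<gamma> * n)) powr (1 / 4) + 2 * real n powr (- 1 / 4) + 4 / n + real n powr (- 1 / 2)" for n :: nat
    have real_top: "filterlim real at_top sequentially" by (rule filterlim_real_sequentially)
    have "(\<lambda>n. y n / (\<gamma> * real n)) \<longlonglongrightarrow> 0"
      using tendsto_divide[OF y0 tendsto_const[of \<gamma>]] \<gamma> by (simp add: mult.commute)
    then have "(\<lambda>n. (y n / (\<gamma> * n)) powr (1 / 4)) \<longlonglongrightarrow> 0"
      by (rule tendsto_zero_powrI[OF _ tendsto_const]) (use \<gamma> in \<open>auto simp: y_def\<close>)
    moreover have "(\<lambda>n. real n powr s) \<longlonglongrightarrow> 0" if "s < 0" for s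
      using that real_top by (rule tendsto_neg_powr)
    ultimately have "err \<longlonglongrightarrow> 0 + 2 * 0 + 0 + 0"
      unfolding err_def by (intro tendsto_add tendsto_mult tendsto_const lim_const_over_n) auto
    then have err: "err \<longlonglongrightarrow> 0" by simp
    define Q where "Q n \<tau> = measure_pmf.prob (random_instance k n (\<Delta> n * real n / real (n choose k)) \<rho>)
         {C. \<exists>(d::nat) \<mu>.
            \<gamma> / 50 * real n / (\<Delta> n powr (2 / (real t - 1)) * ln (\<Delta> n)) \<le> real d \<and>
            pseudo_distribution {..<n} D d \<mu> \<and>
            \<bar>\<mu> (val_poly k C) - opt k D \<R> t \<rho>\<bar> \<le> \<tau>}" for n :: nat and \<tau> :: real
    have "(\<lambda>n. Q n \<tau>) \<longlonglongrightarrow> 1" if \<tau>: "0 < \<tau>" for \<tau>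
    proof -
      \<comment> \<open>Half of the tolerance pays for the distance to the optimum, half for the
        random error. The near-optimal \<open>\<nu>\<close> and \<open>\<mu>\<close> depend on
        \<open>\<tau>\<close> but not on \<open>n\<close>, and \<open>err\<close> does not depend on
        them.\<close>
      have "0 < \<tau> / 2" using \<tau> by simp
      then obtain \<nu> \<mu> where \<nu>: "set_pmf \<nu> \<subseteq> D"
        and \<mu>: "\<forall>R\<in>\<R>. set_pmf (\<mu> R) \<subseteq> tuples k D \<and> twise_independent k t \<nu> (\<mu> R)"
        and m: "\<bar>measure_pmf.expectation \<rho> (\<lambda>R. measure_pmf.prob (\<mu> R) R) - opt k D \<R> t \<rho>\<bar> \<le> \<tau> / 2"
        by (rule opt_approx[OF csp \<rho>, where t = t])
      have lim4: "(\<lambda>n. 4 * real n powr (- 1 / 4)) \<longlonglongrightarrow> 4 * 0"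
        by (intro tendsto_mult tendsto_const tendsto_neg_powr real_top) simp
      have "\<forall>\<^sub>F n in sequentially. 4 * real n powr (- 1 / 4) < \<tau> / 2"
        by (rule order_tendstoD(2)[OF lim4]) (use \<tau> in simp)
      then have lower: "\<forall>\<^sub>F n in sequentially. 1 - err n \<le> Q n \<tau>"
        using ev eventually_ge_at_top[of k]
      proof eventually_elim
        case (elim n)
        define m where "m = measure_pmf.expectation \<rho> (\<lambda>R. measure_pmf.prob (\<mu> R) R)"
        interpret random_csp k t n "\<Delta> n" \<gamma> "y n" "ln (\<Delta> n)" "1 / (4 * ln (\<Delta> n))" \<rho> D \<R>
          "\<Delta> n * real n / real (n choose k)" "all_edges k n"
          by unfold_locales (use elim t csp \<rho> in \<open>auto simp: y_def \<gamma>_def\<close>)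
        have "1 - err n \<le> measure_pmf.prob (random_instance k n (\<Delta> n * real n / real (n choose k)) \<rho>)
          {C. \<exists>d \<Lambda>. \<gamma> / 50 * n / (y n * ln (\<Delta> n)) \<le> real d \<and> pseudo_distribution {..<n} D d \<Lambda> \<and>
            \<bar>\<Lambda> (val_poly k C) - m\<bar> \<le> 4 * n powr (- 1 / 4)}"
          unfolding err_def m_def by (rule prob_sos_solution[OF \<nu>]) (use \<mu> in blast)
        also have "\<dots> \<le> Q n \<tau>"
          unfolding Q_def y_def
        proof (rule measure_pmf.finite_measure_mono, safe)
          fix C d \<Lambda>
          assume d: "\<gamma> / 50 * real n / (\<Delta> n powr (2 / (real t - 1)) * ln (\<Delta> n)) \<le> real d"
            and pd: "pseudo_distribution {..<n} D d \<Lambda>"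
            and v: "\<bar>\<Lambda> (val_poly k C) - m\<bar> \<le> 4 * real n powr (- 1 / 4)"
          have "\<bar>m - opt k D \<R> t \<rho>\<bar> \<le> \<tau> / 2"
            using \<open>\<bar>measure_pmf.expectation \<rho> _ - _\<bar> \<le> \<tau> / 2\<close> by (simp add: m_def)
          then have "\<bar>\<Lambda> (val_poly k C) - opt k D \<R> t \<rho>\<bar> \<le> \<tau>" using v elim(1) by linarith
          then show "\<exists>d \<mu>. \<gamma> / 50 * real n / (\<Delta> n powr (2 / (real t - 1)) * ln (\<Delta> n)) \<le> real d \<and>
              pseudo_distribution {..<n} D d \<mu> \<and> \<bar>\<mu> (val_poly k C) - opt k D \<R> t \<rho>\<bar> \<le> \<tau>"
            using d pd by blast
        qed simp
        finally show ?case .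
      qed
      show ?thesis
      proof (rule tendsto_sandwich[OF lower])
        show "(\<lambda>n. 1 - err n) \<longlonglongrightarrow> 1" using tendsto_diff[OF tendsto_const err, of 1] by simp
      qed (auto simp: Q_def)
    qed
    then have "\<exists>\<epsilon>. \<epsilon> \<longlonglongrightarrow> 0 \<and> (\<lambda>n. Q n (\<epsilon> n)) \<longlonglongrightarrow> 1"
      by (intro diagonal_tolerance) (auto simp: Q_def)
    then show ?case unfolding Q_def .
  qed
qed

end
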